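(* Suppose that $\Omega$ is a bounded domain in $\mathbb R^{2n}$ with $C^2$ boundary, and that $f$ is a continuous $\mathbb S^+$-valued function of class $W^{1,2}(U)$ for a domain $U$ with $\overline\Omega\subset U\subset\mathbb R^{2n}$. Let $n(\mathbf y)=(n_{01},\dots,n_{0n},n_{11},\dots,n_{1n})(\mathbf y)$ be the unit outer normal vector to $\partial\Omega$ and $n_A=\sum_{j=1}^n\gamma_jn_{Aj}$ for $A=0,1$. Then for $\mathbf x\in\Omega$, $$f(\mathbf x)=-\int_{\partial\Omega}H(\mathbf x-\mathbf y)\begin{pmatrix}n_0\\ n_1\end{pmatrix}(\mathbf y)\,f(\mathbf y)\,{\rm d}S(\mathbf y)+\int_\Omega H(\mathbf x-\mathbf y)\,\mathscr D_0f(\mathbf y)\,{\rm d}V(\mathbf y),$$ where ${\rm d}S$ is the surface measure and ${\rm d}V$ the Lebesgue measure.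
   Context: Let $n\ge3$ be an integer and $m=\lfloor n/2\rfloor$. Let $W$ be a complex vector space with basis $f_1,\dots,f_m$; for $\alpha=\{\alpha_1<\dots<\alpha_h\}\subset\{1,\dots,m\}$ put $f_\alpha=f_{\alpha_1}\wedge\cdots\wedge f_{\alpha_h}$ ($f_\emptyset=1$), a basis of $\wedge^\bullet W$. Let $\varepsilon_j v=f_j\wedge v$, and let $\iota_j f_\alpha=0$ if $j\notin\alpha$, $\iota_j f_\alpha=(-1)^{t+1}f_{\alpha\setminus\{j\}}$ if $j=\alpha_t$. Put $\gamma_{2j-1}=\varepsilon_j-\iota_j$, $\gamma_{2j}=-\mathbf i(\varepsilon_j+\iota_j)$ for $1\le j\le m$ and, if $n=2m+1$, $\gamma_{n}f_\alpha=-\mathbf i(-1)^{\#\alpha}f_\alpha$. The spinor modules are $\mathbb S^+=\wedge^{\rm even}W$, $\mathbb S^-=\wedge^{\rm odd}W$ for $n$ even, and $\mathbb S^+=\mathbb S^-=\wedge^\bullet W$ for $n$ odd. Then $\gamma_j:\mathbb S^\pm\to\mathbb S^\mp$ and $\gamma_j\gamma_k+\gamma_k\gamma_j=-2\delta_{jk}\mathbf 1$. Write points of $\mathbb R^{2n}$ as $\mathbf x=(\mathbf x_0,\mathbf x_1)$ with $\mathbf x_A=(x_{A1},\dots,x_{An})$, $A=0,1$, let $\partial_{Aj}=\partial/\partial x_{Aj}$ and $\nabla_A=\sum_{j=1}^n\gamma_j\partial_{Aj}$. In matrix form $\mathscr D_0=\begin{pmatrix}\nabla_0\\ \nabla_1\end{pmatrix}$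 (from $\mathbb S^+$-valued to $\mathbb C^2\otimes\mathbb S^-$-valued functions), with formal $L^2$-adjoint $\mathscr D_0^*=(\nabla_0,\nabla_1)$. Let $\Delta=-\sum_{A=0,1}\sum_{j=1}^n\partial_{Aj}^2$. Let $G_0(\mathbf x)=C_{2n}|\mathbf x|^{4-2n}$ be the fundamental solution of $\Delta^2$ on $\mathbb R^{2n}$, where $C_{2n}>0$ is the constant determined by $\Delta^2G_0=\delta_{\mathbf 0}$. Let $G_1=\begin{pmatrix}G_0&0\\0&G_0\end{pmatrix}$ and, for $\mathbf x\ne\mathbf 0$, $$H(\mathbf x)=\mathscr D_0^*\mathscr D_0\mathscr D_0^*G_1(\mathbf x)=\Big(\sum_j\gamma_j\partial_{0j}\Delta G_0,\ \sum_j\gamma_j\partial_{1j}\Delta G_0\Big)(\mathbf x)=-8(n-1)(n-2)C_{2n}\Big(\sum_j\frac{\gamma_jx_{0j}}{|\mathbf x|^{2n}},\ \sum_j\frac{\gamma_jx_{1j}}{|\mathbf x|^{2n}}\Big),$$ a row of two endomorphisms acting on columns in $\mathbb C^2\otimes\mathbb S^-$ and giving values in $\mathbb S^+$.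
   Formalization: The volume integral over Ω need not converge absolutely at every x for such f; it is read as the limit as ε→0 of integrals over Ω minus the ball B(x,ε), and as the Lebesgue integral wherever the integrand is integrable, which is shown for almost every x in Ω. *)

theory Defs
  imports "HOL-Analysis.Analysis"
begin

section \<open>Exterior algebra and Clifford generators\<close>

text \<open>
  The linearly ordered finite type \<open>'m\<close> indexes the basis \<open>f\<^sub>1, \<dots>, f\<^sub>m\<close> of \<open>W\<close>, and \<open>complex ^ ('m set)\<close>
  is the exterior algebra of \<open>W\<close>: the coordinate of a vector at \<open>\<alpha>\<close> is its coefficient at \<open>f\<^sub>\<alpha>\<close>.
  The linearly ordered finite type \<open>'n\<close> stands for \<open>{1, \<dots>, n}\<close>.
  The functions below translate between such types and the numbers \<open>1, 2, \<dots>\<close>.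
\<close>

type_synonym 'm ext = "complex ^ ('m set)"

definition pos :: "'a::{finite,linorder} \<Rightarrow> nat" where
  "pos i = card {..i}"

definition elt :: "nat \<Rightarrow> 'a::{finite,linorder}" where
  "elt k = (THE i. pos i = k)"

definition fb :: "'m::{finite,linorder} set \<Rightarrow> 'm ext" where
  "fb \<alpha> = axis \<alpha> 1"

text \<open>For disjoint \<open>\<alpha>\<close>, \<open>\<beta>\<close> the sign of the permutation sorting the juxtaposition of \<open>\<alpha>\<close> and \<open>\<beta>\<close>
  is determined by the number of inversions.\<close>

definition wedge :: "'m::{finite,linorder} ext \<Rightarrow> 'm ext \<Rightarrow> 'm ext" where
  "wedge u v = (\<Sum>\<alpha>\<in>UNIV. \<Sum>\<beta>\<in>UNIV.
     if \<alpha> \<inter> \<beta> = {} then (u $ \<alpha> * v $ \<beta> * (-1) ^ card {(i, j) \<in> \<alpha> \<times> \<beta>. j < i}) *s fb (\<alpha> \<union> \<beta>) else 0)"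

definition eps :: "'m::{finite,linorder} \<Rightarrow> 'm ext \<Rightarrow> 'm ext" where
  "eps j v = wedge (fb {j}) v"

text \<open>If \<open>j = \<alpha>\<^sub>t\<close> in the increasing enumeration of \<open>\<alpha>\<close>, then \<open>t = card {i \<in> \<alpha>. i \<le> j}\<close>.\<close>

definition iota :: "'m::{finite,linorder} \<Rightarrow> 'm ext \<Rightarrow> 'm ext" where
  "iota j v = (\<Sum>\<alpha>\<in>UNIV.
     if j \<in> \<alpha> then (v $ \<alpha> * (-1) ^ (card {i \<in> \<alpha>. i \<le> j} + 1)) *s fb (\<alpha> - {j}) else 0)"

text \<open>The first case is the additional generator for odd \<open>n\<close>; the second and third are
  \<open>\<gamma>\<^bsub>2k-1\<^esub>\<close> and \<open>\<gamma>\<^bsub>2k\<^esub>\<close>.  Intended for \<open>CARD('m) = CARD('n) div 2\<close>.\<close>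

definition gamma :: "'n::{finite,linorder} \<Rightarrow> 'm::{finite,linorder} ext \<Rightarrow> 'm ext" where
  "gamma j v =
     (if odd CARD('n) \<and> pos j = CARD('n) then (\<chi> \<alpha>. - \<i> * (-1) ^ card \<alpha> * v $ \<alpha>)
      else if odd (pos j) then eps (elt ((pos j + 1) div 2)) v - iota (elt ((pos j + 1) div 2)) v
      else (- \<i>) *s (eps (elt (pos j div 2)) v + iota (elt (pos j div 2)) v))"

definition spinor_plus :: "nat \<Rightarrow> 'm::{finite,linorder} ext set" where
  "spinor_plus n = (if even n then {v. \<forall>\<alpha>. odd (card \<alpha>) \<longrightarrow> v $ \<alpha> = 0} else UNIV)"


section \<open>Differential operators\<close>

text \<open>A point \<open>x :: 'n pt\<close> of \<open>\<real>\<^bsup>2n\<^esup>\<close> has the coordinates \<open>x $ A $ j\<close>; the two elements of the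
  type \<open>2\<close> are \<open>0\<close> and \<open>1\<close>.  The norm and \<open>lebesgue\<close> are the Euclidean ones.\<close>

type_synonym 'n pt = "(real ^ 'n) ^ 2"

definition partial :: "2 \<Rightarrow> 'n::finite \<Rightarrow> ('n pt \<Rightarrow> 'b::real_normed_vector) \<Rightarrow> 'n pt \<Rightarrow> 'b" where
  "partial A j u x = frechet_derivative u (at x) (axis A (axis j 1))"

text \<open>\<open>D0\<close> has the partial derivative operators as an argument, since it is used both with the classical
  ones (in the kernel) and with the weak ones (for Sobolev functions).\<close>

definition D0 :: "(2 \<Rightarrow> 'n::{finite,linorder} \<Rightarrow> ('n pt \<Rightarrow> 'm ext) \<Rightarrow> 'n pt \<Rightarrow> 'm ext)
    \<Rightarrow> ('n pt \<Rightarrow> 'm::{finite,linorder} ext) \<Rightarrow> 'n pt \<Rightarrow> 'm ext ^ 2" where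
  "D0 d u x = (\<chi> A. \<Sum>j\<in>UNIV. gamma j (d A j u x))"

definition D0_adj :: "('n::{finite,linorder} pt \<Rightarrow> 'm::{finite,linorder} ext ^ 2) \<Rightarrow> 'n pt \<Rightarrow> 'm ext" where
  "D0_adj u x = (\<Sum>A\<in>UNIV. \<Sum>j\<in>UNIV. gamma j (partial A j (\<lambda>z. u z $ A) x))"

definition Delta :: "('n::finite pt \<Rightarrow> real) \<Rightarrow> 'n pt \<Rightarrow> real" where
  "Delta u x = - (\<Sum>A\<in>UNIV. \<Sum>j\<in>UNIV. partial A j (partial A j u) x)"

definition normal_column :: "'n::{finite,linorder} pt \<Rightarrow> 'm::{finite,linorder} ext \<Rightarrow> 'm ext ^ 2" where
  "normal_column \<nu> v = (\<chi> A. \<Sum>j\<in>UNIV. (\<nu> $ A $ j) *\<^sub>R gamma j v)"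


section \<open>Test functions, the fundamental solution and the kernel\<close>

primrec Ck :: "nat \<Rightarrow> ('a::euclidean_space \<Rightarrow> real) \<Rightarrow> bool" where
  "Ck 0 u = continuous_on UNIV u"
| "Ck (Suc k) u = ((\<forall>x. u differentiable (at x)) \<and>
     (\<forall>b\<in>Basis. Ck k (\<lambda>x. frechet_derivative u (at x) b)))"

definition test_function :: "'a::euclidean_space set \<Rightarrow> ('a \<Rightarrow> real) \<Rightarrow> bool" where
  "test_function U \<phi> \<longleftrightarrow>
     (\<forall>k. Ck k \<phi>) \<and> compact (closure {x. \<phi> x \<noteq> 0}) \<and> closure {x. \<phi> x \<noteq> 0} \<subseteq> U"

definition locally_integrable :: "'a::euclidean_space set \<Rightarrow> ('a \<Rightarrow> 'b::euclidean_space) \<Rightarrow> bool" where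
  "locally_integrable U u \<longleftrightarrow> (\<forall>K. compact K \<and> K \<subseteq> U \<longrightarrow> set_integrable lebesgue K u)"

definition fundamental_solution_Delta2 :: "('n::finite pt \<Rightarrow> real) \<Rightarrow> bool" where
  "fundamental_solution_Delta2 G \<longleftrightarrow> locally_integrable UNIV G \<and>
     (\<forall>\<phi>. test_function UNIV \<phi> \<longrightarrow> (LINT y|lebesgue. G y * Delta (Delta \<phi>) y) = \<phi> 0)"

definition G0 :: "real \<Rightarrow> 'n::finite pt \<Rightarrow> real" where
  "G0 C x = C * norm x powr (4 - 2 * real CARD('n))"

text \<open>The row \<open>H(x)\<close> applied to a column \<open>w\<close>: \<open>G\<^sub>1\<close> is the scalar matrix \<open>G\<^sub>0\<close> times the identity, and a
  differential operator acts on a matrix-valued function column by column, so that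
  \<open>(\<D>\<^sub>0* \<D>\<^sub>0 \<D>\<^sub>0* G\<^sub>1)(x) w = (\<D>\<^sub>0* \<D>\<^sub>0 \<D>\<^sub>0* (G\<^sub>1 w))(x)\<close>.  Meaningful for \<open>x \<noteq> 0\<close>.\<close>

definition H :: "real \<Rightarrow> 'n::{finite,linorder} pt \<Rightarrow> 'm::{finite,linorder} ext ^ 2 \<Rightarrow> 'm ext" where
  "H C x w = D0_adj (D0 partial (D0_adj (\<lambda>z. G0 C z *\<^sub>R w))) x"


section \<open>Weak derivatives\<close>

definition has_weak_partial ::
  "'n::finite pt set \<Rightarrow> 2 \<Rightarrow> 'n \<Rightarrow> ('n pt \<Rightarrow> 'b::euclidean_space) \<Rightarrow> ('n pt \<Rightarrow> 'b) \<Rightarrow> bool" where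
  "has_weak_partial U A j u g \<longleftrightarrow> locally_integrable U u \<and> locally_integrable U g \<and>
     (\<forall>\<phi>. test_function U \<phi> \<longrightarrow>
       (LINT y:U|lebesgue. partial A j \<phi> y *\<^sub>R u y) = - (LINT y:U|lebesgue. \<phi> y *\<^sub>R g y))"

text \<open>Weak derivatives are unique only almost everywhere on \<open>U\<close>; this picks one version.\<close>

definition weak_partial ::
  "'n::finite pt set \<Rightarrow> 2 \<Rightarrow> 'n \<Rightarrow> ('n pt \<Rightarrow> 'b::euclidean_space) \<Rightarrow> 'n pt \<Rightarrow> 'b" where
  "weak_partial U A j u = (SOME g. has_weak_partial U A j u g)"

definition L2_on :: "'a::euclidean_space set \<Rightarrow> ('a \<Rightarrow> 'b::euclidean_space) \<Rightarrow> bool" where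
  "L2_on U u \<longleftrightarrow> set_borel_measurable lebesgue U u \<and> set_integrable lebesgue U (\<lambda>x. (norm (u x))\<^sup>2)"

definition W12 :: "'n::finite pt set \<Rightarrow> ('n pt \<Rightarrow> 'b::euclidean_space) \<Rightarrow> bool" where
  "W12 U u \<longleftrightarrow> L2_on U u \<and>
     (\<forall>A j. (\<exists>g. has_weak_partial U A j u g) \<and> L2_on U (weak_partial U A j u))"


section \<open>Domains with twice continuously differentiable boundary\<close>

definition domain :: "'a::euclidean_space set \<Rightarrow> bool" where
  "domain U \<longleftrightarrow> open U \<and> connected U \<and> U \<noteq> {}"

definition grad :: "('a::euclidean_space \<Rightarrow> real) \<Rightarrow> 'a \<Rightarrow> 'a" where
  "grad u x = (\<Sum>b\<in>Basis. frechet_derivative u (at x) b *\<^sub>R b)"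

text \<open>Within \<open>V\<close>, and up to relabelling and reorienting the coordinate axes, \<open>\<Omega>\<close> is the region below the
  graph of a \<open>C\<^sup>2\<close> function \<open>g\<close> of the remaining coordinates.  The direction \<open>e\<close> is a coordinate vector
  or its negative; \<open>g\<close> is a function on the whole space that does not depend on the coordinate along \<open>e\<close>.\<close>

definition C2_graph :: "'a::euclidean_space set \<Rightarrow> 'a set \<Rightarrow> 'a \<Rightarrow> ('a \<Rightarrow> real) \<Rightarrow> bool" where
  "C2_graph \<Omega> V e g \<longleftrightarrow> open V \<and> (e \<in> Basis \<or> - e \<in> Basis) \<and> Ck 2 g \<and>
     (\<forall>x t. g (x + t *\<^sub>R e) = g x) \<and> \<Omega> \<inter> V = {x \<in> V. x \<bullet> e < g x}"

definition C2_boundary :: "'a::euclidean_space set \<Rightarrow> bool" where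
  "C2_boundary \<Omega> \<longleftrightarrow> (\<forall>p\<in>frontier \<Omega>. \<exists>V e g. p \<in> V \<and> C2_graph \<Omega> V e g)"

text \<open>\<open>grad g y\<close> is orthogonal to \<open>e\<close>, so \<open>\<nu>\<close> has norm \<open>1\<close>.\<close>

definition unit_outer_normal :: "'a::euclidean_space set \<Rightarrow> 'a \<Rightarrow> 'a \<Rightarrow> bool" where
  "unit_outer_normal \<Omega> y \<nu> \<longleftrightarrow> (\<exists>V e g. y \<in> V \<and> C2_graph \<Omega> V e g \<and>
     \<nu> = (e - grad g y) /\<^sub>R sqrt (1 + (norm (grad g y))\<^sup>2))"

text \<open>Lebesgue measure of codimension one on the coordinate hyperplane orthogonal to \<open>e\<close>,
  as a measure on the whole space (compare the definition of \<open>lborel\<close>).\<close>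

definition hyperplane_lborel :: "'a::euclidean_space \<Rightarrow> 'a measure" where
  "hyperplane_lborel e =
     distr (\<Pi>\<^sub>M b\<in>Basis - {e, - e}. lborel) borel (\<lambda>c. \<Sum>b\<in>Basis - {e, - e}. c b *\<^sub>R b)"

text \<open>The surface measure is the Borel measure on \<open>frontier \<Omega>\<close> that in every local graph representation
  is given by the area element \<open>sqrt (1 + |grad g|\<^sup>2)\<close>.  The charts cover a \<open>C\<^sup>2\<close> boundary, hence this
  determines \<open>S\<close> uniquely.\<close>

definition surface_measure :: "'a::euclidean_space set \<Rightarrow> 'a measure \<Rightarrow> bool" where
  "surface_measure \<Omega> S \<longleftrightarrow> sets S = sets (restrict_space borel (frontier \<Omega>)) \<and>
     (\<forall>V e g. C2_graph \<Omega> V e g \<longrightarrow>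
       (\<forall>A\<in>sets borel. A \<subseteq> frontier \<Omega> \<inter> V \<longrightarrow>
         emeasure S A = (\<integral>\<^sup>+ x. indicator A (x + g x *\<^sub>R e) *
           ennreal (sqrt (1 + (norm (grad g x))\<^sup>2)) \<partial>hyperplane_lborel e)))"


section \<open>Integrals that are improper at a point\<close>

text \<open>If \<open>F\<close> is Lebesgue integrable over \<open>\<Omega>\<close>, then \<open>I\<close> is its Lebesgue integral.\<close>

definition has_singular_integral ::
  "('a::euclidean_space \<Rightarrow> 'b::euclidean_space) \<Rightarrow> 'b \<Rightarrow> 'a set \<Rightarrow> 'a \<Rightarrow> bool" where
  "has_singular_integral F I \<Omega> x \<longleftrightarrow>
     (\<forall>\<epsilon>>0. set_integrable lebesgue (\<Omega> - ball x \<epsilon>) F) \<and>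
     ((\<lambda>\<epsilon>. LINT y:(\<Omega> - ball x \<epsilon>)|lebesgue. F y) \<longlongrightarrow> I) (at_right 0)"

end

theory Submission
  imports Defs
begin

text \<open>
  By the Clifford relations the entries of \<open>H(z)\<close> are \<open>c \<Sum>\<^sub>j \<gamma>\<^sub>j z $ A $ j / |z|\<^bsup>2n\<^esup>\<close>, where \<open>c = - 8 (n - 1) (n - 2) C\<close>: a symmetric
  expression in products of two generators collapses to its trace.  The same collapse shows that in the divergence
  theorem for \<open>p(|x - y|) H(x - y) f(y)\<close>, with a radial cutoff \<open>p\<close> vanishing near \<open>0\<close>, only \<open>c p'(r) r\<^bsup>1-2n\<^esup> f\<close>
  survives beside \<open>p H \<D>\<^sub>0 f\<close>, because \<open>z / |z|\<^bsup>2n\<^esup>\<close> is divergence free.  This term has total mass \<open>c \<omega>\<close>, where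
  \<open>\<omega>\<close> is the area of the unit sphere, and concentrates at \<open>x\<close>.  Testing the fundamental solution with a
  radial bump function gives \<open>c \<omega> = - 1\<close>.

  The divergence theorem for a continuous function with weak derivatives needs no approximation of that function.
  In a chart of the boundary, the weak derivative is tested with a cutoff that depends only on the height over the
  graph, divided by \<open>\<delta>\<close>; as \<open>\<delta>\<close> tends to \<open>0\<close> its gradient concentrates on the boundary.  Such a cutoff is
  only continuously differentiable, and it is the cutoff that has to be mollified.
\<close>


subsection \<open>The Clifford generators\<close>

text \<open>The kernel has size \<open>|z|^(1 - 2n)\<close>, whose square is not integrable at the
  pole, while the weak derivatives of \<open>f\<close> are only square integrable. At an individual
  \<open>x\<close> the volume integral may therefore fail to converge absolutely. Hence it is read
  as a limit of integrals outside balls, the existence of this limit at every \<open>x\<close> is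
  something to be proved, and Lebesgue integrability is obtained, by Tonelli, for almost every
  \<open>x\<close>. No estimate of the volume integrand near the pole is available, so the cutoff
  vanishes on a whole ball. For a fixed ball the cutoff is first made sharp. The mass of its
  transition shell is the same for all radii and widths, so replacing \<open>f\<close> by its value
  at \<open>x\<close> costs at most the oscillation of \<open>f\<close> near \<open>x\<close>. This
  bound does not involve the weak derivatives, and continuity of \<open>f\<close> at
  \<open>x\<close> then gives the limit. Radial functions and cutoffs are written in terms of the
  squared distance, which is smooth at the centre, so that no root has to be differentiated
  there.\<close>

lemma pos_strict_mono: "i < j \<Longrightarrow> pos i < pos (j::'a::{finite,linorder})"
  unfolding pos_def by (rule psubset_card_mono) auto

lemma pos_eq_iff: "pos i = pos j \<longleftrightarrow> i = (j::'a::{finite,linorder})"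
  by (metis less_irrefl neqE pos_strict_mono)

lemma pos_ge_1: "1 \<le> pos i"
  unfolding pos_def by (metis One_nat_def Suc_leI atMost_iff card_gt_0_iff empty_iff finite order_refl)

lemma range_pos: "range (pos :: 'a::{finite,linorder} \<Rightarrow> nat) = {1..CARD('a)}"
proof (rule card_subset_eq)
  show "range (pos :: 'a \<Rightarrow> nat) \<subseteq> {1..CARD('a)}"
    using pos_ge_1[where 'a='a] by (auto simp: pos_def intro!: card_mono simp del: card_UNIV)
  have "inj (pos :: 'a \<Rightarrow> nat)" by (simp add: inj_def pos_eq_iff)
  then show "card (range (pos :: 'a \<Rightarrow> nat)) = card {1..CARD('a)}"
    by (simp add: card_image)
qed simp

lemma pos_elt: "1 \<le> k \<Longrightarrow> k \<le> CARD('a::{finite,linorder}) \<Longrightarrow> pos (elt k :: 'a) = k"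
proof -
  assume "1 \<le> k" "k \<le> CARD('a)"
  then obtain i :: 'a where i: "pos i = k"
    using range_pos[where 'a='a] by (metis atLeastAtMost_iff imageE)
  then have "elt k = i" unfolding elt_def using pos_eq_iff by (intro the_equality) auto
  with i show ?thesis by simp
qed

section \<open>Coordinates of the generators: signs and flips\<close>

text \<open>The sign of sorting the basis vector with index \<open>j\<close> past those of smaller
  index. Creation and annihilation of that vector share it.\<close>

definition sgn_ext :: "'m::{finite,linorder} \<Rightarrow> 'm set \<Rightarrow> complex" where
  "sgn_ext j \<alpha> = (-1) ^ card {i \<in> \<alpha>. i < j}"

text \<open>Symmetric difference with \<open>{j}\<close>. It is an involution that treats creation
  and annihilation alike.\<close>

definition flip :: "'m \<Rightarrow> 'm set \<Rightarrow> 'm set" where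
  "flip j \<alpha> = (if j \<in> \<alpha> then \<alpha> - {j} else insert j \<alpha>)"

lemma flip_flip: "flip j (flip j \<alpha>) = \<alpha>"
  by (auto simp: flip_def)

lemma flip_commute: "flip j (flip k \<alpha>) = flip k (flip j \<alpha>)"
  by (auto simp: flip_def)

lemma in_flip: "i \<in> flip j \<alpha> \<longleftrightarrow> (if i = j then j \<notin> \<alpha> else i \<in> \<alpha>)"
  by (auto simp: flip_def)

lemma sgn_ext_sq: "sgn_ext j \<alpha> * sgn_ext j \<alpha> = 1"
  by (simp add: sgn_ext_def flip: power_add mult_2)

lemma minus_one_power_card_flip: "(-1::complex) ^ card (flip k (\<alpha>::'m::finite set)) = - ((-1) ^ card \<alpha>)"
proof (cases "k \<in> \<alpha>")
  case True
  then have "card \<alpha> = Suc (card (\<alpha> - {k}))" by (metis card_Suc_Diff1 finite)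
  with True show ?thesis by (simp add: flip_def del: card_Diff_insert card_Diff_singleton)
qed (simp add: flip_def)

text \<open>Source of anticommutation: for distinct \<open>j\<close> and \<open>k\<close> exactly
  one of \<open>k < j\<close> and \<open>j < k\<close> holds, so exactly one of the two orders of
  flipping picks up an extra sign.\<close>

lemma sgn_ext_flip:
  "sgn_ext j (flip k \<alpha>) = (if k < j then - sgn_ext j \<alpha> else sgn_ext j (\<alpha>::'m::{finite,linorder} set))"
proof -
  have "{i \<in> flip k \<alpha>. i < j} = (if k < j then flip k {i \<in> \<alpha>. i < j} else {i \<in> \<alpha>. i < j})"
    by (auto simp: flip_def)
  then show ?thesis by (simp add: sgn_ext_def minus_one_power_card_flip)
qed

lemma eps_nth: "eps j v $ \<alpha> = (if j \<in> \<alpha> then sgn_ext j \<alpha> * v $ (\<alpha> - {j}) else 0)"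
proof -
  have "eps j v $ \<alpha> = (\<Sum>\<alpha>'\<in>UNIV. \<Sum>\<beta>\<in>UNIV. if \<alpha>' = {j} then if j \<notin> \<beta> \<and> insert j \<beta> = \<alpha> then
      v $ \<beta> * (-1) ^ card {(i, j') \<in> {j} \<times> \<beta>. j' < i} else 0 else 0)"
    by (auto simp: eps_def wedge_def fb_def axis_def intro!: sum.cong)
  also have "\<dots> = (\<Sum>\<beta>\<in>UNIV. if j \<notin> \<beta> \<and> insert j \<beta> = \<alpha> then
      v $ \<beta> * (-1) ^ card {(i, j') \<in> {j} \<times> \<beta>. j' < i} else 0)"
    by (subst sum.swap) simp
  also have "\<dots> = (\<Sum>\<beta>\<in>UNIV. if \<beta> = \<alpha> - {j} then if j \<in> \<alpha> then v $ \<beta> * sgn_ext j \<alpha> else 0 else 0)"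
  proof (rule sum.cong[OF refl])
    fix \<beta> :: "'a set"
    have "card {(i, j') \<in> {j} \<times> \<beta>. j' < i} = card {i \<in> \<beta>. i < j}"
      by (rule bij_betw_same_card[where f = snd]) (auto simp: bij_betw_def inj_on_def image_iff)
    moreover have "sgn_ext j (insert j \<beta>) = (-1) ^ card {i \<in> \<beta>. i < j}" if "j \<notin> \<beta>"
      using sgn_ext_flip[of j j \<beta>] that by (simp add: flip_def sgn_ext_def)
    ultimately show "(if j \<notin> \<beta> \<and> insert j \<beta> = \<alpha> then
      v $ \<beta> * (-1) ^ card {(i, j') \<in> {j} \<times> \<beta>. j' < i} else 0) =
       (if \<beta> = \<alpha> - {j} then if j \<in> \<alpha> then v $ \<beta> * sgn_ext j \<alpha> else 0 else 0)"
      using insert_absorb by (cases "j \<notin> \<beta> \<and> insert j \<beta> = \<alpha>") (auto simp del: insert_Times_insert)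
  qed
  finally show ?thesis by simp
qed

lemma iota_nth: "iota j v $ \<alpha> = (if j \<notin> \<alpha> then sgn_ext j \<alpha> * v $ (insert j \<alpha>) else 0)"
proof -
  have "iota j v $ \<alpha> = (\<Sum>\<beta>\<in>UNIV. if \<beta> = insert j \<alpha> then if j \<notin> \<alpha> then sgn_ext j \<alpha> * v $ \<beta> else 0 else 0)"
    unfolding iota_def sum_component
  proof (rule sum.cong[OF refl])
    fix \<beta> :: "'a set"
    \<comment> \<open>The exponent \<open>t + 1\<close> has the parity of \<open>t - 1\<close>,
      which counts the elements strictly below \<open>j\<close>.\<close>
    have "(-1) ^ (card {i \<in> \<beta>. i \<le> j} + 1) = sgn_ext j \<beta>" if "j \<in> \<beta>"
    proof -
      have "{i \<in> \<beta>. i \<le> j} = insert j {i \<in> \<beta>. i < j}" using that by auto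
      then show ?thesis by (simp add: sgn_ext_def)
    qed
    moreover have "sgn_ext j (insert j \<alpha>) = sgn_ext j \<alpha>" if "j \<notin> \<alpha>"
      using sgn_ext_flip[of j j \<alpha>] that by (simp add: flip_def)
    ultimately show "(if j \<in> \<beta> then (v $ \<beta> * (-1) ^ (card {i \<in> \<beta>. i \<le> j} + 1)) *s fb (\<beta> - {j}) else 0) $ \<alpha> =
      (if \<beta> = insert j \<alpha> then if j \<notin> \<alpha> then sgn_ext j \<alpha> * v $ \<beta> else 0 else 0)"
      by (cases "j \<in> \<beta>") (auto simp: fb_def axis_def)
  qed
  then show ?thesis by simp
qed

text \<open>Together with \<open>gamma_flip\<close> this presents a generator as a monomial matrix,
  so that the Clifford relations become identities between scalars.\<close>

definition gamma_coeff :: "'n::{finite,linorder} \<Rightarrow> 'm::{finite,linorder} set \<Rightarrow> complex" where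
  "gamma_coeff j \<alpha> =
     (if odd CARD('n) \<and> pos j = CARD('n) then - \<i> * (-1) ^ card \<alpha>
      else if odd (pos j) then (if elt ((pos j + 1) div 2) \<in> \<alpha> then 1 else -1) * sgn_ext (elt ((pos j + 1) div 2)) \<alpha>
      else - \<i> * sgn_ext (elt (pos j div 2)) \<alpha>)"

text \<open>For even \<open>pos j\<close> the quotient \<open>(pos j + 1) div 2\<close> equals
  \<open>pos j div 2\<close>, so one formula serves both generators of a pair.\<close>

definition gamma_flip :: "'n::{finite,linorder} \<Rightarrow> 'm::{finite,linorder} set \<Rightarrow> 'm set" where
  "gamma_flip j \<alpha> = (if odd CARD('n) \<and> pos j = CARD('n) then \<alpha> else flip (elt ((pos j + 1) div 2)) \<alpha>)"

lemma gamma_nth: "gamma j v $ \<alpha> = gamma_coeff j \<alpha> * v $ gamma_flip j \<alpha>"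
  by (auto simp: gamma_def gamma_coeff_def gamma_flip_def eps_nth iota_nth flip_def algebra_simps)

lemma gamma_add: "gamma j (u + v) = gamma j u + gamma j v"
  by (simp add: vec_eq_iff gamma_nth algebra_simps)

lemma gamma_scaleR: "gamma j (r *\<^sub>R v) = r *\<^sub>R gamma j v"
  by (simp add: vec_eq_iff gamma_nth)

lemma bounded_linear_gamma: "bounded_linear (gamma j)"
  by (intro linear_conv_bounded_linear[THEN iffD1] linearI gamma_add gamma_scaleR)

text \<open>Flips commute, so both products read the same coordinate of \<open>v\<close> and only
  the scalars are compared. The additional generator anticommutes with the others because a flip
  changes the parity of \<open>card\<close>; generators of different pairs do so by
  \<open>sgn_ext_flip\<close>; the two of one pair do so because a flip toggles the membership on
  which the sign of the odd one depends.\<close>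

lemma gamma_anticommute:
  fixes j k :: "'n::{finite,linorder}" and v :: "'m::{finite,linorder} ext"
  assumes "CARD('m) = CARD('n) div 2"
  shows "gamma j (gamma k v) + gamma k (gamma j v) = (if j = k then - 2 else 0) *\<^sub>R v"
proof -
  have pos_le: "pos i \<le> CARD('n)" for i :: 'n
    using range_pos[where 'a='n] by auto
  \<comment> \<open>The dimension hypothesis keeps the number of the pair between 1 and
    \<open>CARD('m)\<close>, where \<open>elt\<close> inverts \<open>pos\<close>. Different pairs
    thus use different basis vectors.\<close>
  have pe: "pos (elt ((pos i + 1) div 2) :: 'm) = (pos i + 1) div 2"
    if "\<not> (odd CARD('n) \<and> pos i = CARD('n))" for i :: 'n
    using pos_le[of i] pos_ge_1[of i] assms that by (intro pos_elt) presburger+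
  have jk: "j = k \<longleftrightarrow> pos j = pos k" by (simp add: pos_eq_iff)
  have "gamma_coeff j \<alpha> * gamma_coeff k (gamma_flip j \<alpha>) * v $ gamma_flip k (gamma_flip j \<alpha>)
      + gamma_coeff k \<alpha> * gamma_coeff j (gamma_flip k \<alpha>) * v $ gamma_flip j (gamma_flip k \<alpha>)
     = (if j = k then - 2 else 0) * v $ \<alpha>" for \<alpha>
  proof (cases "odd CARD('n) \<and> pos j = CARD('n)")
    case True
    note J = True
    show ?thesis
    proof (cases "odd CARD('n) \<and> pos k = CARD('n)")
      case True
      with J have "j = k" by (simp add: jk)
      with True show ?thesis
        by (simp add: gamma_coeff_def gamma_flip_def flip: power_add mult_2)
    next
      case False
      with J have "j \<noteq> k" by auto
      with False J show ?thesis
        by (auto simp: gamma_coeff_def gamma_flip_def minus_one_power_card_flip)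
    qed
  next
    case False
    note J = False
    show ?thesis
    proof (cases "odd CARD('n) \<and> pos k = CARD('n)")
      case True
      with J have "j \<noteq> k" by auto
      with True J show ?thesis
        by (auto simp: gamma_coeff_def gamma_flip_def minus_one_power_card_flip)
    next
      case False
      define p :: 'm where "p = elt ((pos j + 1) div 2)"
      define q :: 'm where "q = elt ((pos k + 1) div 2)"
      have pq: "p = q \<longleftrightarrow> (pos j + 1) div 2 = (pos k + 1) div 2"
        using pe[OF J] pe[OF False] by (metis p_def q_def)
      have cj: "gamma_coeff j \<beta> = (if odd (pos j) then if p \<in> \<beta> then 1 else -1 else - \<i>) * sgn_ext p \<beta>" for \<beta>
        using J by (auto simp: gamma_coeff_def p_def)
      have ck: "gamma_coeff k \<beta> = (if odd (pos k) then if q \<in> \<beta> then 1 else -1 else - \<i>) * sgn_ext q \<beta>" for \<beta>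
        using False by (auto simp: gamma_coeff_def q_def)
      have fj: "gamma_flip j \<beta> = flip p \<beta>" for \<beta> using J by (auto simp: gamma_flip_def p_def)
      have fk: "gamma_flip k \<beta> = flip q \<beta>" for \<beta> using False by (auto simp: gamma_flip_def q_def)
      show ?thesis
      proof (cases "p = q")
        case True
        then have "(pos j + 1) div 2 = (pos k + 1) div 2" using pq by simp
        \<comment> \<open>The two members of a pair have the numbers \<open>2k - 1\<close> and
          \<open>2k\<close>, so parity tells them apart.\<close>
        then have jk2: "j = k \<longleftrightarrow> odd (pos j) = odd (pos k)" unfolding jk by presburger
        have s1: "sgn_ext q \<alpha> * sgn_ext q \<alpha> = 1" by (rule sgn_ext_sq)
        have sq: "(x * sgn_ext q \<alpha>) * (y * sgn_ext q \<alpha>) = x * y"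
          "sgn_ext q \<alpha> * (y * sgn_ext q \<alpha>) = y" "(x * sgn_ext q \<alpha>) * sgn_ext q \<alpha> = x" for x y
          using s1 by algebra+
        show ?thesis
          unfolding jk2 cj ck fj fk True
          by (cases "odd (pos j)"; cases "odd (pos k)"; cases "q \<in> \<alpha>")
            (simp_all add: in_flip sgn_ext_flip flip_flip sq s1)
      next
        case ne: False
        then have "j \<noteq> k" by (auto simp: p_def q_def)
        with ne show ?thesis
          unfolding cj ck fj fk flip_commute[of q p]
          by (cases p q rule: linorder_cases) (simp_all add: in_flip sgn_ext_flip)
      qed
    qed
  qed
  then show ?thesis
    by (simp add: vec_eq_iff gamma_nth mult.assoc scaleR_conv_of_real)
qed

text \<open>Averaging the sum with its copy under the exchange of \<open>j\<close> and
  \<open>k\<close> replaces each product by half an anticommutator. This is the collapse to the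
  trace, used for the kernel and again in the divergence theorem.\<close>

lemma sum_gamma_gamma_symmetric:
  fixes T :: "'n::{finite,linorder} \<Rightarrow> 'n \<Rightarrow> real" and v :: "'m::{finite,linorder} ext"
  assumes "CARD('m) = CARD('n) div 2" and sym: "\<And>j k. T j k = T k j"
  shows "(\<Sum>j\<in>UNIV. \<Sum>k\<in>UNIV. T j k *\<^sub>R gamma j (gamma k v)) = - (\<Sum>j\<in>UNIV. T j j) *\<^sub>R v"
proof -
  let ?S = "\<Sum>j\<in>UNIV. \<Sum>k\<in>UNIV. T j k *\<^sub>R gamma j (gamma k v)"
  have "?S = (\<Sum>j\<in>UNIV. \<Sum>k\<in>UNIV. T j k *\<^sub>R gamma k (gamma j v))"
    by (subst sum.swap) (simp add: sym)
  then have "2 *\<^sub>R ?S = ?S + (\<Sum>j\<in>UNIV. \<Sum>k\<in>UNIV. T j k *\<^sub>R gamma k (gamma j v))"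
    by (simp add: scaleR_2)
  also have "\<dots> = (\<Sum>j\<in>UNIV. \<Sum>k\<in>UNIV. T j k *\<^sub>R (gamma j (gamma k v) + gamma k (gamma j v)))"
    by (simp add: sum.distrib scaleR_add_right)
  also have "\<dots> = (\<Sum>j\<in>UNIV. \<Sum>k\<in>UNIV. if k = j then (- 2 * T j j) *\<^sub>R v else 0)"
    unfolding gamma_anticommute[OF assms(1)] by (intro sum.cong refl) auto
  also have "\<dots> = 2 *\<^sub>R (- (\<Sum>j\<in>UNIV. T j j) *\<^sub>R v)"
    by (simp add: scaleR_sum_left sum_distrib_left sum_negf scaleR_sum_right)
  \<comment> \<open>The second disjunct is what cancelling the scalar 2 leaves behind.\<close>
  finally have "?S = - (\<Sum>j\<in>UNIV. T j j) *\<^sub>R v \<or> (2::real) = 0"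
    by (simp only: scaleR_cancel_left)
  then show ?thesis by simp
qed


subsection \<open>Functions of class \<open>C\<^sup>k\<close>\<close>

text \<open>Any computed expression for the derivative may stand in for
  \<open>frechet_derivative\<close>, which is what the recursive definition speaks about.\<close>

lemma Ck_SucI:
  assumes "\<And>x. (u has_derivative u' x) (at x)" "\<And>b. b \<in> Basis \<Longrightarrow> Ck k (\<lambda>x. u' x b)"
  shows "Ck (Suc k) u"
proof -
  have "frechet_derivative u (at x) = u' x" for x
    using frechet_derivative_at[OF assms(1)] by simp
  with assms show ?thesis by (auto simp: differentiable_def)
qed

lemma Ck_Suc_imp_Ck: "Ck (Suc k) u \<Longrightarrow> Ck k u"
proof (induction k arbitrary: u)
  case 0
  then show ?case
    by (auto simp: continuous_on_eq_continuous_at intro: differentiable_imp_continuous_within)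
qed auto

lemma Ck_mono: "Ck k u \<Longrightarrow> j \<le> k \<Longrightarrow> Ck j u"
  by (induction k) (auto simp del: Ck.simps(2) dest: Ck_Suc_imp_Ck elim: le_SucE)

lemma Ck_const: "Ck k (\<lambda>x. c)"
proof (induction k arbitrary: c)
  case (Suc k)
  show ?case by (rule Ck_SucI[where u' = "\<lambda>x v. 0"]) (auto intro: Suc)
qed simp

lemma Ck_inner: "Ck k (\<lambda>x. x \<bullet> a)"
proof (cases k)
  case (Suc k)
  show ?thesis unfolding Suc
    by (rule Ck_SucI[where u' = "\<lambda>x v. v \<bullet> a"]) (auto intro!: derivative_eq_intros Ck_const)
qed (auto intro!: continuous_intros)

lemma Ck_Suc_has_derivative:
  "Ck (Suc k) u \<Longrightarrow> (u has_derivative frechet_derivative u (at x)) (at x)"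
  by (simp add: frechet_derivative_works)

lemma Ck_add: "Ck k u \<Longrightarrow> Ck k v \<Longrightarrow> Ck k (\<lambda>x. u x + v x)"
proof (induction k arbitrary: u v)
  case (Suc k)
  show ?case
    by (rule Ck_SucI[OF has_derivative_add[OF Suc.prems[THEN Ck_Suc_has_derivative]]])
      (use Suc in auto)
qed (auto intro: continuous_intros)

lemma Ck_mult: "Ck k u \<Longrightarrow> Ck k v \<Longrightarrow> Ck k (\<lambda>x. u x * v x)"
proof (induction k arbitrary: u v)
  case (Suc k)
  show ?case
    by (rule Ck_SucI[OF has_derivative_mult[OF Suc.prems[THEN Ck_Suc_has_derivative]]])
      (use Suc Suc.prems[THEN Ck_Suc_imp_Ck] in \<open>auto intro!: Ck_add\<close>)
qed (auto intro: continuous_intros)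

lemma Ck1_I:
  assumes "\<And>x. (u has_derivative (\<lambda>v. G x \<bullet> v)) (at x)" "continuous_on UNIV G"
  shows "Ck 1 u"
  unfolding One_nat_def
  by (rule Ck_SucI[OF assms(1)]) (auto intro!: continuous_intros assms(2))

lemma Ck1_grad:
  assumes "Ck 1 u"
  shows "(u has_derivative (\<lambda>v. grad u x \<bullet> v)) (at x)"
    and "continuous_on UNIV (grad u)"
    and "grad u x \<bullet> v = frechet_derivative u (at x) v"
proof -
  have d: "(u has_derivative frechet_derivative u (at x)) (at x)" for x
    using assms Ck_Suc_has_derivative[of 0 u] by simp
  have "grad u x \<bullet> v = frechet_derivative u (at x) v" for x v
  proof -
    interpret bounded_linear "frechet_derivative u (at x)" by (rule has_derivative_bounded_linear[OF d])
    have "frechet_derivative u (at x) v = frechet_derivative u (at x) (\<Sum>b\<in>Basis. (v \<bullet> b) *\<^sub>R b)"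
      by (simp add: euclidean_representation)
    also have "\<dots> = (\<Sum>b\<in>Basis. (v \<bullet> b) * frechet_derivative u (at x) b)"
      by (simp add: sum scaleR)
    also have "\<dots> = grad u x \<bullet> v"
      by (simp add: grad_def inner_sum_left) (metis inner_commute mult.commute)
    finally show ?thesis by simp
  qed
  then show "grad u x \<bullet> v = frechet_derivative u (at x) v"
    and "(u has_derivative (\<lambda>v. grad u x \<bullet> v)) (at x)" using d by simp_all
  show "continuous_on UNIV (grad u)"
    unfolding grad_def using assms by (auto intro!: continuous_intros)
qed

lemma has_derivative_grad_unique:
  "(u has_derivative (\<lambda>v. G \<bullet> v)) (at x) \<Longrightarrow> frechet_derivative u (at x) = (\<lambda>v. G \<bullet> v)"
  using frechet_derivative_at by metis

lemma Ck_diff: "Ck k u \<Longrightarrow> Ck k v \<Longrightarrow> Ck k (\<lambda>x. u x - v x)"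
  using Ck_add[of k u "\<lambda>x. (-1) * v x"] Ck_mult[OF Ck_const[of k "-1"], of v] by simp

lemma Ck_prod: "finite I \<Longrightarrow> (\<And>i. i \<in> I \<Longrightarrow> Ck k (u i)) \<Longrightarrow> Ck k (\<lambda>x. \<Prod>i\<in>I. u i x)"
  by (induction I rule: finite_induct) (auto intro: Ck_mult Ck_const)

lemma Ck1_imp_continuous: "Ck 1 u \<Longrightarrow> continuous_on UNIV u"
  using Ck_Suc_imp_Ck[of 0 u] by simp

lemma frechet_derivative_add_Ck1:
  assumes "Ck 1 u" "Ck 1 v"
  shows "frechet_derivative (\<lambda>x. u x + v x) (at x) b = frechet_derivative u (at x) b + frechet_derivative v (at x) b"
proof -
  have "((\<lambda>x. u x + v x) has_derivative (\<lambda>h. frechet_derivative u (at x) h + frechet_derivative v (at x) h)) (at x)"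
    using assms by (intro has_derivative_add Ck_Suc_has_derivative[of 0]) simp_all
  from frechet_derivative_at[OF this] show ?thesis by metis
qed

lemma frechet_derivative_mult_Ck1:
  fixes u v :: "'a::euclidean_space \<Rightarrow> real"
  assumes "Ck 1 u" "Ck 1 v"
  shows "frechet_derivative (\<lambda>x. u x * v x) (at x) b = u x * frechet_derivative v (at x) b + frechet_derivative u (at x) b * v x"
proof -
  have "((\<lambda>x. u x * v x) has_derivative (\<lambda>h. u x * frechet_derivative v (at x) h + frechet_derivative u (at x) h * v x)) (at x)"
    using assms by (intro has_derivative_mult Ck_Suc_has_derivative[of 0]) simp_all
  from frechet_derivative_at[OF this] show ?thesis by metis
qed


subsection \<open>A smooth bump function\<close>

text \<open>The functions \<open>p(1/t) exp(-1/t)\<close> form a family closed under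
  differentiation: \<open>p\<close> is replaced by \<open>X^2 (p - p')\<close>. Smoothness becomes
  an induction over the family instead of a statement about one function.\<close>

definition exp_bump :: "real poly \<Rightarrow> real \<Rightarrow> real" where
  "exp_bump p t = (if t > 0 then poly p (1 / t) * exp (- (1 / t)) else 0)"

lemma poly_exp_tendsto_0: "((\<lambda>t::real. poly p t * exp (- t)) \<longlongrightarrow> 0) at_top"
proof -
  have "((\<lambda>t::real. \<Sum>i\<le>degree p. coeff p i * (t ^ i / exp t)) \<longlongrightarrow> (\<Sum>i\<le>degree p. coeff p i * 0)) at_top"
    by (intro tendsto_intros tendsto_power_div_exp_0)
  then show ?thesis
    by (simp add: poly_altdef sum_distrib_right exp_minus divide_inverse mult.assoc)
qed

lemma exp_bump_deriv:
  "(exp_bump p has_real_derivative exp_bump ([:0, 0, 1:] * (p - pderiv p)) t) (at t)"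
proof (cases t "0::real" rule: linorder_cases)
  case less
  have "((\<lambda>_. 0) has_real_derivative exp_bump ([:0, 0, 1:] * (p - pderiv p)) t) (at t)"
    using less by (simp add: exp_bump_def)
  then show ?thesis
    by (rule has_field_derivative_transform_within_open[where S = "{..<0}"]) (use less in \<open>auto simp: exp_bump_def\<close>)
next
  case greater
  have "((\<lambda>t. poly p (1 / t) * exp (- (1 / t))) has_real_derivative exp_bump ([:0, 0, 1:] * (p - pderiv p)) t) (at t)"
    using greater
    by (auto intro!: derivative_eq_intros poly_DERIV[THEN DERIV_chain2] simp: exp_bump_def field_simps power2_eq_square)
  then show ?thesis
    by (rule has_field_derivative_transform_within_open[where S = "{0<..}"]) (use greater in \<open>auto simp: exp_bump_def\<close>)
next
  case equal
  \<comment> \<open>The difference quotient at 0 is again in the family: dividing by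
    \<open>h\<close> multiplies the polynomial in \<open>1/h\<close> by \<open>X\<close>, which is
    \<open>pCons 0 p\<close>.\<close>
  have "((\<lambda>h. poly (pCons 0 p) (inverse h) * exp (- inverse h)) \<longlongrightarrow> 0) (at_right (0::real))"
    by (rule filterlim_compose[OF poly_exp_tendsto_0 filterlim_inverse_at_top_right])
  then have "((\<lambda>h. exp_bump p h / h) \<longlongrightarrow> 0) (at_right 0)"
    by (rule tendsto_cong[THEN iffD1, rotated])
      (auto simp: exp_bump_def eventually_at_right_less field_simps intro: eventually_mono[OF eventually_at_right_less])
  moreover have "((\<lambda>h. exp_bump p h / h) \<longlongrightarrow> 0) (at_left 0)"
    by (rule tendsto_eventually) (auto simp: exp_bump_def eventually_at_left_field intro: exI[of _ "-1"])
  ultimately have "((\<lambda>h. exp_bump p h / h) \<longlongrightarrow> 0) (at 0)"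
    by (simp add: filterlim_at_split)
  then show ?thesis using equal
    by (simp add: DERIV_def exp_bump_def)
qed

text \<open>The polynomial is generalised because the induction hypothesis is needed for the
  polynomial of the derivative; the other factor of the derivative is linear in
  \<open>x\<close>.\<close>

lemma Ck_exp_bump: "Ck k (\<lambda>x. exp_bump p (r - x \<bullet> x))"
proof (induction k arbitrary: p)
  case 0
  have "continuous_on UNIV (exp_bump p)"
    using exp_bump_deriv by (auto simp: continuous_on_eq_continuous_at intro: DERIV_isCont)
  then show ?case
    by (auto intro!: continuous_on_compose2[of UNIV "exp_bump p"] continuous_intros)
next
  case (Suc k)
  show ?case
  proof (rule Ck_SucI)
    fix x :: 'a
    show "((\<lambda>x. exp_bump p (r - x \<bullet> x)) has_derivative
        (\<lambda>v. exp_bump ([:0, 0, 1:] * (p - pderiv p)) (r - x \<bullet> x) * ((-2) * (x \<bullet> v)))) (at x)"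
      by (rule has_derivative_eq_rhs, rule DERIV_compose_FDERIV[OF exp_bump_deriv])
        (auto intro!: derivative_eq_intros simp: inner_commute)
  next
    fix b :: 'a
    show "Ck k (\<lambda>x. exp_bump ([:0, 0, 1:] * (p - pderiv p)) (r - x \<bullet> x) * ((-2) * (x \<bullet> b)))"
      by (intro Ck_mult Suc Ck_const Ck_inner)
  qed
qed

lemma exp_bump_nonneg: "0 \<le> exp_bump 1 t" and exp_bump_pos: "0 < t \<Longrightarrow> 0 < exp_bump 1 t"
  and exp_bump_eq_0: "t \<le> 0 \<Longrightarrow> exp_bump p t = 0"
  by (auto simp: exp_bump_def)


subsection \<open>Mollification\<close>

lemma has_derivative_parametric_integral:
  fixes \<phi> \<eta> :: "'a::euclidean_space \<Rightarrow> real"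
  assumes \<phi>: "continuous_on UNIV \<phi>" and \<eta>: "Ck 1 \<eta>"
  shows "((\<lambda>x. integral (cbox a b) (\<lambda>y. \<phi> y * \<eta> (x - y))) has_derivative
     (\<lambda>v. integral (cbox a b) (\<lambda>y. \<phi> y * frechet_derivative \<eta> (at (x - y)) v))) (at x)"
proof -
  \<comment> \<open>The derivative in \<open>x\<close> as a bounded linear map. Writing it through
    the gradient makes its joint continuity, which the Leibniz rule requires, a matter of
    composition.\<close>
  define fx where "fx x y = blinfun_inner_right (\<phi> y *\<^sub>R grad \<eta> (x - y))" for x y
  have c\<eta>: "continuous_on UNIV \<eta>" using Ck_Suc_imp_Ck[of 0 \<eta>] \<eta> by simp
  note [continuous_intros] = continuous_on_compose2[OF \<phi>] continuous_on_compose2[OF c\<eta>]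
    continuous_on_compose2[OF Ck1_grad(2)[OF \<eta>]]
    bounded_linear.continuous_on[OF bounded_linear_blinfun_inner_right]
  have cont: "continuous_on (UNIV \<times> cbox a b) (\<lambda>(x, y). fx x y)"
    unfolding fx_def case_prod_unfold by (intro continuous_intros) auto
  have "((\<lambda>x. integral (cbox a b) (\<lambda>y. \<phi> y * \<eta> (x - y))) has_derivative
     integral (cbox a b) (fx x)) (at x)"
  proof (rule leibniz_rule)
    fix x y
    show "((\<lambda>x. \<phi> y * \<eta> (x - y)) has_derivative fx x y) (at x)"
      unfolding fx_def
      by (rule has_derivative_eq_rhs, rule has_derivative_mult_right,
          rule has_derivative_compose[where g = \<eta>, OF _ Ck1_grad(1)[OF \<eta>]])
        (auto intro!: derivative_eq_intros)
    show "(\<lambda>y. \<phi> y * \<eta> (x - y)) integrable_on cbox a b"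
      by (intro integrable_continuous continuous_intros) auto
  qed (use cont in auto)
  moreover have "blinfun_apply (integral (cbox a b) (fx x)) v =
      integral (cbox a b) (\<lambda>y. \<phi> y * frechet_derivative \<eta> (at (x - y)) v)" for v
  proof (subst blinfun_apply_integral)
    show "fx x integrable_on cbox a b"
      unfolding fx_def by (intro integrable_continuous continuous_intros) auto
  qed (simp add: fx_def Ck1_grad(3)[OF \<eta>])
  then have "blinfun_apply (integral (cbox a b) (fx x)) =
      (\<lambda>v. integral (cbox a b) (\<lambda>y. \<phi> y * frechet_derivative \<eta> (at (x - y)) v))" ..
  ultimately show ?thesis by simp
qed

lemma Ck_convolution:
  fixes \<phi> \<eta> :: "'a::euclidean_space \<Rightarrow> real"
  assumes \<phi>: "continuous_on UNIV \<phi>"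
  shows "Ck k \<eta> \<Longrightarrow> Ck k (\<lambda>x. integral (cbox a b) (\<lambda>y. \<phi> y * \<eta> (x - y)))"
proof (induction k arbitrary: \<eta>)
  case 0
  then have "continuous_on UNIV \<eta>" by simp
  note [continuous_intros] = continuous_on_compose2[OF \<phi>] continuous_on_compose2[OF this]
  have "continuous_on (UNIV \<times> cbox a b) (\<lambda>(x, y). \<phi> y * \<eta> (x - y))"
    unfolding case_prod_unfold by (intro continuous_intros) auto
  from integral_continuous_on_param[OF this] show ?case by simp
next
  case (Suc k)
  have "Ck 1 \<eta>" using Suc.prems by (rule Ck_mono) simp
  note d = has_derivative_parametric_integral[OF \<phi> this]
  show ?case
    by (rule Ck_SucI[OF d]) (use Suc in auto)
qed

lemma lborel_distr_minus:
  fixes x :: "'a::euclidean_space"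
  shows "distr lborel borel (\<lambda>y. x - y) = lborel"
  by (subst lborel_affine[of "-1" x]) (auto simp: density_1)

text \<open>Both orders are needed: with the variable \<open>x\<close> in the mollifier the
  convolution is seen to be smooth, with \<open>x\<close> in \<open>\<phi>\<close> its derivative is
  seen to be the mollified derivative of \<open>\<phi>\<close>.\<close>

lemma integral_convolution_commute:
  fixes \<phi> \<eta> :: "'a::euclidean_space \<Rightarrow> real"
  assumes c: "continuous_on UNIV \<phi>" "continuous_on UNIV \<eta>"
    and s: "\<And>y. \<phi> y \<noteq> 0 \<Longrightarrow> y \<in> cbox a b" "\<And>y. \<eta> y \<noteq> 0 \<Longrightarrow> y \<in> cbox c d"
  shows "integral (cbox a b) (\<lambda>y. \<phi> y * \<eta> (x - y)) = integral (cbox c d) (\<lambda>y. \<eta> y * \<phi> (x - y))"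
proof -
  have *: "integral (cbox a b) (\<lambda>y. \<phi> y * \<eta> (x - y)) = (LINT y|lborel. \<phi> y * \<eta> (x - y))"
    if c: "continuous_on UNIV \<phi>" "continuous_on UNIV \<eta>" and s: "\<And>y. \<phi> y \<noteq> 0 \<Longrightarrow> y \<in> cbox a b"
    for \<phi> \<eta> :: "'a \<Rightarrow> real" and a b
  proof -
    have "set_integrable lborel (cbox a b) (\<lambda>y. \<phi> y * \<eta> (x - y))"
      unfolding set_integrable_def
      by (intro borel_integrable_compact compact_cbox continuous_intros
          continuous_on_compose2[OF c(1)] continuous_on_compose2[OF c(2)]) auto
    from set_borel_integral_eq_integral(2)[OF this]
    have "integral (cbox a b) (\<lambda>y. \<phi> y * \<eta> (x - y)) = (LINT y:cbox a b|lborel. \<phi> y * \<eta> (x - y))" ..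
    also have "\<dots> = (LINT y|lborel. \<phi> y * \<eta> (x - y))"
      unfolding set_lebesgue_integral_def using s by (intro Bochner_Integration.integral_cong) (auto simp: indicator_def)
    finally show ?thesis .
  qed
  have m: "\<phi> \<in> borel_measurable borel" "\<eta> \<in> borel_measurable borel"
    using c borel_measurable_continuous_onI by auto
  have "(LINT y|lborel. \<phi> y * \<eta> (x - y)) = (LINT y|distr lborel borel (\<lambda>y. x - y). \<phi> y * \<eta> (x - y))"
    by (simp add: lborel_distr_minus)
  also have "\<dots> = (LINT y|lborel. \<phi> (x - y) * \<eta> y)"
    using m by (subst integral_distr) auto
  finally show ?thesis
    using *[of \<phi> \<eta> a b] *[of \<eta> \<phi> c d] c s by (simp add: mult.commute)
qed

lemma uniform_continuity_bounded_support:
  fixes u :: "'a::euclidean_space \<Rightarrow> 'b::real_normed_vector"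
  assumes c: "continuous_on UNIV u" and R: "\<And>x. u x \<noteq> 0 \<Longrightarrow> norm x \<le> R" and "e > 0"
  obtains d where "d > 0" "\<And>x y. norm (x - y) \<le> d \<Longrightarrow> norm (u x - u y) \<le> e"
proof -
  have "uniformly_continuous_on (cball 0 (R + 1)) u"
    by (rule compact_uniformly_continuous) (auto intro: continuous_on_subset[OF c])
  then obtain d where d: "d > 0"
    "\<And>x y. x \<in> cball 0 (R + 1) \<Longrightarrow> y \<in> cball 0 (R + 1) \<Longrightarrow> dist y x < d \<Longrightarrow> dist (u y) (u x) < e"
    unfolding uniformly_continuous_on_def using \<open>e > 0\<close> by metis
  \<comment> \<open>Half of \<open>d\<close> makes room for the strict inequality. The bound 1
    ensures that, if one point leaves the ball of radius \<open>R + 1\<close>, both points are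
    outside the ball of radius \<open>R\<close> and hence outside the support.\<close>
  show thesis
  proof (rule that[of "min (d / 2) 1"])
    fix x y :: 'a assume *: "norm (x - y) \<le> min (d / 2) 1"
    show "norm (u x - u y) \<le> e"
    proof (cases "norm x \<le> R + 1 \<and> norm y \<le> R + 1")
      case True
      then show ?thesis using d(2)[of y x] * d(1) by (simp add: dist_norm)
    next
      case False
      then have "norm x > R \<and> norm y > R"
        using * norm_triangle_ineq2[of x y] norm_triangle_ineq2[of y x] by (auto simp: norm_minus_commute)
      then have "u x = 0" "u y = 0" using R by force+
      then show ?thesis using \<open>e > 0\<close> by simp
    qed
  qed (use d in auto)
qed

lemma frechet_derivative_eq_0_outside:
  fixes \<phi> :: "'a::euclidean_space \<Rightarrow> real"
  assumes "closed K" "\<And>x. x \<notin> K \<Longrightarrow> \<phi> x = 0" "x \<notin> K"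
  shows "frechet_derivative \<phi> (at x) = (\<lambda>v. 0)"
proof -
  have "(\<phi> has_derivative (\<lambda>v. 0)) (at x)"
    by (rule has_derivative_transform_within_open[where f = "\<lambda>_. 0" and s = "- K"]) (use assms in auto)
  from frechet_derivative_at[OF this] show ?thesis by simp
qed

lemma mollifier_exists:
  assumes "d > 0"
  obtains \<eta> :: "'a::euclidean_space \<Rightarrow> real" and a b
  where "\<And>k. Ck k \<eta>" "\<And>x. 0 \<le> \<eta> x" "\<And>x. \<eta> x \<noteq> 0 \<Longrightarrow> norm x \<le> d \<and> x \<in> cbox a b"
    "integral (cbox a b) \<eta> = 1"
proof -
  define \<zeta> where "\<zeta> x = exp_bump 1 (d\<^sup>2 - x \<bullet> x)" for x :: 'a
  obtain a :: 'a where a: "cball 0 d \<subseteq> box (- a) a"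
    using bounded_subset_box_symmetric[OF bounded_cball] by blast
  have ck: "Ck k \<zeta>" for k unfolding \<zeta>_def by (rule Ck_exp_bump)
  have cont: "continuous_on (cbox (- a) a) \<zeta>"
    using ck[of 0] by (auto intro: continuous_on_subset)
  have z: "0 \<in> box (-a) a" using a \<open>d > 0\<close> by (auto simp: subset_iff)
  have "integral (cbox (-a) a) \<zeta> \<noteq> 0"
  proof
    assume "integral (cbox (-a) a) \<zeta> = 0"
    then have "\<forall>x\<in>cbox (-a) a. \<zeta> x = 0"
      by (subst (asm) integral_cbox_eq_0_iff[OF cont]) (use z in \<open>auto simp: \<zeta>_def exp_bump_nonneg\<close>)
    then have "\<zeta> 0 = 0" using z box_subset_cbox by blast
    moreover have "\<zeta> 0 > 0" unfolding \<zeta>_def using \<open>d > 0\<close> by (intro exp_bump_pos) auto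
    ultimately show False by simp
  qed
  moreover have "integral (cbox (-a) a) \<zeta> \<ge> 0"
    by (intro integral_nonneg integrable_continuous cont) (simp add: \<zeta>_def exp_bump_nonneg)
  ultimately have pos: "integral (cbox (-a) a) \<zeta> > 0" by simp
  show thesis
  proof (rule that[of "\<lambda>x. inverse (integral (cbox (-a) a) \<zeta>) * \<zeta> x" "-a" a])
    fix x assume "inverse (integral (cbox (-a) a) \<zeta>) * \<zeta> x \<noteq> 0"
    then have "d\<^sup>2 - x \<bullet> x > 0" using exp_bump_eq_0[of "d\<^sup>2 - x \<bullet> x" 1] by (auto simp: \<zeta>_def not_le[symmetric])
    then have "(norm x)\<^sup>2 < d\<^sup>2" by (simp add: dot_square_norm)
    then have "norm x \<le> d" using \<open>d > 0\<close> power_less_imp_less_base[of "norm x" 2 d] by linarith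
    moreover from this have "x \<in> cball 0 d" by simp
    ultimately show "norm x \<le> d \<and> x \<in> cbox (-a) a" using a box_subset_cbox by blast
  next
    show "0 \<le> inverse (integral (cbox (-a) a) \<zeta>) * \<zeta> x" for x
      using pos by (simp add: \<zeta>_def exp_bump_nonneg)
  qed (use pos in \<open>auto intro!: Ck_mult Ck_const ck\<close>)
qed

lemma convolution_close:
  fixes u \<eta> :: "'a::euclidean_space \<Rightarrow> real"
  assumes u: "continuous_on UNIV u" and \<eta>: "continuous_on UNIV \<eta>" "\<And>x. 0 \<le> \<eta> x"
    "\<And>x. \<eta> x \<noteq> 0 \<Longrightarrow> norm x \<le> d" "integral (cbox a b) \<eta> = 1"
    and d: "\<And>x y. norm (x - y) \<le> d \<Longrightarrow> norm (u x - u y) \<le> e"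
  shows "\<bar>integral (cbox a b) (\<lambda>y. \<eta> y * u (x - y)) - u x\<bar> \<le> e"
proof -
  note [continuous_intros] = continuous_on_compose2[OF u] continuous_on_compose2[OF \<eta>(1)]
  have "integral (cbox a b) (\<lambda>y. \<eta> y * u (x - y)) - u x =
      integral (cbox a b) (\<lambda>y. \<eta> y * u (x - y)) - integral (cbox a b) (\<lambda>y. \<eta> y * u x)"
    using \<eta>(4) by simp
  also have "\<dots> = integral (cbox a b) (\<lambda>y. \<eta> y * u (x - y) - \<eta> y * u x)"
    by (intro Henstock_Kurzweil_Integration.integral_diff[symmetric] integrable_continuous continuous_intros) auto
  also have "norm \<dots> \<le> integral (cbox a b) (\<lambda>y. \<eta> y * e)"
  proof (intro integral_norm_bound_integral integrable_continuous continuous_intros)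
    fix y
    show "norm (\<eta> y * u (x - y) - \<eta> y * u x) \<le> \<eta> y * e"
    proof (cases "\<eta> y = 0")
      case False
      with \<eta>(3)[of y] d[of "x - y" x] have "norm (u (x - y) - u x) \<le> e" by simp
      then have "\<eta> y * norm (u (x - y) - u x) \<le> \<eta> y * e" by (intro mult_left_mono \<eta>)
      then show ?thesis using \<eta>(2)[of y] by (simp add: abs_mult flip: right_diff_distrib)
    qed simp
  qed auto
  also have "\<dots> = e" using \<eta>(4) by simp
  finally show ?thesis by simp
qed

text \<open>Only the derivative in the direction \<open>b\<close> is controlled, since one weak
  derivative is tested at a time. The last property keeps the supports inside a fixed compact
  neighbourhood of the original one.\<close>

lemma smooth_approximation:
  fixes \<phi> :: "'a::euclidean_space \<Rightarrow> real"
  assumes "Ck 1 \<phi>" and R: "\<And>x. \<phi> x \<noteq> 0 \<Longrightarrow> norm x \<le> R" and "e > 0" and b: "b \<in> Basis"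
  obtains \<psi> where "\<And>k. Ck k \<psi>" "\<And>x. \<bar>\<psi> x - \<phi> x\<bar> \<le> e"
    "\<And>x. \<bar>frechet_derivative \<psi> (at x) b - frechet_derivative \<phi> (at x) b\<bar> \<le> e"
    "\<And>x. \<psi> x \<noteq> 0 \<Longrightarrow> \<exists>y. \<phi> y \<noteq> 0 \<and> dist y x \<le> e"
proof -
  let ?D = "\<lambda>x. frechet_derivative \<phi> (at x) b"
  have c: "continuous_on UNIV \<phi>" "continuous_on UNIV ?D"
    using assms(1) Ck_Suc_imp_Ck[of 0 \<phi>] b by auto
  have R': "norm x \<le> R" if "?D x \<noteq> 0" for x
    using frechet_derivative_eq_0_outside[of "cball 0 R" \<phi> x] R that by fastforce
  obtain d1 where d1: "d1 > 0" "\<And>x y. norm (x - y) \<le> d1 \<Longrightarrow> norm (\<phi> x - \<phi> y) \<le> e"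
    using uniform_continuity_bounded_support[OF c(1) R \<open>e > 0\<close>] by metis
  obtain d2 where d2: "d2 > 0" "\<And>x y. norm (x - y) \<le> d2 \<Longrightarrow> norm (?D x - ?D y) \<le> e"
    using uniform_continuity_bounded_support[OF c(2) R' \<open>e > 0\<close>] by metis
  define d where "d = Min {d1, d2, e}"
  have d: "d > 0" "d \<le> d1" "d \<le> d2" "d \<le> e" using d1 d2 \<open>e > 0\<close> by (auto simp: d_def)
  obtain \<eta> :: "'a \<Rightarrow> real" and l u where \<eta>: "\<And>k. Ck k \<eta>" "\<And>x. 0 \<le> \<eta> x"
    "\<And>x. \<eta> x \<noteq> 0 \<Longrightarrow> norm x \<le> d \<and> x \<in> cbox l u" "integral (cbox l u) \<eta> = 1"
    using mollifier_exists[OF d(1)] by metis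
  have c\<eta>: "continuous_on UNIV \<eta>" using \<eta>(1)[of 0] by simp
  obtain p where p: "cball 0 R \<subseteq> cbox (-p) (p::'a)"
    using bounded_subset_cbox_symmetric[OF bounded_cball] by blast
  define \<psi> where "\<psi> x = integral (cbox (-p) p) (\<lambda>y. \<phi> y * \<eta> (x - y))" for x
  have \<psi>: "\<psi> = (\<lambda>x. integral (cbox l u) (\<lambda>y. \<eta> y * \<phi> (x - y)))"
    unfolding \<psi>_def
    by (intro ext integral_convolution_commute c c\<eta>) (use R p \<eta>(3) in \<open>auto simp: subset_iff\<close>)
  have \<eta>d: "norm x \<le> d" if "\<eta> x \<noteq> 0" for x
    using \<eta>(3)[OF that] by simp
  have close: "norm (\<phi> x - \<phi> y) \<le> e" "norm (?D x - ?D y) \<le> e" if "norm (x - y) \<le> d" for x y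
    using d1(2)[of x y] d2(2)[of x y] that d by simp_all
  show thesis
  proof (rule that)
    show "Ck k \<psi>" for k
      unfolding \<psi>_def by (intro Ck_convolution c \<eta>)
    show "\<bar>\<psi> x - \<phi> x\<bar> \<le> e" for x
      unfolding \<psi> by (rule convolution_close[OF c(1) c\<eta> \<eta>(2) \<eta>d \<eta>(4) close(1)])
    have "frechet_derivative \<psi> (at x) = (\<lambda>v. integral (cbox l u) (\<lambda>y. \<eta> y * frechet_derivative \<phi> (at (x - y)) v))" for x
      unfolding \<psi> by (rule frechet_derivative_at[OF has_derivative_parametric_integral[OF c\<eta> assms(1)], symmetric])
    then show "\<bar>frechet_derivative \<psi> (at x) b - ?D x\<bar> \<le> e" for x
      using convolution_close[OF c(2) c\<eta> \<eta>(2) \<eta>d \<eta>(4) close(2)] by simp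
    show "\<exists>y. \<phi> y \<noteq> 0 \<and> dist y x \<le> e" if "\<psi> x \<noteq> 0" for x
    proof (rule ccontr)
      assume *: "\<not> ?thesis"
      have "\<eta> y * \<phi> (x - y) = 0" for y
      proof (cases "\<eta> y = 0")
        case False
        then have "dist (x - y) x \<le> e" using \<eta>(3)[of y] d(4) by (simp add: dist_norm)
        with * have "\<phi> (x - y) = 0" by blast
        then show ?thesis by simp
      qed simp
      then have "(\<lambda>y. \<eta> y * \<phi> (x - y)) = (\<lambda>y. 0)" ..
      then have "\<psi> x = 0" by (simp only: \<psi>) simp
      with that show False by simp
    qed
  qed
qed


subsection \<open>Weak derivatives tested with continuously differentiable functions\<close>

text \<open>This is \<open>has_weak_partial\<close> with the pair of indices replaced by a
  direction, so that the divergence theorem can be proved in an arbitrary Euclidean space.\<close>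

definition weak_deriv :: "'a::euclidean_space set \<Rightarrow> 'a \<Rightarrow> ('a \<Rightarrow> 'b::euclidean_space) \<Rightarrow> ('a \<Rightarrow> 'b) \<Rightarrow> bool" where
  "weak_deriv U b u g \<longleftrightarrow> locally_integrable U u \<and> locally_integrable U g \<and>
     (\<forall>\<phi>. test_function U \<phi> \<longrightarrow>
       (LINT y:U|lebesgue. frechet_derivative \<phi> (at y) b *\<^sub>R u y) = - (LINT y:U|lebesgue. \<phi> y *\<^sub>R g y))"

lemma integrable_scaleR_support:
  fixes g :: "'a::euclidean_space \<Rightarrow> 'b::euclidean_space"
  assumes \<phi>: "\<phi> \<in> borel_measurable lebesgue" "\<And>x. x \<in> K \<Longrightarrow> \<bar>\<phi> x\<bar> \<le> M" "\<And>x. x \<notin> K \<Longrightarrow> \<phi> x = 0"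
    and g: "set_integrable lebesgue K g"
  shows "integrable lebesgue (\<lambda>x. \<phi> x *\<^sub>R g x)"
    and "norm (LINT x|lebesgue. \<phi> x *\<^sub>R g x) \<le> M * (LINT x:K|lebesgue. norm (g x))"
proof -
  have eq: "\<phi> x *\<^sub>R g x = \<phi> x *\<^sub>R (indicator K x *\<^sub>R g x)" for x
    using \<phi>(3) by (cases "x \<in> K") auto
  have i: "integrable lebesgue (\<lambda>x. indicator K x *\<^sub>R g x)" using g unfolding set_integrable_def .
  then have i2: "integrable lebesgue (\<lambda>x. M *\<^sub>R (indicator K x *\<^sub>R norm (g x)))"
    using integrable_norm[OF i] by (intro integrable_scaleR_right) simp
  have b: "norm (\<phi> x *\<^sub>R g x) \<le> M *\<^sub>R (indicator K x *\<^sub>R norm (g x))" for x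
    using \<phi>(2,3) by (cases "x \<in> K") (auto intro: mult_right_mono)
  show int: "integrable lebesgue (\<lambda>x. \<phi> x *\<^sub>R g x)"
  proof (rule Bochner_Integration.integrable_bound[OF i2])
    have "(\<lambda>x. \<phi> x *\<^sub>R (indicator K x *\<^sub>R g x)) \<in> borel_measurable lebesgue"
      by (rule borel_measurable_scaleR[OF \<phi>(1) borel_measurable_integrable[OF i]])
    then show "(\<lambda>x. \<phi> x *\<^sub>R g x) \<in> borel_measurable lebesgue"
      by (simp only: flip: eq)
    show "AE x in lebesgue. norm (\<phi> x *\<^sub>R g x) \<le> norm (M *\<^sub>R (indicator K x *\<^sub>R norm (g x)))"
      using b by (intro AE_I2) (metis abs_ge_self order_trans real_norm_def)
  qed
  have "norm (LINT x|lebesgue. \<phi> x *\<^sub>R g x) \<le> (LINT x|lebesgue. M *\<^sub>R (indicator K x *\<^sub>R norm (g x)))"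
    by (rule order_trans[OF integral_norm_bound Bochner_Integration.integral_mono[OF integrable_norm[OF int] i2 b]])
  then show "norm (LINT x|lebesgue. \<phi> x *\<^sub>R g x) \<le> M * (LINT x:K|lebesgue. norm (g x))"
    by (simp add: set_lebesgue_integral_def)
qed

lemma bounded_continuous_support:
  fixes \<phi> :: "'a::euclidean_space \<Rightarrow> 'b::real_normed_vector"
  assumes "continuous_on UNIV \<phi>" "compact K" "\<And>x. x \<notin> K \<Longrightarrow> \<phi> x = 0"
  obtains M where "M \<ge> 0" "\<And>x. norm (\<phi> x) \<le> M"
proof -
  have "compact (\<phi> ` K)" using assms by (intro compact_continuous_image) (auto intro: continuous_on_subset)
  then obtain M where M: "\<And>x. x \<in> K \<Longrightarrow> norm (\<phi> x) \<le> M" using compact_imp_bounded by (force simp: bounded_iff)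
  show thesis by (rule that[of "max M 0"]) (use M assms(3) in \<open>fastforce simp: le_max_iff_disj\<close>)+
qed

text \<open>Mollifying \<open>\<phi>\<close> gives test functions that converge uniformly together
  with their derivative along \<open>b\<close>. Their supports stay in the compact neighbourhood
  \<open>L\<close> of \<open>K\<close>, on which \<open>u\<close> and \<open>g\<close> are
  integrable, so both integrals converge.\<close>

lemma weak_deriv_Ck1:
  fixes \<phi> :: "'a::euclidean_space \<Rightarrow> real" and u g :: "'a \<Rightarrow> 'b::euclidean_space"
  assumes w: "weak_deriv U b u g" and "open U" and b: "b \<in> Basis"
    and \<phi>: "Ck 1 \<phi>" and K: "compact K" "K \<subseteq> U" and supp: "\<And>x. x \<notin> K \<Longrightarrow> \<phi> x = 0"
  shows "integrable lebesgue (\<lambda>y. frechet_derivative \<phi> (at y) b *\<^sub>R u y)"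
    and "integrable lebesgue (\<lambda>y. \<phi> y *\<^sub>R g y)"
    and "(LINT y|lebesgue. frechet_derivative \<phi> (at y) b *\<^sub>R u y) = - (LINT y|lebesgue. \<phi> y *\<^sub>R g y)"
proof -
  let ?D = "\<lambda>\<phi> y. frechet_derivative \<phi> (at y) b"
  obtain e0 where e0: "e0 > 0" "(\<Union>x\<in>K. cball x e0) \<subseteq> U"
    using compact_subset_open_imp_cball_epsilon_subset[OF K(1) \<open>open U\<close> K(2)] by metis
  define L where "L = (\<Union>x\<in>K. cball x e0)"
  have L: "compact L" "L \<subseteq> U" "K \<subseteq> L" unfolding L_def
    using compact_minkowski_sum_cball[OF K(1)] e0 by auto
  have ui: "set_integrable lebesgue L u" and gi: "set_integrable lebesgue L g"
    using w L by (auto simp: weak_deriv_def locally_integrable_def)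
  have cD: "continuous_on UNIV \<psi> \<and> continuous_on UNIV (?D \<psi>)" if "Ck 1 \<psi>" for \<psi>
    using that b Ck_Suc_imp_Ck[of 0 \<psi>] by auto
  have int: "integrable lebesgue (\<lambda>y. ?D \<psi> y *\<^sub>R u y)" "integrable lebesgue (\<lambda>y. \<psi> y *\<^sub>R g y)"
    if c: "Ck 1 \<psi>" and s: "\<And>x. x \<notin> L \<Longrightarrow> \<psi> x = 0" for \<psi>
  proof -
    have s': "?D \<psi> x = 0" if "x \<notin> L" for x
      using frechet_derivative_eq_0_outside[OF compact_imp_closed[OF L(1)] s that] by simp
    obtain M1 where M1: "\<And>x. norm (\<psi> x) \<le> M1"
      using bounded_continuous_support[of \<psi> L] cD[OF c] L s by metis
    obtain M2 where M2: "\<And>x. norm (?D \<psi> x) \<le> M2"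
      using bounded_continuous_support[of "?D \<psi>" L] cD[OF c] L s' by metis
    have m: "\<psi> \<in> borel_measurable lebesgue" "?D \<psi> \<in> borel_measurable lebesgue"
      using cD[OF c] by (auto intro!: measurable_completion borel_measurable_continuous_onI)
    show "integrable lebesgue (\<lambda>y. ?D \<psi> y *\<^sub>R u y)"
      by (rule integrable_scaleR_support[OF m(2) _ s' ui]) (use M2 in auto)
    show "integrable lebesgue (\<lambda>y. \<psi> y *\<^sub>R g y)"
      by (rule integrable_scaleR_support[OF m(1) _ s gi]) (use M1 in auto)
  qed
  have supp': "\<And>x. x \<notin> L \<Longrightarrow> \<phi> x = 0" using supp L by auto
  show i1: "integrable lebesgue (\<lambda>y. ?D \<phi> y *\<^sub>R u y)" and i2: "integrable lebesgue (\<lambda>y. \<phi> y *\<^sub>R g y)"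
    using int[OF \<phi> supp'] by auto
  obtain R where R: "\<And>x. x \<in> K \<Longrightarrow> norm x \<le> R" using compact_imp_bounded[OF K(1)] by (auto simp: bounded_iff)
  let ?A = "(LINT y|lebesgue. ?D \<phi> y *\<^sub>R u y) + (LINT y|lebesgue. \<phi> y *\<^sub>R g y)"
  have le: "norm ?A \<le> e * ((LINT y:L|lebesgue. norm (u y)) + (LINT y:L|lebesgue. norm (g y)))"
    if e: "0 < e" "e \<le> e0" for e
  proof -
    obtain \<psi> where \<psi>: "\<And>k. Ck k \<psi>" "\<And>x. \<bar>\<psi> x - \<phi> x\<bar> \<le> e"
      "\<And>x. \<bar>?D \<psi> x - ?D \<phi> x\<bar> \<le> e" "\<And>x. \<psi> x \<noteq> 0 \<Longrightarrow> \<exists>y. \<phi> y \<noteq> 0 \<and> dist y x \<le> e"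
      using smooth_approximation[OF \<phi> _ e(1) b, of R] supp R by metis
    have sL: "\<psi> x = 0" if "x \<notin> L" for x
      using \<psi>(4)[of x] supp that e unfolding L_def by (force simp: mem_cball)
    have cl: "closure {x. \<psi> x \<noteq> 0} \<subseteq> L"
      by (rule closure_minimal) (use sL compact_imp_closed[OF L(1)] in auto)
    then have "test_function U \<psi>"
      unfolding test_function_def using \<psi>(1) L cl by (metis closed_Int_compact closed_closure inf.absorb_iff1 subset_trans)
    with w have "(LINT y:U|lebesgue. ?D \<psi> y *\<^sub>R u y) = - (LINT y:U|lebesgue. \<psi> y *\<^sub>R g y)"
      by (simp add: weak_deriv_def)
    moreover have s': "?D \<psi> x = 0" if "x \<notin> L" for x
      using frechet_derivative_eq_0_outside[OF compact_imp_closed[OF L(1)] sL that] by simp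
    have "(LINT y:U|lebesgue. ?D \<psi> y *\<^sub>R u y) = (LINT y|lebesgue. ?D \<psi> y *\<^sub>R u y)"
      unfolding set_lebesgue_integral_def using s' L
      by (intro Bochner_Integration.integral_cong) (auto simp: indicator_def)
    moreover have "(LINT y:U|lebesgue. \<psi> y *\<^sub>R g y) = (LINT y|lebesgue. \<psi> y *\<^sub>R g y)"
      unfolding set_lebesgue_integral_def using sL L
      by (intro Bochner_Integration.integral_cong) (auto simp: indicator_def)
    ultimately have eq: "(LINT y|lebesgue. ?D \<psi> y *\<^sub>R u y) = - (LINT y|lebesgue. \<psi> y *\<^sub>R g y)" by simp
    have s'': "?D \<phi> x = 0" if "x \<notin> L" for x
      using frechet_derivative_eq_0_outside[OF compact_imp_closed[OF L(1)] supp' that] by simp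
    have \<psi>1: "Ck 1 \<psi>" by (rule \<psi>)
    have m: "\<psi> \<in> borel_measurable lebesgue" "?D \<psi> \<in> borel_measurable lebesgue"
      "\<phi> \<in> borel_measurable lebesgue" "?D \<phi> \<in> borel_measurable lebesgue"
      using cD[OF \<psi>1] cD[OF \<phi>] by (auto intro!: measurable_completion borel_measurable_continuous_onI)
    have "?A = (LINT y|lebesgue. (?D \<phi> y - ?D \<psi> y) *\<^sub>R u y) + (LINT y|lebesgue. (\<phi> y - \<psi> y) *\<^sub>R g y)"
      unfolding scaleR_diff_left using int[OF \<psi>1 sL] i1 i2 eq by (simp add: Bochner_Integration.integral_diff)
    also have "norm \<dots> \<le> e * (LINT y:L|lebesgue. norm (u y)) + e * (LINT y:L|lebesgue. norm (g y))"
      by (intro norm_triangle_le add_mono integrable_scaleR_support(2) ui gi)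
        (use m s' s'' sL supp' \<psi>(2,3) in \<open>auto simp: abs_minus_commute\<close>)
    finally show ?thesis by (simp add: distrib_left)
  qed
  have "norm ?A \<le> 0"
  proof (rule tendsto_lowerbound[of "\<lambda>e. e * ((LINT y:L|lebesgue. norm (u y)) + (LINT y:L|lebesgue. norm (g y)))" _ "at_right 0"])
    show "((\<lambda>e. e * ((LINT y:L|lebesgue. norm (u y)) + (LINT y:L|lebesgue. norm (g y)))) \<longlongrightarrow> 0) (at_right 0)"
      by (auto intro!: tendsto_eq_intros)
    show "\<forall>\<^sub>F e in at_right 0. norm ?A \<le> e * ((LINT y:L|lebesgue. norm (u y)) + (LINT y:L|lebesgue. norm (g y)))"
      using le e0(1) by (auto simp: eventually_at_right_field intro!: exI[of _ e0])
  qed simp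
  then show "(LINT y|lebesgue. ?D \<phi> y *\<^sub>R u y) = - (LINT y|lebesgue. \<phi> y *\<^sub>R g y)"
    by (simp add: eq_neg_iff_add_eq_0)
qed


subsection \<open>Integration over hyperplanes\<close>

text \<open>\<open>Basis\<close> never contains a vector together with its negative, so removing
  \<open>e\<close> and \<open>- e\<close> drops exactly one coordinate.\<close>

lemma signed_Basis:
  assumes "e \<in> Basis \<or> - e \<in> (Basis :: 'a::euclidean_space set)"
  obtains b and c :: real where "b \<in> Basis" "e = c *\<^sub>R b" "c = 1 \<or> c = -1" "Basis - {e, - e} = Basis - {b}"
proof -
  have nb: "- b \<notin> Basis" if "b \<in> Basis" for b :: 'a
  proof
    assume "- b \<in> Basis"
    then have "b \<bullet> (- b) \<ge> 0" using inner_Basis[OF that \<open>- b \<in> Basis\<close>] by (simp only:) simp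
    moreover have "b \<bullet> (- b) = - 1" using that by simp
    ultimately show False by linarith
  qed
  from assms show thesis
  proof
    assume "e \<in> Basis"
    then show thesis using nb[of e] by (intro that[of e 1]) auto
  next
    assume "- e \<in> Basis"
    then show thesis using nb[of "- e"] by (intro that[of "- e" "-1"]) auto
  qed
qed

lemma inner_signed_Basis_self: "e \<in> Basis \<or> - e \<in> Basis \<Longrightarrow> e \<bullet> e = 1"
  by (metis inner_minus_left inner_minus_right inner_same_Basis minus_minus)

lemma sets_hyperplane_lborel [simp, measurable_cong]: "sets (hyperplane_lborel e) = sets borel"
  and space_hyperplane_lborel [simp]: "space (hyperplane_lborel e) = UNIV"
  by (simp_all add: hyperplane_lborel_def)

lemma AE_hyperplane_lborel:
  assumes "e \<in> Basis \<or> - e \<in> (Basis :: 'a::euclidean_space set)"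
  shows "AE z in hyperplane_lborel e. z \<bullet> e = 0"
proof -
  have "(\<Sum>b\<in>Basis - {e, - e}. c b *\<^sub>R b) \<bullet> e = 0" for c :: "'a \<Rightarrow> real"
  proof -
    obtain b0 and s :: real where b0: "b0 \<in> Basis" "e = s *\<^sub>R b0" "Basis - {e, - e} = Basis - {b0}"
      using signed_Basis[OF assms] by metis
    have "(\<Sum>b\<in>Basis - {b0}. c b *\<^sub>R b) \<bullet> b0 = 0"
      unfolding inner_sum_left using b0(1) by (intro sum.neutral) (auto simp: inner_Basis)
    then show ?thesis unfolding b0(3) unfolding b0(2) by simp
  qed
  then show ?thesis
    unfolding hyperplane_lborel_def by (subst AE_distr_iff) auto
qed

interpretation lborel_product: product_sigma_finite "\<lambda>_::'i. lborel :: 'a::euclidean_space measure"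
  by standard

lemma finite_hyperplane_lborel_cball:
  assumes "e \<in> Basis \<or> - e \<in> (Basis :: 'a::euclidean_space set)"
  shows "emeasure (hyperplane_lborel e) (cball 0 R) < \<infinity>"
proof -
  let ?B = "Basis - {e, - e}" and ?P = "\<lambda>c. \<Sum>b\<in>Basis - {e, - e}. c b *\<^sub>R b"
  have "emeasure (hyperplane_lborel e) (cball 0 R) =
      emeasure (\<Pi>\<^sub>M b\<in>?B. lborel) (?P -` cball 0 R \<inter> space (\<Pi>\<^sub>M b\<in>?B. lborel))"
    unfolding hyperplane_lborel_def by (subst emeasure_distr) auto
  also have "\<dots> \<le> emeasure (\<Pi>\<^sub>M b\<in>?B. lborel) (\<Pi>\<^sub>E b\<in>?B. {-R..R})"
  proof (rule emeasure_mono)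
    show "?P -` cball 0 R \<inter> space (\<Pi>\<^sub>M b\<in>?B. lborel) \<subseteq> (\<Pi>\<^sub>E b\<in>?B. {-R..R})"
    proof
      fix c assume c: "c \<in> ?P -` cball 0 R \<inter> space (\<Pi>\<^sub>M b\<in>?B. lborel)"
      have "\<bar>c b\<bar> \<le> R" if b: "b \<in> ?B" for b
      proof -
        have "?P c \<bullet> b = (\<Sum>b'\<in>?B. if b' = b then c b else 0)"
          unfolding inner_sum_left using b by (intro sum.cong refl) (auto simp: inner_Basis)
        then have "?P c \<bullet> b = c b" using b by simp
        then show ?thesis using Basis_le_norm[of b "?P c"] b c by auto
      qed
      then have "\<forall>b\<in>?B. c b \<in> {-R..R}" by (auto simp: abs_le_iff minus_le_iff)
      moreover have "c \<in> extensional ?B" using c by (simp add: space_PiM PiE_def)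
      ultimately show "c \<in> (\<Pi>\<^sub>E b\<in>?B. {-R..R})" by (simp add: PiE_def Pi_def)
    qed
    show "(\<Pi>\<^sub>E b\<in>?B. {-R..R}) \<in> sets (\<Pi>\<^sub>M b\<in>?B. lborel)"
      by (intro sets_PiM_I_finite) auto
  qed
  also have "\<dots> = (\<Prod>b\<in>?B. emeasure lborel {-R..R})"
    by (intro lborel_product.emeasure_PiM) auto
  also have "\<dots> < \<infinity>"
    by (simp add: power_less_top_ennreal emeasure_lborel_Icc_eq)
  finally show ?thesis .
qed

text \<open>Fubini with the coordinate along \<open>e\<close> split off. If \<open>e\<close> is the
  negative of a coordinate vector, reflecting the line leaves the inner integral unchanged.\<close>

lemma lborel_integral_hyperplane:
  fixes F :: "'a::euclidean_space \<Rightarrow> 'b::{banach, second_countable_topology}"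
  assumes e: "e \<in> Basis \<or> - e \<in> Basis" and F: "integrable lborel F"
  shows "(LINT y|lborel. F y) = (LINT z|hyperplane_lborel e. LINT t|lborel. F (z + t *\<^sub>R e))"
proof -
  obtain b and s :: real where b: "b \<in> Basis" and s: "e = s *\<^sub>R b" "s = 1 \<or> s = -1" and B: "Basis - {e, - e} = Basis - {b}"
    using signed_Basis[OF e] by metis
  have [measurable]: "F \<in> borel_measurable borel" using borel_measurable_integrable[OF F] by simp
  let ?P = "\<lambda>I c. \<Sum>b\<in>I. c b *\<^sub>R b"
  have ins: "insert b (Basis - {b}) = Basis" using b by auto
  have eq: "lborel = distr (\<Pi>\<^sub>M b\<in>Basis. lborel) borel (?P Basis)" by (rule lborel_eq)
  have int: "integrable (\<Pi>\<^sub>M b\<in>Basis. lborel) (\<lambda>c. F (?P Basis c))"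
  proof -
    have "integrable (distr (\<Pi>\<^sub>M b\<in>Basis. lborel) borel (?P Basis)) F"
      by (subst eq[symmetric]) (rule F)
    then show ?thesis by (subst (asm) integrable_distr_eq) auto
  qed
  have "(LINT y|lborel. F y) = (LINT c|(\<Pi>\<^sub>M b\<in>Basis. lborel). F (?P Basis c))"
    by (subst eq, subst integral_distr) auto
  also have "\<dots> = (LINT c|(\<Pi>\<^sub>M b\<in>Basis - {b}. lborel). LINT t|lborel. F (?P Basis (c(b := t))))"
    using lborel_product.product_integral_insert[of "Basis - {b}" b "\<lambda>c. F (?P Basis c)"] int
    unfolding ins by simp
  also have "\<dots> = (LINT c|(\<Pi>\<^sub>M b\<in>Basis - {b}. lborel). LINT t|lborel. F (?P (Basis - {b}) c + t *\<^sub>R e))"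
  proof (rule Bochner_Integration.integral_cong[OF refl])
    fix c :: "'a \<Rightarrow> real"
    have "?P Basis (c(b := t)) = ?P (Basis - {b}) c + t *\<^sub>R b" for t
    proof -
      have "?P Basis (c(b := t)) = t *\<^sub>R b + ?P (Basis - {b}) (c(b := t))"
        using b by (subst sum.remove[of _ b]) auto
      also have "?P (Basis - {b}) (c(b := t)) = ?P (Basis - {b}) c"
        by (intro sum.cong) auto
      finally show ?thesis by simp
    qed
    moreover have "(LINT t|lborel. F (?P (Basis - {b}) c + t *\<^sub>R b)) = (LINT t|lborel. F (?P (Basis - {b}) c + t *\<^sub>R e))"
      using lborel_integral_real_affine[of s "\<lambda>t. F (?P (Basis - {b}) c + t *\<^sub>R b)" 0] s by auto
    ultimately show "(LINT t|lborel. F (?P Basis (c(b := t)))) = (LINT t|lborel. F (?P (Basis - {b}) c + t *\<^sub>R e))"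
      by simp
  qed
  also have "\<dots> = (LINT z|hyperplane_lborel e. LINT t|lborel. F (z + t *\<^sub>R e))"
    unfolding hyperplane_lborel_def B by (subst integral_distr) auto
  finally show ?thesis .
qed


subsection \<open>Local graph representations of the boundary\<close>

lemma C2_graphD:
  assumes "C2_graph \<Omega> V e g"
  shows "open V" "e \<in> Basis \<or> - e \<in> Basis" "Ck 1 g" "g (x + t *\<^sub>R e) = g x"
    "x \<in> V \<Longrightarrow> x \<in> \<Omega> \<longleftrightarrow> x \<bullet> e < g x" "continuous_on UNIV g" "e \<bullet> e = 1"
proof -
  show *: "open V" "e \<in> Basis \<or> - e \<in> Basis" "Ck 1 g" "g (x + t *\<^sub>R e) = g x"
    "x \<in> V \<Longrightarrow> x \<in> \<Omega> \<longleftrightarrow> x \<bullet> e < g x"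
    using assms Ck_mono[of 2 g 1] by (auto simp: C2_graph_def)
  show "continuous_on UNIV g" using *(3) Ck_Suc_imp_Ck[of 0 g] by simp
  show "e \<bullet> e = 1" using *(2) by (rule inner_signed_Basis_self)
qed

lemma C2_graph_grad:
  assumes "C2_graph \<Omega> V e g"
  shows "grad g (x + t *\<^sub>R e) = grad g x" "grad g x \<bullet> e = 0"
proof -
  note g = C2_graphD[OF assms]
  have "((\<lambda>x. g (x + t *\<^sub>R e)) has_derivative (\<lambda>v. grad g (x + t *\<^sub>R e) \<bullet> v)) (at x)"
    by (rule has_derivative_eq_rhs, rule has_derivative_compose[OF _ Ck1_grad(1)[OF g(3)]])
      (auto intro!: derivative_eq_intros)
  then have "(g has_derivative (\<lambda>v. grad g (x + t *\<^sub>R e) \<bullet> v)) (at x)" by (simp add: g(4))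
  from has_derivative_unique[OF this Ck1_grad(1)[OF g(3)]]
  show "grad g (x + t *\<^sub>R e) = grad g x" by (metis vector_eq_rdot)
  have "((\<lambda>t::real. g (x + t *\<^sub>R e)) has_derivative (\<lambda>t. grad g x \<bullet> (t *\<^sub>R e))) (at 0)"
    by (rule has_derivative_eq_rhs, rule has_derivative_compose[where g = g], rule derivative_eq_intros refl)+
      (auto intro!: derivative_eq_intros Ck1_grad(1)[OF g(3)])
  then have "((\<lambda>t::real. g x) has_derivative (\<lambda>t. grad g x \<bullet> (t *\<^sub>R e))) (at 0)" by (simp add: g(4))
  from has_derivative_unique[OF this has_derivative_const]
  show "grad g x \<bullet> e = 0" by (metis scaleR_one)
qed

text \<open>Within \<open>V\<close> the regions strictly below and strictly above the graph are
  open, one inside \<Omega> and one disjoint from it. A point on the graph is not in \<Omega>, but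
  any small move along \<open>- e\<close> enters it.\<close>

lemma C2_graph_frontier:
  assumes "C2_graph \<Omega> V e g" "x \<in> V"
  shows "x \<in> frontier \<Omega> \<longleftrightarrow> x \<bullet> e = g x"
proof -
  note g = C2_graphD[OF assms(1)]
  have cont: "continuous_on UNIV (\<lambda>x. x \<bullet> e - g x)" by (intro continuous_intros g(6))
  have opens: "open (V \<inter> {x. x \<bullet> e - g x < 0})" "open (V \<inter> {x. x \<bullet> e - g x > 0})"
    using g(1) by (auto intro!: open_Int open_Collect_less cont continuous_intros g(6))
  show ?thesis
  proof
    assume x: "x \<in> frontier \<Omega>"
    show "x \<bullet> e = g x"
    proof (cases "x \<bullet> e" "g x" rule: linorder_cases)
      case less
      have "V \<inter> {x. x \<bullet> e - g x < 0} \<subseteq> \<Omega>" using g(5) by auto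
      then have "x \<in> interior \<Omega>" using less assms(2) opens(1) by (intro interiorI[of "V \<inter> {x. x \<bullet> e - g x < 0}"]) auto
      with x show ?thesis by (auto simp: frontier_def)
    next
      case greater
      have "(V \<inter> {x. x \<bullet> e - g x > 0}) \<inter> \<Omega> = {}" using g(5) by force
      then have "(V \<inter> {x. x \<bullet> e - g x > 0}) \<inter> closure \<Omega> = {}" using opens(2) open_Int_closure_eq_empty by blast
      with greater assms(2) x show ?thesis by (auto simp: frontier_def)
    qed
  next
    assume eq: "x \<bullet> e = g x"
    have "x \<in> closure \<Omega>"
      unfolding closure_approachable
    proof (intro allI impI)
      fix r :: real assume "r > 0"
      obtain r' where r': "r' > 0" "ball x r' \<subseteq> V" using g(1) assms(2) open_contains_ball by metis
      define t where "t = min r r' / 2"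
      have t: "0 < t" "t < r" "t < r'" using \<open>r > 0\<close> r'(1) by (auto simp: t_def min_def)
      have ne: "norm e = 1" using g(7) by (simp add: norm_eq_1)
      have "x - t *\<^sub>R e \<in> V" using r'(2) t ne by (auto simp: subset_iff dist_norm)
      moreover have "(x - t *\<^sub>R e) \<bullet> e < g (x - t *\<^sub>R e)"
        using g(4)[of x "- t"] g(7) eq t by (simp add: inner_diff_left)
      ultimately have "x - t *\<^sub>R e \<in> \<Omega>" using g(5) by blast
      moreover have "dist (x - t *\<^sub>R e) x < r" using t ne by (simp add: dist_norm)
      ultimately show "\<exists>y\<in>\<Omega>. dist y x < r" by blast
    qed
    moreover have "x \<notin> interior \<Omega>" using g(5)[OF assms(2)] eq interior_subset by force
    ultimately show "x \<in> frontier \<Omega>" by (simp add: frontier_def)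
  qed
qed

lemma C2_graph_norm_normal:
  assumes "C2_graph \<Omega> V e g"
  shows "sqrt (1 + (norm (grad g y))\<^sup>2) = norm (e - grad g y)"
proof -
  have "(norm (e - grad g y))\<^sup>2 = 1 + (norm (grad g y))\<^sup>2"
    using C2_graph_grad(2)[OF assms, of y] C2_graphD(7)[OF assms]
    by (simp add: power2_norm_eq_inner inner_diff_left inner_diff_right inner_commute)
  then show ?thesis by (metis norm_ge_zero real_sqrt_abs abs_of_nonneg)
qed

lemma C2_graph_normal_nonzero:
  assumes "C2_graph \<Omega> V e g"
  shows "e - grad g y \<noteq> 0"
proof
  assume "e - grad g y = 0"
  then have "(e - grad g y) \<bullet> e = 0" by simp
  then show False
    using C2_graph_grad(2)[OF assms, of y] C2_graphD(7)[OF assms] by (simp add: inner_diff_left)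
qed

text \<open>If two representations had different normals, some direction would point into \<open>\<Omega>\<close> for one of them
  and out of \<open>\<Omega>\<close> for the other.\<close>

lemma C2_graph_normal_unique:
  assumes c: "C2_graph \<Omega> V e g" "C2_graph \<Omega> V' e' g'" and y: "y \<in> V" "y \<in> V'" "y \<in> frontier \<Omega>"
  shows "(e - grad g y) /\<^sub>R sqrt (1 + (norm (grad g y))\<^sup>2) = (e' - grad g' y) /\<^sub>R sqrt (1 + (norm (grad g' y))\<^sup>2)"
proof -
  define p where "p = e - grad g y"
  define p' where "p' = e' - grad g' y"
  define n where "n = p /\<^sub>R norm p"
  define n' where "n' = p' /\<^sub>R norm p'"
  have p: "norm p > 0" "norm p' > 0"
    using C2_graph_normal_nonzero[OF c(1)] C2_graph_normal_nonzero[OF c(2)] by (auto simp: p_def p'_def)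
  have nn: "n \<bullet> n = 1" "n' \<bullet> n' = 1" using p
    by (auto simp: n_def n'_def dot_square_norm power2_eq_square)
  have pn: "p = norm p *\<^sub>R n" "p' = norm p' *\<^sub>R n'" using p by (auto simp: n_def n'_def)
  have D: "((\<lambda>t. (y + t *\<^sub>R v) \<bullet> e - g (y + t *\<^sub>R v)) has_real_derivative (e - grad g y) \<bullet> v) (at 0)"
    if "C2_graph \<Omega> V e g" for V e g v
  proof -
    have *: "((\<lambda>t. g (y + t *\<^sub>R v)) has_derivative (\<lambda>t. grad g y \<bullet> (t *\<^sub>R v))) (at 0)"
      by (rule has_derivative_eq_rhs, rule has_derivative_compose[where g = g], rule derivative_eq_intros refl)+
        (auto intro!: derivative_eq_intros Ck1_grad(1)[OF C2_graphD(3)[OF that]])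
    show ?thesis
      unfolding has_field_derivative_def
      by (rule has_derivative_eq_rhs, rule has_derivative_diff[OF _ *])
        (auto intro!: derivative_eq_intros simp: inner_diff_left inner_commute algebra_simps)
  qed
  have "n = n'"
  proof (rule ccontr)
    assume "n \<noteq> n'"
    then have "(n - n') \<bullet> (n - n') > 0" by simp
    then have lt: "n \<bullet> n' < 1" using nn by (simp add: inner_diff_left inner_diff_right inner_commute)
    \<comment> \<open>For two different unit vectors the difference \<open>n' - n\<close> has a
      negative inner product with \<open>n\<close> and a positive one with \<open>n'\<close>. Along
      \<open>v\<close> the first defining function decreases and the second increases.\<close>
    define v where "v = n' - n"
    have pv: "p \<bullet> v < 0"
      using p(1) lt nn by (subst pn(1)) (auto simp: v_def inner_diff_right intro!: mult_pos_neg)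
    have pv': "p' \<bullet> v > 0"
      using p(2) lt nn by (subst pn(2)) (auto simp: v_def inner_diff_right inner_commute intro!: mult_pos_pos)
    obtain d where d: "d > 0" "\<And>h. 0 < h \<Longrightarrow> h < d \<Longrightarrow> (y + h *\<^sub>R v) \<bullet> e - g (y + h *\<^sub>R v) < y \<bullet> e - g y"
      using DERIV_neg_dec_right[OF D[OF c(1), of v]] pv by (auto simp: p_def)
    obtain d' where d': "d' > 0" "\<And>h. 0 < h \<Longrightarrow> h < d' \<Longrightarrow> (y + h *\<^sub>R v) \<bullet> e' - g' (y + h *\<^sub>R v) > y \<bullet> e' - g' y"
      using DERIV_pos_inc_right[OF D[OF c(2), of v]] pv' by (auto simp: p'_def)
    have "open (V \<inter> V')" using c[THEN C2_graphD(1)] by (rule open_Int)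
    then obtain r where r: "r > 0" "ball y r \<subseteq> V \<inter> V'" using y open_contains_ball by (metis IntI)
    \<comment> \<open>The first two bounds keep the monotonicity of the two defining functions, the
      third keeps \<open>y + h *\<^sub>R v\<close> in both charts; adding 1 to \<open>norm v\<close>
      makes the denominator visibly positive.\<close>
    define m where "m = Min {d, d', r / (norm v + 1)}"
    define h where "h = m / 2"
    have vp: "norm v + 1 > 0" by (simp add: add_nonneg_pos)
    have "m > 0" "m \<le> d" "m \<le> d'" "m \<le> r / (norm v + 1)" unfolding m_def using d(1) d'(1) r(1) vp by auto
    then have h: "0 < h" "h < d" "h < d'" "h < r / (norm v + 1)" unfolding h_def by linarith+
    have "h * norm v < r"
    proof -
      have "h * norm v \<le> h * (norm v + 1)" using h(1) by simp
      also have "\<dots> < r" using h(4) vp by (simp add: pos_less_divide_eq)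
      finally show ?thesis .
    qed
    then have "y + h *\<^sub>R v \<in> V \<inter> V'" using r(2) h(1) by (auto simp: subset_iff dist_norm)
    moreover have "y \<bullet> e = g y" "y \<bullet> e' = g' y"
      using C2_graph_frontier[OF c(1) y(1)] C2_graph_frontier[OF c(2) y(2)] y(3) by auto
    moreover note d(2)[OF h(1,2)] d'(2)[OF h(1,3)]
    ultimately show False
      using C2_graphD(5)[OF c(1)] C2_graphD(5)[OF c(2)] by (smt (verit) IntD1 IntD2)
  qed
  then show ?thesis
    unfolding C2_graph_norm_normal[OF c(1)] C2_graph_norm_normal[OF c(2)] n_def n'_def p_def p'_def .
qed

text \<open>\<open>unit_outer_normal\<close> only promises some chart; uniqueness allows computing
  in whichever chart is at hand.\<close>

lemma unit_outer_normal_eq: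
  assumes "unit_outer_normal \<Omega> y \<nu>" "C2_graph \<Omega> V e g" "y \<in> V" "y \<in> frontier \<Omega>"
  shows "\<nu> = (e - grad g y) /\<^sub>R sqrt (1 + (norm (grad g y))\<^sup>2)"
  using assms C2_graph_normal_unique unfolding unit_outer_normal_def by metis

lemma continuous_on_normal:
  fixes \<nu> :: "'a::euclidean_space \<Rightarrow> 'a"
  assumes "C2_boundary \<Omega>" "\<forall>y\<in>frontier \<Omega>. unit_outer_normal \<Omega> y (\<nu> y)"
  shows "continuous_on (frontier \<Omega>) \<nu>"
  unfolding continuous_on_eq_continuous_within
proof
  fix p assume p: "p \<in> frontier \<Omega>"
  then obtain V e g where V: "p \<in> V" and c: "C2_graph \<Omega> V e g"
    using assms(1) unfolding C2_boundary_def by blast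
  let ?N = "\<lambda>y. (e - grad g y) /\<^sub>R sqrt (1 + (norm (grad g y))\<^sup>2)"
  have "continuous_on UNIV ?N"
    by (intro continuous_intros Ck1_grad(2) C2_graphD(3)[OF c]) (metis C2_graph_norm_normal[OF c] C2_graph_normal_nonzero[OF c] norm_eq_zero)
  then have "continuous (at p within frontier \<Omega>) ?N"
    by (meson UNIV_I continuous_on_eq_continuous_within continuous_on_subset p subset_UNIV)
  then show "continuous (at p within frontier \<Omega>) \<nu>"
  proof (rule continuous_transform_within_openin)
    show "openin (top_of_set (frontier \<Omega>)) (frontier \<Omega> \<inter> V)"
      using C2_graphD(1)[OF c] by (rule openin_open_Int)
    show "p \<in> frontier \<Omega> \<inter> V" using p V by simp
  qed (use unit_outer_normal_eq[OF _ c] assms(2) in auto)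
qed


subsection \<open>The surface measure in a chart\<close>

lemma surface_measure_space: "surface_measure \<Omega> S \<Longrightarrow> space S = frontier \<Omega>"
  by (metis sets_eq_imp_space_eq space_borel space_restrict_space2 surface_measure_def
      space_restrict_space inf_top.left_neutral UNIV_I inf_top_right)

text \<open>\<open>surface_measure\<close> prescribes only the measures of sets within a chart. It
  follows that \<open>S\<close> restricted to \<open>V\<close> and the image of the weighted
  hyperplane measure under the graph map agree on Borel sets, and then so do integrals.\<close>

lemma surface_integral_chart:
  fixes F :: "'a::euclidean_space \<Rightarrow> 'b::euclidean_space"
  assumes S: "surface_measure \<Omega> S" and c: "C2_graph \<Omega> V e g"
    and F: "F \<in> borel_measurable borel" "\<And>y. y \<notin> V \<Longrightarrow> F y = 0"
  shows "(LINT y|S. F y) =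
    (LINT z|hyperplane_lborel e. sqrt (1 + (norm (grad g z))\<^sup>2) *\<^sub>R F (z + g z *\<^sub>R e))"
proof -
  note g = C2_graphD[OF c]
  have sS: "sets S = sets (restrict_space borel (frontier \<Omega>))" using S by (simp add: surface_measure_def)
  have fr: "frontier \<Omega> \<in> sets borel" by (simp add: frontier_closed borel_closed)
  have id: "(\<lambda>x. x) \<in> S \<rightarrow>\<^sub>M borel"
    by (subst measurable_cong_sets[OF sS refl]) (rule measurable_restrict_space1, simp)
  have [measurable]: "g \<in> borel_measurable borel" "grad g \<in> borel_measurable borel" "V \<in> sets borel" "F \<in> borel_measurable borel"
    using g(6) Ck1_grad(2)[OF g(3)] g(1) F(1) by (auto intro: borel_measurable_continuous_onI)
  let ?T = "\<lambda>z. z + g z *\<^sub>R e" and ?w = "\<lambda>z. sqrt (1 + (norm (grad g z))\<^sup>2)"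
  let ?\<mu> = "density (hyperplane_lborel e) (\<lambda>z. ennreal (indicator V (?T z) * ?w z))"
  let ?\<sigma> = "density S (\<lambda>y. ennreal (indicator V y))"
  have indV: "(\<lambda>y. indicator V y :: real) \<in> borel_measurable S"
    using measurable_compose[OF id, of "indicator V" borel] by simp
  have eq: "distr ?\<sigma> borel (\<lambda>x. x) = distr ?\<mu> borel ?T"
  proof (rule measure_eqI)
    fix A assume "A \<in> sets (distr ?\<sigma> borel (\<lambda>x. x))"
    then have A[measurable]: "A \<in> sets borel" by simp
    have AS: "A \<inter> frontier \<Omega> \<in> sets S" unfolding sS sets_restrict_space using A by blast
    have AVS: "A \<inter> V \<inter> frontier \<Omega> \<in> sets S" unfolding sS sets_restrict_space using A by (auto intro!: image_eqI[of _ _ "A \<inter> V"])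
    have "emeasure (distr ?\<sigma> borel (\<lambda>x. x)) A = emeasure ?\<sigma> (A \<inter> frontier \<Omega>)"
      using id by (subst emeasure_distr) (auto simp: surface_measure_space[OF S])
    also have "\<dots> = (\<integral>\<^sup>+ y. indicator (A \<inter> V \<inter> frontier \<Omega>) y \<partial>S)"
      using indV AS by (subst emeasure_density) (auto intro!: nn_integral_cong simp: indicator_def)
    also have "\<dots> = emeasure S (A \<inter> V \<inter> frontier \<Omega>)" using AVS by simp
    also have "\<dots> = (\<integral>\<^sup>+ z. indicator (A \<inter> V \<inter> frontier \<Omega>) (?T z) * ennreal (?w z) \<partial>hyperplane_lborel e)"
    proof -
      have "\<forall>A\<in>sets borel. A \<subseteq> frontier \<Omega> \<inter> V \<longrightarrow> emeasure S A =
          (\<integral>\<^sup>+ x. indicator A (x + g x *\<^sub>R e) * ennreal (?w x) \<partial>hyperplane_lborel e)"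
        using S c unfolding surface_measure_def by blast
      moreover have "A \<inter> V \<inter> frontier \<Omega> \<in> sets borel" using fr by simp
      moreover have "A \<inter> V \<inter> frontier \<Omega> \<subseteq> frontier \<Omega> \<inter> V" by auto
      ultimately show ?thesis by blast
    qed
    also have "\<dots> = (\<integral>\<^sup>+ z. ennreal (indicator V (?T z) * ?w z) * indicator (?T -` A) z \<partial>hyperplane_lborel e)"
    \<comment> \<open>Almost every \<open>z\<close> is orthogonal to \<open>e\<close>, and then its
      image lies on the graph. Inside \<open>V\<close> it is therefore automatically a frontier
      point.\<close>
    proof (rule nn_integral_cong_AE, use AE_hyperplane_lborel[OF g(2)] in eventually_elim)
      fix z assume z: "z \<bullet> e = 0"
      have "?T z \<in> frontier \<Omega>" if "?T z \<in> V"
        using C2_graph_frontier[OF c that] z g(4)[of z] g(7) by (simp add: inner_add_left)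
      then show "indicator (A \<inter> V \<inter> frontier \<Omega>) (?T z) * ennreal (?w z)
          = ennreal (indicator V (?T z) * ?w z) * indicator (?T -` A) z"
        by (auto simp: indicator_def)
    qed
    also have "\<dots> = emeasure (distr ?\<mu> borel ?T) A"
    proof -
      have "?T -` A \<in> sets borel"
        using measurable_sets_borel[of ?T borel A] A by (auto intro!: borel_measurable_add borel_measurable_scaleR)
      then show ?thesis
        by (subst emeasure_distr, simp_all, subst emeasure_density) auto
    qed
    finally show "emeasure (distr ?\<sigma> borel (\<lambda>x. x)) A = emeasure (distr ?\<mu> borel ?T) A" .
  qed simp
  have "(LINT y|S. F y) = (LINT y|S. indicator V y *\<^sub>R F y)"
    using F(2) by (intro Bochner_Integration.integral_cong) (auto simp: indicator_def)
  also have "\<dots> = (LINT y|?\<sigma>. F y)"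
    using indV measurable_compose[OF id F(1)] by (subst integral_density) auto
  also have "\<dots> = (LINT y|distr ?\<sigma> borel (\<lambda>x. x). F y)"
    using id by (subst integral_distr) auto
  also have "\<dots> = (LINT z|?\<mu>. F (?T z))"
    unfolding eq by (subst integral_distr) auto
  also have "\<dots> = (LINT z|hyperplane_lborel e. (indicator V (?T z) * ?w z) *\<^sub>R F (?T z))"
    by (subst integral_density) auto
  also have "\<dots> = (LINT z|hyperplane_lborel e. ?w z *\<^sub>R F (?T z))"
    using F(2) by (intro Bochner_Integration.integral_cong) (auto simp: indicator_def)
  finally show ?thesis .
qed


subsection \<open>A continuously differentiable step\<close>

text \<open>The cubic with the values 0 and 1 and vanishing derivatives at 0 and 1, so that the
  three pieces join continuously differentiably.\<close>

definition step :: "real \<Rightarrow> real" where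
  "step t = (if t \<le> 0 then 0 else if t \<ge> 1 then 1 else 3 * t\<^sup>2 - 2 * t ^ 3)"

text \<open>The parabola is negative exactly outside the unit interval, so the maximum cuts it off
  there and continuity is evident from the form.\<close>

definition step_deriv :: "real \<Rightarrow> real" where
  "step_deriv t = max 0 (6 * t * (1 - t))"

lemma step_deriv_eq: "step_deriv t = (if 0 \<le> t \<and> t \<le> 1 then 6 * t * (1 - t) else 0)"
proof -
  have "t * (1 - t) \<le> 0" if "\<not> (0 \<le> t \<and> t \<le> 1)"
    using that by (auto simp: not_le mult_le_0_iff)
  then show ?thesis by (auto simp: step_deriv_def max_def)
qed

lemma DERIV_step: "(step has_real_derivative step_deriv t) (at t)"
proof -
  \<comment> \<open>Serves the junctions 0 and 1: an increment bounded by a quadratic has derivative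
    0 without matching one-sided limits. The factor 3 covers the cubic piece for small
    \<open>h\<close>, and for \<open>\<bar>h\<bar> \<ge> 1\<close> it exceeds the total variation
    1.\<close>
  have *: "(step has_real_derivative 0) (at x)" if "\<And>h. \<bar>step (x + h) - step x\<bar> \<le> 3 * h\<^sup>2" for x
    unfolding DERIV_def
  proof (rule Lim_null_comparison)
    have "norm ((step (x + h) - step x) / h) \<le> 3 * \<bar>h\<bar>" for h
    proof (cases "h = 0")
      case False
      then have "norm ((step (x + h) - step x) / h) \<le> 3 * h\<^sup>2 / \<bar>h\<bar>"
        using that[of h] by (simp add: divide_right_mono)
      also have "\<dots> = 3 * \<bar>h\<bar>" using False by (simp add: power2_eq_square divide_simps abs_if)
      finally show ?thesis .
    qed simp
    then show "\<forall>\<^sub>F h in at 0. norm ((step (x + h) - step x) / h) \<le> 3 * \<bar>h\<bar>" by simp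
    show "((\<lambda>h. 3 * \<bar>h\<bar>) \<longlongrightarrow> 0) (at (0::real))" by (auto intro!: tendsto_eq_intros)
  qed
  have sq: "1 \<le> 3 * h\<^sup>2" if "\<bar>h\<bar> \<ge> 1" for h :: real
    using power_mono[of 1 "\<bar>h\<bar>" 2] that by simp
  have cube: "0 \<le> 3 * h\<^sup>2 - 2 * h ^ 3 \<and> 3 * h\<^sup>2 - 2 * h ^ 3 \<le> 3 * h\<^sup>2" if "0 \<le> h" "h \<le> 1" for h :: real
  proof -
    have "0 \<le> h\<^sup>2 * (3 - 2 * h)" using that by simp
    then show ?thesis using that by (simp add: power2_eq_square power3_eq_cube algebra_simps)
  qed
  consider "t < 0" | "t = 0" | "0 < t" "t < 1" | "t = 1" | "t > 1" by linarith
  then show ?thesis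
  proof cases
    case 1
    have "((\<lambda>_. 0) has_real_derivative step_deriv t) (at t)" using 1 by (simp add: step_deriv_eq)
    then show ?thesis
      by (rule has_field_derivative_transform_within_open[where S = "{..<0}"]) (use 1 in \<open>auto simp: step_def\<close>)
  next
    case 2
    have "\<bar>step (0 + h) - step 0\<bar> \<le> 3 * h\<^sup>2" for h
      using cube[of h] sq[of h] by (auto simp: step_def)
    from *[OF this] show ?thesis using 2 by (simp add: step_deriv_def)
  next
    case 3
    have "((\<lambda>t. 3 * t\<^sup>2 - 2 * t ^ 3) has_real_derivative step_deriv t) (at t)"
      using 3 by (auto intro!: derivative_eq_intros simp: step_deriv_eq power2_eq_square algebra_simps)
    then show ?thesis
      by (rule has_field_derivative_transform_within_open[where S = "{0<..<1}"]) (use 3 in \<open>auto simp: step_def\<close>)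
  next
    case 4
    have "\<bar>step (1 + h) - step 1\<bar> \<le> 3 * h\<^sup>2" for h
    proof (cases "-1 < h \<and> h < 0")
      case True
      \<comment> \<open>Point symmetry of the step about its midpoint reduces the junction 1 to the
        junction 0.\<close>
      then have "step (1 + h) - step 1 = - (3 * (- h)\<^sup>2 - 2 * (- h) ^ 3)"
        by (simp add: step_def power2_eq_square power3_eq_cube algebra_simps)
      then show ?thesis using cube[of "- h"] True by simp
    qed (use sq[of h] in \<open>auto simp: step_def\<close>)
    from *[OF this] show ?thesis using 4 by (simp add: step_deriv_def)
  next
    case 5
    have "((\<lambda>_. 1) has_real_derivative step_deriv t) (at t)" using 5 by (simp add: step_deriv_eq)
    then show ?thesis
      by (rule has_field_derivative_transform_within_open[where S = "{1<..}"]) (use 5 in \<open>auto simp: step_def\<close>)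
  qed
qed

lemma step_bounds: "0 \<le> step t" "step t \<le> 1"
proof -
  have "0 \<le> t\<^sup>2 * (3 - 2 * t) \<and> 1 - t\<^sup>2 * (3 - 2 * t) = (1 - t)\<^sup>2 * (1 + 2 * t)" if "0 < t" "t < 1"
    using that by (auto simp: power2_eq_square algebra_simps)
  moreover have "0 \<le> (1 - t)\<^sup>2 * (1 + 2 * t)" if "0 < t" using that by simp
  ultimately show "0 \<le> step t" "step t \<le> 1"
    by (auto simp: step_def power2_eq_square power3_eq_cube algebra_simps)
qed

lemma continuous_step_deriv: "continuous_on A step_deriv"
  unfolding step_deriv_def by (intro continuous_intros)

lemma step_deriv_nonneg: "0 \<le> step_deriv t"
  by (simp add: step_deriv_def)

lemma step_deriv_zero: "t \<notin> {0..1} \<Longrightarrow> step_deriv t = 0"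
  by (auto simp: step_deriv_eq)

lemma integral_step_deriv:
  "integrable lborel step_deriv" "(LINT t|lborel. step_deriv t) = 1"
proof -
  have eq: "step_deriv = (\<lambda>t. step_deriv t * indicator {0..1} t)"
    using step_deriv_zero by (auto simp: fun_eq_iff indicator_def)
  have c: "isCont step_deriv t" for t
    using continuous_step_deriv[of UNIV] by (simp add: continuous_on_eq_continuous_at)
  show "integrable lborel step_deriv"
    by (subst eq) (rule borel_integrable_atLeastAtMost, rule c)
  have "(LINT t|lborel. step_deriv t * indicator {0..1} t) = step 1 - step 0"
    by (rule integral_FTC_Icc_real) (use c DERIV_step in \<open>auto intro: has_field_derivative_at_within\<close>)
  then show "(LINT t|lborel. step_deriv t) = 1"
    by (subst eq) (simp add: step_def)
qed

lemma Ck1_step: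
  assumes "Ck 1 q"
  shows "Ck 1 (\<lambda>x. step (q x))"
    and "frechet_derivative (\<lambda>x. step (q x)) (at x) v = step_deriv (q x) * (grad q x \<bullet> v)"
proof -
  have d: "((\<lambda>x. step (q x)) has_derivative (\<lambda>v. (step_deriv (q x) *\<^sub>R grad q x) \<bullet> v)) (at x)" for x
    by (rule has_derivative_eq_rhs, rule DERIV_compose_FDERIV[OF DERIV_step Ck1_grad(1)[OF assms]]) auto
  have "continuous_on UNIV q" using assms Ck_Suc_imp_Ck[of 0 q] by simp
  then show "Ck 1 (\<lambda>x. step (q x))"
    by (intro Ck1_I[OF d] continuous_intros Ck1_grad(2)[OF assms] continuous_on_compose2[OF continuous_step_deriv]) auto
  show "frechet_derivative (\<lambda>x. step (q x)) (at x) v = step_deriv (q x) * (grad q x \<bullet> v)"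
    using has_derivative_grad_unique[OF d] by simp
qed

subsection \<open>The divergence theorem in a chart\<close>

text \<open>Along each line parallel to \<open>e\<close> the weight has integral 1 and lives at
  depth between \<open>\<delta> k\<close> and \<open>2 * \<delta> k\<close> below the graph. It is
  an approximate identity at the graph point of that line.\<close>

lemma boundary_layer_tendsto:
  fixes F :: "'a::euclidean_space \<Rightarrow> 'b::euclidean_space"
  assumes c: "C2_graph \<Omega> V e g" and F: "continuous_on UNIV F" "compact K" "\<And>y. y \<notin> K \<Longrightarrow> F y = 0"
    and \<delta>: "\<And>k. \<delta> k > 0" "\<delta> \<longlonglongrightarrow> 0"
  shows "(\<lambda>k. LINT y|lebesgue. (step_deriv ((g y - y \<bullet> e) / \<delta> k - 1) / \<delta> k) *\<^sub>R F y)
    \<longlonglongrightarrow> (LINT z|hyperplane_lborel e. F (z + g z *\<^sub>R e))"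
proof -
  note g = C2_graphD[OF c]
  obtain M where M: "M \<ge> 0" "\<And>y. norm (F y) \<le> M" using bounded_continuous_support[OF F] by metis
  obtain R where R: "\<And>y. y \<in> K \<Longrightarrow> norm y \<le> R" using compact_imp_bounded[OF F(2)] by (auto simp: bounded_iff)
  have gm[measurable]: "g \<in> borel_measurable borel" and Fm[measurable]: "F \<in> borel_measurable borel"
    and sm[measurable]: "step_deriv \<in> borel_measurable borel"
    using g(6) F(1) continuous_step_deriv by (auto intro: borel_measurable_continuous_onI)
  define J where "J d z = (LINT s|lborel. step_deriv s *\<^sub>R F (z + (g z - d - d * s) *\<^sub>R e))" for d z
  have layer: "(LINT y|lebesgue. (step_deriv ((g y - y \<bullet> e) / d - 1) / d) *\<^sub>R F y) = (LINT z|hyperplane_lborel e. J d z)"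
    if d: "d > 0" for d
  proof -
    let ?L = "\<lambda>y. (step_deriv ((g y - y \<bullet> e) / d - 1) / d) *\<^sub>R F y"
    have cont: "continuous_on UNIV ?L"
      using d by (intro continuous_intros F(1) g(6) continuous_on_compose2[OF continuous_step_deriv[of UNIV]]) auto
    have "integrable lborel (\<lambda>y. indicator K y *\<^sub>R ?L y)"
      by (intro borel_integrable_compact F(2) continuous_on_subset[OF cont]) simp
    moreover have "(\<lambda>y. indicator K y *\<^sub>R ?L y) = ?L" using F(3) by (auto simp: indicator_def fun_eq_iff)
    ultimately have int: "integrable lborel ?L" by simp
    have "(LINT y|lebesgue. ?L y) = (LINT y|lborel. ?L y)"
      by (rule integral_completion) measurable
    also have "\<dots> = (LINT z|hyperplane_lborel e. LINT t|lborel. ?L (z + t *\<^sub>R e))"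
      by (rule lborel_integral_hyperplane[OF g(2) int])
    also have "\<dots> = (LINT z|hyperplane_lborel e. J d z)"
    proof (rule integral_cong_AE)
      show "AE z in hyperplane_lborel e. (LINT t|lborel. ?L (z + t *\<^sub>R e)) = J d z"
        using AE_hyperplane_lborel[OF g(2)]
      proof eventually_elim
        fix z assume z: "z \<bullet> e = 0"
        have "(LINT t|lborel. ?L (z + t *\<^sub>R e)) = (LINT t|lborel. (step_deriv ((g z - t) / d - 1) / d) *\<^sub>R F (z + t *\<^sub>R e))"
          by (simp add: g(4,7) inner_add_left z)
        \<comment> \<open>Substitution \<open>t = g z - d - d * s\<close>: the argument of the step
          becomes \<open>s\<close>, and the Jacobian \<open>d\<close> cancels the factor
          \<open>1 / d\<close>.\<close>
        also have "\<dots> = \<bar>- d\<bar> *\<^sub>R (LINT s|lborel. (step_deriv ((g z - (g z - d + - d * s)) / d - 1) / d) *\<^sub>R F (z + (g z - d + - d * s) *\<^sub>R e))"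
          using d by (intro lborel_integral_real_affine) simp
        also have "\<dots> = (LINT s|lborel. \<bar>- d\<bar> *\<^sub>R ((step_deriv ((g z - (g z - d + - d * s)) / d - 1) / d) *\<^sub>R F (z + (g z - d + - d * s) *\<^sub>R e)))"
          by (rule integral_scaleR_right[symmetric])
        also have "\<dots> = J d z"
          unfolding J_def
        proof (rule Bochner_Integration.integral_cong[OF refl])
          fix s :: real
          have "(g z - (g z - d + - d * s)) / d - 1 = s" using d by (simp add: field_simps)
          then show "\<bar>- d\<bar> *\<^sub>R ((step_deriv ((g z - (g z - d + - d * s)) / d - 1) / d) *\<^sub>R F (z + (g z - d + - d * s) *\<^sub>R e))
              = step_deriv s *\<^sub>R F (z + (g z - d - d * s) *\<^sub>R e)"
            using d by simp
        qed
        finally show "(LINT t|lborel. ?L (z + t *\<^sub>R e)) = J d z" .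
      qed
    qed (unfold J_def, measurable)
    finally show ?thesis .
  qed
  \<comment> \<open>Since \<open>z\<close> is orthogonal to \<open>e\<close>, moving along
    \<open>e\<close> only increases the norm; for large \<open>z\<close> the whole line misses
    \<open>K\<close>. This gives a majorant that does not depend on \<open>d\<close>.\<close>
  have bound: "norm (J d z) \<le> M * indicator (cball 0 R) z" if z: "z \<bullet> e = 0" for d z
  proof (cases "norm z \<le> R")
    case True
    have le: "norm (step_deriv s *\<^sub>R F (z + (g z - d - d * s) *\<^sub>R e)) \<le> step_deriv s * M" for s
      using M(2) by (simp add: step_deriv_nonneg mult_left_mono)
    have iM: "integrable lborel (\<lambda>s. step_deriv s * M)" using integral_step_deriv(1) by simp
    have "integrable lborel (\<lambda>s. step_deriv s *\<^sub>R F (z + (g z - d - d * s) *\<^sub>R e))"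
      by (rule Bochner_Integration.integrable_bound[OF iM]) (measurable, use le in \<open>auto intro: order_trans[OF _ abs_ge_self]\<close>)
    from order_trans[OF integral_norm_bound Bochner_Integration.integral_mono[OF integrable_norm[OF this] iM le]]
    have "norm (J d z) \<le> (LINT s|lborel. step_deriv s * M)" unfolding J_def .
    then show ?thesis using True integral_step_deriv by simp
  next
    case False
    have "F (z + t *\<^sub>R e) = 0" for t
    proof (rule F(3), rule notI)
      assume "z + t *\<^sub>R e \<in> K"
      then have "norm (z + t *\<^sub>R e) \<le> R" by (rule R)
      moreover have "norm z \<le> norm (z + t *\<^sub>R e)"
        using z by (simp add: norm_le inner_add_left inner_add_right inner_commute g(7))
      ultimately show False using False by simp
    qed
    then show ?thesis using False by (simp add: J_def)
  qed
  have lim: "(\<lambda>k. J (\<delta> k) z) \<longlonglongrightarrow> F (z + g z *\<^sub>R e)" for z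
  proof -
    have "(\<lambda>k. LINT s|lborel. step_deriv s *\<^sub>R F (z + (g z - \<delta> k - \<delta> k * s) *\<^sub>R e))
        \<longlonglongrightarrow> (LINT s|lborel. step_deriv s *\<^sub>R F (z + (g z - 0 - 0 * s) *\<^sub>R e))"
    proof (rule integral_dominated_convergence[where w = "\<lambda>s. step_deriv s * M"])
      show "AE s in lborel. (\<lambda>k. step_deriv s *\<^sub>R F (z + (g z - \<delta> k - \<delta> k * s) *\<^sub>R e))
          \<longlonglongrightarrow> step_deriv s *\<^sub>R F (z + (g z - 0 - 0 * s) *\<^sub>R e)"
        using F(1) by (intro AE_I2 tendsto_intros isCont_tendsto_compose[where g = F] \<delta>(2)) (simp add: continuous_on_eq_continuous_at)
      show "AE s in lborel. norm (step_deriv s *\<^sub>R F (z + (g z - \<delta> k - \<delta> k * s) *\<^sub>R e)) \<le> step_deriv s * M" for k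
        using M(2) by (intro AE_I2) (simp add: step_deriv_nonneg mult_left_mono)
    qed (use integral_step_deriv(1) in \<open>measurable, simp\<close>)
    then show ?thesis
      by (simp add: J_def integral_scaleR_left[OF integral_step_deriv(1)] integral_step_deriv(2))
  qed
  have "(\<lambda>k. LINT z|hyperplane_lborel e. J (\<delta> k) z) \<longlonglongrightarrow> (LINT z|hyperplane_lborel e. F (z + g z *\<^sub>R e))"
  proof (rule integral_dominated_convergence[where w = "\<lambda>z. M * indicator (cball 0 R) z"])
    show "integrable (hyperplane_lborel e) (\<lambda>z. M * indicator (cball 0 R) z :: real)"
      using finite_hyperplane_lborel_cball[OF g(2), of R]
      by (intro integrable_mult_right integrable_real_indicator) auto
    show "AE z in hyperplane_lborel e. norm (J (\<delta> k) z) \<le> M * indicator (cball 0 R) z" for k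
      using AE_hyperplane_lborel[OF g(2)] by eventually_elim (rule bound)
  qed (use lim in \<open>auto simp: J_def\<close>)
  then show ?thesis by (simp add: layer[OF \<delta>(1)])
qed

text \<open>The product rule for \<open>\<zeta> y * step (q k y)\<close> separates a part that fills
  up \<Omega> in the limit from a boundary layer, whose limit is an integral over the
  hyperplane.\<close>

lemma gauss_chart:
  fixes u w :: "'a::euclidean_space \<Rightarrow> 'b::euclidean_space" and \<nu> :: "'a \<Rightarrow> 'a"
  assumes S: "surface_measure \<Omega> S" and c: "C2_graph \<Omega> V e g"
    and \<nu>: "\<forall>y\<in>frontier \<Omega>. unit_outer_normal \<Omega> y (\<nu> y)"
    and U: "open U" and u: "continuous_on U u" and wd: "weak_deriv U b u w" and b: "b \<in> Basis"
    and \<zeta>: "Ck 1 \<zeta>" and K: "compact K" "K \<subseteq> V \<inter> U" "\<And>y. y \<notin> K \<Longrightarrow> \<zeta> y = 0"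
  shows "(LINT y:\<Omega>|lebesgue. frechet_derivative \<zeta> (at y) b *\<^sub>R u y + \<zeta> y *\<^sub>R w y)
    = (LINT y|S. (\<zeta> y * (\<nu> y \<bullet> b)) *\<^sub>R u y)"
proof -
  note g = C2_graphD[OF c]
  have KV: "K \<subseteq> V" and KU: "K \<subseteq> U" using K by auto
  have D\<zeta>0: "frechet_derivative \<zeta> (at y) = (\<lambda>v. 0)" if "y \<notin> K" for y
    by (rule frechet_derivative_eq_0_outside[OF compact_imp_closed[OF K(1)] K(3) that])
  have c\<zeta>: "continuous_on UNIV \<zeta>" using \<zeta> Ck_Suc_imp_Ck[of 0 \<zeta>] by simp
  \<comment> \<open>\<open>F\<close> carries the unnormalised normal. Its length is the area
    element, so on returning to \<open>S\<close> the normalisation of \<open>\<nu>\<close> cancels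
    the density of the surface measure.\<close>
  define F where "F y = (\<zeta> y * ((e - grad g y) \<bullet> b)) *\<^sub>R u y" for y
  have F0: "F y = 0" if "y \<notin> K" for y using K(3)[OF that] by (simp add: F_def)
  \<comment> \<open>\<open>u\<close> is continuous only on \<open>U\<close>; off \<open>K\<close>
    the factor \<open>\<zeta>\<close> makes \<open>F\<close> vanish, and these two open sets cover
    the space.\<close>
  have "continuous_on (U \<union> - K) F"
  proof (rule continuous_on_open_Un)
    show "continuous_on U F"
      unfolding F_def by (intro continuous_intros u continuous_on_subset[OF Ck1_grad(2)[OF g(3)]] continuous_on_subset[OF c\<zeta>]) auto
    show "continuous_on (- K) F" by (subst continuous_on_cong[of _ _ _ "\<lambda>_. 0"]) (use F0 in auto)
  qed (use U K in \<open>auto simp: compact_imp_closed open_Compl\<close>)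
  moreover have "U \<union> - K = UNIV" using KU by auto
  ultimately have cF: "continuous_on UNIV F" by simp
  note wi = weak_deriv_Ck1[OF wd U b \<zeta> K(1) KU K(3)]
  let ?f = "\<lambda>y. frechet_derivative \<zeta> (at y) b *\<^sub>R u y + \<zeta> y *\<^sub>R w y"
  have fi: "integrable lebesgue ?f" using wi(1,2) by (rule Bochner_Integration.integrable_add)
  define \<delta> where "\<delta> k = 1 / real (Suc k)" for k
  have \<delta>: "\<delta> k > 0" for k by (simp add: \<delta>_def)
  have \<delta>0: "\<delta> \<longlonglongrightarrow> 0" unfolding \<delta>_def using LIMSEQ_inverse_real_of_nat by (simp add: inverse_eq_divide)
  \<comment> \<open>With this argument the step is 0 down to depth \<open>\<delta> k\<close> below
    the graph and 1 from depth \<open>2 * \<delta> k\<close> on.\<close>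
  define q where "q k y = (g y - y \<bullet> e) / \<delta> k - 1" for k y
  have dq: "(q k has_derivative (\<lambda>v. ((1 / \<delta> k) *\<^sub>R (grad g y - e)) \<bullet> v)) (at y)" for k y
  proof -
    have "((\<lambda>y. inverse (\<delta> k) * (g y - y \<bullet> e) - 1) has_derivative (\<lambda>v. inverse (\<delta> k) * (grad g y \<bullet> v - v \<bullet> e) - 0)) (at y)"
      by (intro has_derivative_diff has_derivative_mult_right Ck1_grad(1)[OF g(3)] has_derivative_const
          has_derivative_inner_left has_derivative_ident)
    moreover have "q k = (\<lambda>y. inverse (\<delta> k) * (g y - y \<bullet> e) - 1)"
      by (simp add: q_def fun_eq_iff divide_inverse mult.commute)
    moreover have "(\<lambda>v. inverse (\<delta> k) * (grad g y \<bullet> v - v \<bullet> e) - 0) = (\<lambda>v. ((1 / \<delta> k) *\<^sub>R (grad g y - e)) \<bullet> v)"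
      by (simp add: fun_eq_iff inner_diff_left divide_inverse) (simp add: inner_commute)
    ultimately show ?thesis by simp
  qed
  have ckq: "Ck 1 (q k)" for k
    by (rule Ck1_I[OF dq]) (intro continuous_intros Ck1_grad(2)[OF g(3)])
  have gq: "grad (q k) y \<bullet> v = ((1 / \<delta> k) *\<^sub>R (grad g y - e)) \<bullet> v" for k y v
    using Ck1_grad(3)[OF ckq, of k y v] has_derivative_grad_unique[OF dq, of k y] by simp
  have sb: "(\<lambda>y. step (q k y)) \<in> borel_measurable borel" for k
    by (intro borel_measurable_continuous_onI Ck1_imp_continuous Ck1_step(1) ckq)
  have identity: "(LINT y|lebesgue. step (q k y) *\<^sub>R ?f y) = (LINT y|lebesgue. (step_deriv ((g y - y \<bullet> e) / \<delta> k - 1) / \<delta> k) *\<^sub>R F y)" for k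
  proof -
    let ?K = "K \<inter> {y. y \<bullet> e + \<delta> k \<le> g y}"
    let ?\<phi> = "\<lambda>y. \<zeta> y * step (q k y)"
    have "closed {y. y \<bullet> e + \<delta> k \<le> g y}" by (intro closed_Collect_le continuous_intros g(6))
    then have K': "compact ?K" "?K \<subseteq> U" using K(1) KU by (auto intro: compact_Int_closed)
    have s0: "step (q k y) = 0" if "\<not> y \<bullet> e + \<delta> k \<le> g y" for y
      using that \<delta>[of k] by (simp add: step_def q_def divide_le_eq)
    have \<phi>0: "?\<phi> y = 0" if "y \<notin> ?K" for y using that K(3) s0 by auto
    have ck: "Ck 1 ?\<phi>" by (intro Ck_mult \<zeta> Ck1_step(1) ckq)
    note wk = weak_deriv_Ck1[OF wd U b ck K' \<phi>0]
    \<comment> \<open>The cutoff grows into \<Omega>: its gradient is a nonnegative multiple of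
      \<open>grad g y - e\<close>, opposite to the outer normal. Hence the minus sign.\<close>
    have D: "frechet_derivative ?\<phi> (at y) b *\<^sub>R u y =
        step (q k y) *\<^sub>R (frechet_derivative \<zeta> (at y) b *\<^sub>R u y) - (step_deriv ((g y - y \<bullet> e) / \<delta> k - 1) / \<delta> k) *\<^sub>R F y" for y
    proof -
      have "(g y - y \<bullet> e) / \<delta> k - 1 = q k y" by (simp add: q_def)
      moreover have "frechet_derivative ?\<phi> (at y) b = \<zeta> y * (step_deriv (q k y) * (((1 / \<delta> k) *\<^sub>R (grad g y - e)) \<bullet> b))
          + frechet_derivative \<zeta> (at y) b * step (q k y)"
        by (simp only: frechet_derivative_mult_Ck1[OF \<zeta> Ck1_step(1)[OF ckq]] Ck1_step(2)[OF ckq] gq)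
      ultimately show ?thesis
        by (simp only: F_def) (simp add: inner_diff_left algebra_simps scaleR_left_diff_distrib diff_divide_distrib)
    qed
    have sm: "(\<lambda>y. step (q k y)) \<in> borel_measurable lebesgue"
      using sb[of k] by (intro measurable_completion) simp
    have i1: "integrable lebesgue (\<lambda>y. step (q k y) *\<^sub>R (frechet_derivative \<zeta> (at y) b *\<^sub>R u y))"
    proof (rule Bochner_Integration.integrable_bound[OF wi(1)])
      show "(\<lambda>y. step (q k y) *\<^sub>R (frechet_derivative \<zeta> (at y) b *\<^sub>R u y)) \<in> borel_measurable lebesgue"
        by (rule borel_measurable_scaleR[OF sm borel_measurable_integrable[OF wi(1)]])
      have "norm (step t *\<^sub>R x) \<le> norm x" for t and x :: 'b
        using step_bounds[of t] by (simp add: mult_left_le_one_le)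
      then show "AE y in lebesgue. norm (step (q k y) *\<^sub>R (frechet_derivative \<zeta> (at y) b *\<^sub>R u y))
          \<le> norm (frechet_derivative \<zeta> (at y) b *\<^sub>R u y)" by blast
    qed
    have i2: "integrable lebesgue (\<lambda>y. step (q k y) *\<^sub>R (\<zeta> y *\<^sub>R w y))"
      using wk(2) by (simp add: mult.commute)
    have i3: "integrable lebesgue (\<lambda>y. (step_deriv ((g y - y \<bullet> e) / \<delta> k - 1) / \<delta> k) *\<^sub>R F y)"
      using Bochner_Integration.integrable_diff[OF i1 wk(1)] unfolding D by simp
    have eq: "(LINT y|lebesgue. step (q k y) *\<^sub>R (frechet_derivative \<zeta> (at y) b *\<^sub>R u y)) - (LINT y|lebesgue. (step_deriv ((g y - y \<bullet> e) / \<delta> k - 1) / \<delta> k) *\<^sub>R F y)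
      = - (LINT y|lebesgue. step (q k y) *\<^sub>R (\<zeta> y *\<^sub>R w y))"
      using wk(3) i1 i3 unfolding D by (simp add: Bochner_Integration.integral_diff mult.commute)
    have "(LINT y|lebesgue. step (q k y) *\<^sub>R ?f y) =
        (LINT y|lebesgue. step (q k y) *\<^sub>R (frechet_derivative \<zeta> (at y) b *\<^sub>R u y))
        + (LINT y|lebesgue. step (q k y) *\<^sub>R (\<zeta> y *\<^sub>R w y))"
      unfolding scaleR_add_right using i1 i2 by (rule Bochner_Integration.integral_add)
    also have "\<dots> = (LINT y|lebesgue. (step_deriv ((g y - y \<bullet> e) / \<delta> k - 1) / \<delta> k) *\<^sub>R F y)"
      using eq[unfolded diff_eq_eq] by (simp only:) simp
    finally show ?thesis .
  qed
  have "(\<lambda>k. LINT y|lebesgue. step (q k y) *\<^sub>R ?f y) \<longlonglongrightarrow> (LINT y|lebesgue. indicator \<Omega> y *\<^sub>R ?f y)"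
  proof (rule integral_dominated_convergence[where w = "\<lambda>y. norm (?f y)"])
    have lim: "(\<lambda>k. step (q k y) *\<^sub>R ?f y) \<longlonglongrightarrow> indicator \<Omega> y *\<^sub>R ?f y" for y
    proof (cases "y \<in> K")
      case True
      then have yV: "y \<in> V" using KV by auto
      show ?thesis
      proof (cases "y \<in> \<Omega>")
        case True
        then have lt: "0 < g y - y \<bullet> e" using g(5)[OF yV] by simp
        then have "(\<lambda>k. 2 * \<delta> k) \<longlonglongrightarrow> 2 * 0 \<and> 2 * 0 < g y - y \<bullet> e" using \<delta>0 by (intro conjI tendsto_intros) auto
        then have "\<forall>\<^sub>F k in sequentially. 2 * \<delta> k < g y - y \<bullet> e" using order_tendstoD(2) by blast
        then have "\<forall>\<^sub>F k in sequentially. step (q k y) *\<^sub>R ?f y = indicator \<Omega> y *\<^sub>R ?f y"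
        proof eventually_elim
          fix k assume "2 * \<delta> k < g y - y \<bullet> e"
          then have "q k y \<ge> 1" using \<delta>[of k] by (simp add: q_def le_divide_eq)
          then have "step (q k y) = 1" by (simp add: step_def)
          then show "step (q k y) *\<^sub>R ?f y = indicator \<Omega> y *\<^sub>R ?f y" using True by simp
        qed
        then show ?thesis by (rule tendsto_eventually)
      next
        case False
        then have "step (q k y) = 0" for k
          using g(5)[OF yV] \<delta>[of k] by (simp add: step_def q_def divide_le_eq)
        then show ?thesis using False by simp
      qed
    next
      case False
      then show ?thesis using K(3) D\<zeta>0 by simp
    qed
    then show "AE y in lebesgue. (\<lambda>k. step (q k y) *\<^sub>R ?f y) \<longlonglongrightarrow> indicator \<Omega> y *\<^sub>R ?f y" by simp
    show sm: "(\<lambda>y. step (q k y) *\<^sub>R ?f y) \<in> borel_measurable lebesgue" for k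
      by (rule borel_measurable_scaleR[OF measurable_completion borel_measurable_integrable[OF fi]]) (use sb[of k] in simp)
    \<comment> \<open>Measurability of the limit is inherited from the approximants, because nothing
      is known about \<Omega> outside the chart.\<close>
    show "(\<lambda>y. indicator \<Omega> y *\<^sub>R ?f y) \<in> borel_measurable lebesgue"
      by (rule borel_measurable_LIMSEQ_metric[OF sm lim])
    show "integrable lebesgue (\<lambda>y. norm (?f y))" using fi by (rule integrable_norm)
    show "AE y in lebesgue. norm (step (q k y) *\<^sub>R ?f y) \<le> norm (?f y)" for k
      using step_bounds by (intro AE_I2) (simp add: mult_left_le_one_le)
  qed
  moreover have "(\<lambda>k. LINT y|lebesgue. step (q k y) *\<^sub>R ?f y) \<longlonglongrightarrow> (LINT z|hyperplane_lborel e. F (z + g z *\<^sub>R e))"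
    unfolding identity by (rule boundary_layer_tendsto[OF c cF K(1) F0 \<delta> \<delta>0])
  ultimately have eq: "(LINT y:\<Omega>|lebesgue. ?f y) = (LINT z|hyperplane_lborel e. F (z + g z *\<^sub>R e))"
    unfolding set_lebesgue_integral_def by (rule LIMSEQ_unique)
  let ?w = "\<lambda>z. sqrt (1 + (norm (grad g z))\<^sup>2)"
  have wpos: "?w z > 0" for z by (simp add: add_pos_nonneg)
  \<comment> \<open>\<open>\<nu>\<close> is given only on the frontier. \<open>F2\<close> agrees
    with the surface integrand there and is continuous on the whole space, as
    \<open>surface_integral_chart\<close> needs a Borel function.\<close>
  define F2 where "F2 y = inverse (?w y) *\<^sub>R F y" for y
  have "continuous_on UNIV F2"
    unfolding F2_def by (intro continuous_intros cF Ck1_grad(2)[OF g(3)]) (metis wpos less_irrefl)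
  then have F2m: "F2 \<in> borel_measurable borel" by (rule borel_measurable_continuous_onI)
  have "(LINT y|S. (\<zeta> y * (\<nu> y \<bullet> b)) *\<^sub>R u y) = (LINT y|S. F2 y)"
  proof (rule Bochner_Integration.integral_cong[OF refl])
    fix y assume "y \<in> space S"
    then have y: "y \<in> frontier \<Omega>" by (simp add: surface_measure_space[OF S])
    show "(\<zeta> y * (\<nu> y \<bullet> b)) *\<^sub>R u y = F2 y"
    proof (cases "y \<in> K")
      case True
      then have "\<nu> y = (e - grad g y) /\<^sub>R ?w y" using unit_outer_normal_eq[OF _ c _ y] \<nu> y KV by blast
      then show ?thesis by (simp add: F2_def F_def mult_ac)
    qed (use K(3) F0 in \<open>simp add: F2_def\<close>)
  qed
  also have "\<dots> = (LINT z|hyperplane_lborel e. ?w z *\<^sub>R F2 (z + g z *\<^sub>R e))"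
    using F0 KV by (intro surface_integral_chart[OF S c F2m]) (auto simp: F2_def)
  also have "\<dots> = (LINT z|hyperplane_lborel e. F (z + g z *\<^sub>R e))"
    unfolding F2_def C2_graph_grad(1)[OF c] using wpos by (simp add: less_imp_neq[THEN not_sym])
  finally show ?thesis using eq by simp
qed


subsection \<open>Finiteness of the surface measure\<close>

lemma surface_measure_chart_finite:
  assumes S: "surface_measure \<Omega> S" and c: "C2_graph \<Omega> V e g" and r: "cball p r \<subseteq> V"
  shows "emeasure S (frontier \<Omega> \<inter> ball p r) < \<infinity>"
proof -
  note g = C2_graphD[OF c]
  let ?A = "frontier \<Omega> \<inter> ball p r" and ?w = "\<lambda>z. sqrt (1 + (norm (grad g z))\<^sup>2)"
  define R where "R = norm p + r"
  have cw: "continuous_on UNIV ?w" by (intro continuous_intros Ck1_grad(2)[OF g(3)])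
  have "compact (?w ` cball 0 R)" by (intro compact_continuous_image continuous_on_subset[OF cw]) auto
  then obtain M where M: "\<And>z. norm z \<le> R \<Longrightarrow> ?w z \<le> M"
    using compact_imp_bounded by (force simp: bounded_iff)
  have A: "?A \<in> sets borel" by (intro sets.Int borel_closed borel_open) auto
  have "ball p r \<subseteq> V" using r ball_subset_cball by blast
  then have "emeasure S ?A = (\<integral>\<^sup>+ z. indicator ?A (z + g z *\<^sub>R e) * ennreal (?w z) \<partial>hyperplane_lborel e)"
    using S c A unfolding surface_measure_def by blast
  also have "\<dots> \<le> (\<integral>\<^sup>+ z. ennreal M * indicator (cball 0 R) z \<partial>hyperplane_lborel e)"
  proof (rule nn_integral_mono_AE, use AE_hyperplane_lborel[OF g(2)] in eventually_elim)
    fix z assume z: "z \<bullet> e = 0"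
    show "indicator ?A (z + g z *\<^sub>R e) * ennreal (?w z) \<le> ennreal M * indicator (cball 0 R) z"
    proof (cases "z + g z *\<^sub>R e \<in> ?A")
      case True
      then have "dist p (z + g z *\<^sub>R e) < r" by simp
      then have "norm (z + g z *\<^sub>R e) \<le> R"
        unfolding R_def dist_norm using norm_triangle_ineq2[of "z + g z *\<^sub>R e" p] by (simp add: norm_minus_commute)
      moreover have "norm z \<le> norm (z + g z *\<^sub>R e)"
        using z by (simp add: norm_le inner_add_left inner_add_right inner_commute g(7))
      ultimately have "norm z \<le> R" by simp
      then show ?thesis using M[of z] True by (simp add: ennreal_leI)
    qed simp
  qed
  also have "\<dots> = ennreal M * emeasure (hyperplane_lborel e) (cball 0 R)"
    by (rule nn_integral_cmult_indicator) simp
  also have "\<dots> < \<infinity>"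
    using finite_hyperplane_lborel_cball[OF g(2), of R] by (simp add: ennreal_mult_less_top)
  finally show ?thesis .
qed

lemma finite_surface_measure:
  assumes S: "surface_measure \<Omega> S" and "C2_boundary \<Omega>" "bounded \<Omega>"
  shows "finite_measure S"
proof
  have sS: "sets S = sets (restrict_space borel (frontier \<Omega>))" using S by (simp add: surface_measure_def)
  have "\<forall>p\<in>frontier \<Omega>. \<exists>r>0. emeasure S (frontier \<Omega> \<inter> ball p r) < \<infinity>"
  proof
    fix p assume "p \<in> frontier \<Omega>"
    then obtain V e g where V: "p \<in> V" and c: "C2_graph \<Omega> V e g"
      using assms(2) unfolding C2_boundary_def by blast
    obtain r where "r > 0" "cball p r \<subseteq> V" using C2_graphD(1)[OF c] V open_contains_cball by metis
    then show "\<exists>r>0. emeasure S (frontier \<Omega> \<inter> ball p r) < \<infinity>"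
      using surface_measure_chart_finite[OF S c] by blast
  qed
  then obtain r where r: "\<And>p. p \<in> frontier \<Omega> \<Longrightarrow> r p > 0 \<and> emeasure S (frontier \<Omega> \<inter> ball p (r p)) < \<infinity>"
    by metis
  have "compact (frontier \<Omega>)" using assms(3) by (rule compact_frontier_bounded)
  then obtain D where D: "D \<subseteq> frontier \<Omega>" "finite D" "frontier \<Omega> \<subseteq> (\<Union>p\<in>D. ball p (r p))"
    by (rule compactE_image[of _ "frontier \<Omega>" "\<lambda>p. ball p (r p)"]) (use r in auto)
  have "frontier \<Omega> = (\<Union>p\<in>D. frontier \<Omega> \<inter> ball p (r p))" using D(3) by auto
  then have "emeasure S (space S) = emeasure S (\<Union>p\<in>D. frontier \<Omega> \<inter> ball p (r p))"
    by (simp add: surface_measure_space[OF S])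
  also have "\<dots> \<le> (\<Sum>p\<in>D. emeasure S (frontier \<Omega> \<inter> ball p (r p)))"
    by (rule emeasure_subadditive_finite[OF D(2)]) (auto simp: sS sets_restrict_space)
  also have "\<dots> < \<infinity>" using r D(1,2) by (auto simp: less_top[symmetric])
  finally show "emeasure S (space S) \<noteq> \<infinity>" by simp
qed

lemma integrable_surface_measure:
  fixes F :: "'a::euclidean_space \<Rightarrow> 'b::euclidean_space"
  assumes S: "surface_measure \<Omega> S" and "C2_boundary \<Omega>" "bounded \<Omega>" and F: "continuous_on (frontier \<Omega>) F"
  shows "integrable S F"
proof -
  interpret finite_measure S by (rule finite_surface_measure[OF assms(1-3)])
  have sS: "sets S = sets (restrict_space borel (frontier \<Omega>))" using S by (simp add: surface_measure_def)
  have "compact (F ` frontier \<Omega>)"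
    using F compact_frontier_bounded[OF assms(3)] by (rule compact_continuous_image)
  then obtain M where M: "\<And>y. y \<in> frontier \<Omega> \<Longrightarrow> norm (F y) \<le> M"
    using compact_imp_bounded by (force simp: bounded_iff)
  show ?thesis
  proof (rule integrable_const_bound[where B = M])
    show "AE y in S. norm (F y) \<le> M" using M by (intro AE_I2) (simp add: surface_measure_space[OF S])
    show "F \<in> borel_measurable S"
      by (subst measurable_cong_sets[OF sS refl]) (rule borel_measurable_continuous_on_restrict[OF F])
  qed
qed


subsection \<open>The divergence theorem\<close>

text \<open>Equal to 1 up to distance \<open>r\<close> and to 0 from distance
  \<open>sqrt 2 * r\<close> on; the radius \<open>2 * r\<close> used below is a rounder
  bound.\<close>

definition cutoff :: "'a::euclidean_space \<Rightarrow> real \<Rightarrow> 'a \<Rightarrow> real" where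
  "cutoff p r y = step (2 - (y - p) \<bullet> (y - p) / r\<^sup>2)"

lemma Ck1_cutoff: "Ck 1 (cutoff p r)"
proof -
  have "((\<lambda>y. 2 - (y - p) \<bullet> (y - p) / r\<^sup>2) has_derivative (\<lambda>v. ((- 2 / r\<^sup>2) *\<^sub>R (y - p)) \<bullet> v)) (at y)" for y
    unfolding divide_inverse
    by (auto intro!: derivative_eq_intros simp: inner_commute)
  then have "Ck 1 (\<lambda>y. 2 - (y - p) \<bullet> (y - p) / r\<^sup>2)"
    by (rule Ck1_I) (intro continuous_intros)
  then show ?thesis unfolding cutoff_def[abs_def] by (rule Ck1_step)
qed

lemma cutoff_eq_1: "r > 0 \<Longrightarrow> y \<in> ball p r \<Longrightarrow> cutoff p r y = 1"
proof -
  assume r: "r > 0" "y \<in> ball p r"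
  then have "(norm (y - p))\<^sup>2 \<le> r\<^sup>2" by (intro power_mono) (auto simp: dist_norm norm_minus_commute)
  then have "(y - p) \<bullet> (y - p) / r\<^sup>2 \<le> 1" using r by (simp add: dot_square_norm divide_le_eq)
  then show ?thesis by (simp add: cutoff_def step_def)
qed

lemma cutoff_eq_0: "r > 0 \<Longrightarrow> y \<notin> cball p (2 * r) \<Longrightarrow> cutoff p r y = 0"
proof -
  assume r: "r > 0" "y \<notin> cball p (2 * r)"
  then have "(2 * r)\<^sup>2 \<le> (norm (y - p))\<^sup>2" by (intro power_mono) (auto simp: dist_norm norm_minus_commute)
  moreover have "(2 * r)\<^sup>2 = 4 * r\<^sup>2" by (simp add: power_mult_distrib)
  ultimately have "2 * r\<^sup>2 \<le> (norm (y - p))\<^sup>2" using zero_le_power2[of r] by linarith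
  then have "2 \<le> (y - p) \<bullet> (y - p) / r\<^sup>2" using r by (simp add: dot_square_norm le_divide_eq)
  then show ?thesis by (simp add: cutoff_def step_def)
qed

lemma set_integrable_scaleR_continuous:
  fixes h :: "'a::euclidean_space \<Rightarrow> real" and w :: "'a \<Rightarrow> 'b::euclidean_space"
  assumes h: "continuous_on UNIV h" and K: "compact K" "set_integrable lebesgue K w" and A: "A \<subseteq> K" "A \<in> sets lebesgue"
  shows "set_integrable lebesgue A (\<lambda>y. h y *\<^sub>R w y)"
proof -
  have "compact (h ` K)" using K(1) by (intro compact_continuous_image continuous_on_subset[OF h]) auto
  then obtain M where M: "\<And>y. y \<in> K \<Longrightarrow> \<bar>h y\<bar> \<le> M" using compact_imp_bounded by (force simp: bounded_iff)
  have "set_integrable lebesgue A w" by (rule set_integrable_subset[OF K(2) A(2,1)])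
  then have "integrable lebesgue (\<lambda>y. (indicator A y * h y) *\<^sub>R w y)"
  proof (intro integrable_scaleR_support(1)[where K = A and M = M] borel_measurable_times)
    show "h \<in> borel_measurable lebesgue"
      using borel_measurable_continuous_onI[OF h] by (intro measurable_completion) simp
  qed (use M A in \<open>auto simp: indicator_def\<close>)
  then show ?thesis by (simp add: set_integrable_def)
qed

locale C2_region =
  fixes \<Omega> U :: "'a::euclidean_space set" and S :: "'a measure" and \<nu> :: "'a \<Rightarrow> 'a"
  assumes open_\<Omega>: "open \<Omega>" and bounded_\<Omega>: "bounded \<Omega>" and C2: "C2_boundary \<Omega>"
    and open_U: "open U" and closure_\<Omega>: "closure \<Omega> \<subseteq> U"
    and \<nu>: "\<forall>y\<in>frontier \<Omega>. unit_outer_normal \<Omega> y (\<nu> y)"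
    and S: "surface_measure \<Omega> S"
begin

lemma compact_closure_\<Omega>: "compact (closure \<Omega>)"
  using bounded_\<Omega> by (simp add: compact_closure)

lemma set_integrable_Ck1:
  fixes u w :: "'a \<Rightarrow> 'b::euclidean_space"
  assumes wd: "weak_deriv U b u w" and b: "b \<in> Basis" and h: "Ck 1 h"
  shows "set_integrable lebesgue \<Omega> (\<lambda>y. frechet_derivative h (at y) b *\<^sub>R u y)"
    and "set_integrable lebesgue \<Omega> (\<lambda>y. h y *\<^sub>R w y)"
proof -
  have i: "set_integrable lebesgue (closure \<Omega>) u" "set_integrable lebesgue (closure \<Omega>) w"
    using wd compact_closure_\<Omega> closure_\<Omega> by (auto simp: weak_deriv_def locally_integrable_def)
  have "\<Omega> \<in> sets lebesgue" using open_\<Omega> by (simp add: borel_open)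
  note * = set_integrable_scaleR_continuous[OF _ compact_closure_\<Omega> _ closure_subset this]
  show "set_integrable lebesgue \<Omega> (\<lambda>y. frechet_derivative h (at y) b *\<^sub>R u y)"
    by (rule *[OF _ i(1)]) (use h b in auto)
  show "set_integrable lebesgue \<Omega> (\<lambda>y. h y *\<^sub>R w y)"
    by (rule *[OF Ck1_imp_continuous[OF h] i(2)])
qed

lemma integrable_surface_Ck1:
  fixes u :: "'a \<Rightarrow> 'b::euclidean_space"
  assumes u: "continuous_on U u" and h: "Ck 1 h"
  shows "integrable S (\<lambda>y. (h y * (\<nu> y \<bullet> b)) *\<^sub>R u y)"
proof (rule integrable_surface_measure[OF S C2 bounded_\<Omega>])
  have "frontier \<Omega> \<subseteq> U" using closure_\<Omega> by (auto simp: frontier_def)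
  then show "continuous_on (frontier \<Omega>) (\<lambda>y. (h y * (\<nu> y \<bullet> b)) *\<^sub>R u y)"
    by (intro continuous_intros continuous_on_normal[OF C2 \<nu>] continuous_on_subset[OF u]
        continuous_on_subset[OF Ck1_imp_continuous[OF h]]) auto
qed

text \<open>Both sides are additive in \<open>h\<close>. The identity holds for \<open>h\<close>
  times a small cutoff around each point of the closure, inside \<Omega> with no boundary term and
  at the frontier by \<open>gauss_chart\<close>; finitely many cutoffs are then combined by
  compactness.\<close>

theorem divergence_theorem:
  fixes u w :: "'a \<Rightarrow> 'b::euclidean_space"
  assumes u: "continuous_on U u" and wd: "weak_deriv U b u w" and b: "b \<in> Basis" and h: "Ck 1 h"
  shows "(LINT y:\<Omega>|lebesgue. frechet_derivative h (at y) b *\<^sub>R u y + h y *\<^sub>R w y)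
    = (LINT y|S. (h y * (\<nu> y \<bullet> b)) *\<^sub>R u y)"
proof -
  define P where "P h \<longleftrightarrow> (LINT y:\<Omega>|lebesgue. frechet_derivative h (at y) b *\<^sub>R u y + h y *\<^sub>R w y)
    = (LINT y|S. (h y * (\<nu> y \<bullet> b)) *\<^sub>R u y)" for h
  have P_add: "P (\<lambda>y. h1 y + h2 y)" if c: "Ck 1 h1" "Ck 1 h2" and p: "P h1" "P h2" for h1 h2
  proof -
    have "(LINT y:\<Omega>|lebesgue. frechet_derivative (\<lambda>y. h1 y + h2 y) (at y) b *\<^sub>R u y + (h1 y + h2 y) *\<^sub>R w y)
       = (LINT y:\<Omega>|lebesgue. (frechet_derivative h1 (at y) b *\<^sub>R u y + h1 y *\<^sub>R w y)
          + (frechet_derivative h2 (at y) b *\<^sub>R u y + h2 y *\<^sub>R w y))"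
      unfolding frechet_derivative_add_Ck1[OF c] by (simp add: algebra_simps)
    also have "\<dots> = (LINT y|S. (h1 y * (\<nu> y \<bullet> b)) *\<^sub>R u y) + (LINT y|S. (h2 y * (\<nu> y \<bullet> b)) *\<^sub>R u y)"
      using p set_integrable_Ck1[OF wd b c(1)] set_integrable_Ck1[OF wd b c(2)]
      by (subst set_integral_add) (auto simp: P_def intro!: set_integral_add)
    also have "\<dots> = (LINT y|S. ((h1 y + h2 y) * (\<nu> y \<bullet> b)) *\<^sub>R u y)"
      using integrable_surface_Ck1[OF u c(1), of b] integrable_surface_Ck1[OF u c(2), of b]
      by (simp add: algebra_simps flip: Bochner_Integration.integral_add)
    finally show ?thesis by (simp add: P_def)
  qed
  \<comment> \<open>The radius is chosen before \<open>h\<close>, because the same cutoff is applied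
    later to \<open>h\<close> times a product of other factors.\<close>
  have local_identity: "\<exists>r>0. \<forall>h. Ck 1 h \<longrightarrow> P (\<lambda>y. h y * cutoff p r y)" if p: "p \<in> closure \<Omega>" for p
  proof (cases "p \<in> \<Omega>")
    case True
    then obtain r where r: "r > 0" "cball p r \<subseteq> \<Omega>" using open_\<Omega> open_contains_cball by metis
    have "P (\<lambda>y. h y * cutoff p (r / 2) y)" if h: "Ck 1 h" for h
    proof -
      let ?\<phi> = "\<lambda>y. h y * cutoff p (r / 2) y"
      have ck: "Ck 1 ?\<phi>" by (intro Ck_mult h Ck1_cutoff)
      have z: "?\<phi> y = 0" if "y \<notin> cball p r" for y using cutoff_eq_0[of "r / 2" y p] r that by simp
      have z': "frechet_derivative ?\<phi> (at y) b = 0" if "y \<notin> cball p r" for y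
        using frechet_derivative_eq_0_outside[OF closed_cball z that] by simp
      have sub: "cball p r \<subseteq> U" using r(2) closure_\<Omega> closure_subset by blast
      note wk = weak_deriv_Ck1[OF wd open_U b ck compact_cball sub z]
      have "(LINT y:\<Omega>|lebesgue. frechet_derivative ?\<phi> (at y) b *\<^sub>R u y + ?\<phi> y *\<^sub>R w y)
          = (LINT y|lebesgue. frechet_derivative ?\<phi> (at y) b *\<^sub>R u y + ?\<phi> y *\<^sub>R w y)"
        unfolding set_lebesgue_integral_def
      proof (rule Bochner_Integration.integral_cong[OF refl])
        fix y
        show "indicator \<Omega> y *\<^sub>R (frechet_derivative ?\<phi> (at y) b *\<^sub>R u y + ?\<phi> y *\<^sub>R w y)
            = frechet_derivative ?\<phi> (at y) b *\<^sub>R u y + ?\<phi> y *\<^sub>R w y"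
          by (cases "y \<in> cball p r") (use r(2) in \<open>simp_all only: z z' indicator_simps subsetD scaleR_one scaleR_zero_left scaleR_zero_right add_0 not_False_eq_True\<close>)
      qed
      also have "\<dots> = 0" using wk by (simp add: Bochner_Integration.integral_add)
      also have "0 = (LINT y|S. (?\<phi> y * (\<nu> y \<bullet> b)) *\<^sub>R u y)"
      proof -
        have "?\<phi> y = 0" if "y \<in> space S" for y
        proof -
          have "y \<notin> \<Omega>" using that open_\<Omega> by (simp add: surface_measure_space[OF S] frontier_def interior_open)
          then show ?thesis using z r(2) by blast
        qed
        then have "(LINT y|S. (?\<phi> y * (\<nu> y \<bullet> b)) *\<^sub>R u y) = (LINT y|S. 0)"
          by (intro Bochner_Integration.integral_cong refl) simp
        then show ?thesis by simp
      qed
      finally show ?thesis by (simp add: P_def)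
    qed
    then show ?thesis using r(1) by (intro exI[of _ "r / 2"]) auto
  next
    case False
    then have "p \<in> frontier \<Omega>" using p open_\<Omega> by (simp add: frontier_def interior_open)
    then obtain V e g where V: "p \<in> V" and c: "C2_graph \<Omega> V e g"
      using C2 unfolding C2_boundary_def by blast
    have "open (V \<inter> U)" "p \<in> V \<inter> U" using C2_graphD(1)[OF c] open_U V p closure_\<Omega> by auto
    then obtain r where r: "r > 0" "cball p r \<subseteq> V \<inter> U" using open_contains_cball by metis
    have "P (\<lambda>y. h y * cutoff p (r / 2) y)" if h: "Ck 1 h" for h
      unfolding P_def
    proof (rule gauss_chart[OF S c \<nu> open_U u wd b _ compact_cball r(2)])
      show "Ck 1 (\<lambda>y. h y * cutoff p (r / 2) y)" by (intro Ck_mult h Ck1_cutoff)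
      show "h y * cutoff p (r / 2) y = 0" if "y \<notin> cball p r" for y
        using cutoff_eq_0[of "r / 2" y p] r that by simp
    qed
    then show ?thesis using r(1) by (intro exI[of _ "r / 2"]) auto
  qed
  then obtain r where r: "\<And>p. p \<in> closure \<Omega> \<Longrightarrow> r p > 0 \<and> (\<forall>h. Ck 1 h \<longrightarrow> P (\<lambda>y. h y * cutoff p (r p) y))"
    by metis
  obtain D where D: "D \<subseteq> closure \<Omega>" "finite D" "closure \<Omega> \<subseteq> (\<Union>p\<in>D. ball p (r p))"
    by (rule compactE_image[OF compact_closure_\<Omega>, of "closure \<Omega>" "\<lambda>p. ball p (r p)"]) (use r in auto)
  \<comment> \<open>The complement of \<open>\<Prod>p\<in>D. 1 - cutoff p (r p) y\<close> replaces a
    partition of unity. It is 1 wherever one cutoff is 1, and adding a point \<open>p\<close> adds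
    \<open>h * ?Q * cutoff p (r p)\<close>, which is an instance of the local identity.\<close>
  have "P (\<lambda>y. h y * (1 - (\<Prod>p\<in>D. 1 - cutoff p (r p) y)))"
    using D(2,1)
  proof (induction D rule: finite_induct)
    case empty
    have "frechet_derivative (\<lambda>y. 0 :: real) (at y) b = 0" for y :: 'a
      using frechet_derivative_at[OF has_derivative_const] by metis
    then show ?case by (simp add: P_def set_lebesgue_integral_def)
  next
    case (insert p D)
    let ?Q = "\<lambda>y. \<Prod>p\<in>D. 1 - cutoff p (r p) y"
    have cQ: "Ck 1 ?Q" using insert by (intro Ck_prod Ck_diff Ck_const Ck1_cutoff) auto
    have "P (\<lambda>y. h y * ?Q y * cutoff p (r p) y)"
      using r[of p] insert.prems Ck_mult[OF h cQ] by blast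
    moreover have "P (\<lambda>y. h y * (1 - ?Q y))" using insert by simp
    moreover have "Ck 1 (\<lambda>y. h y * (1 - ?Q y))" "Ck 1 (\<lambda>y. h y * ?Q y * cutoff p (r p) y)"
      by (intro Ck_mult Ck_diff Ck_const h cQ Ck1_cutoff)+
    ultimately have "P (\<lambda>y. h y * (1 - ?Q y) + (h y * ?Q y) * cutoff p (r p) y)"
      by (intro P_add)
    moreover have "(\<lambda>y. h y * (1 - ?Q y) + (h y * ?Q y) * cutoff p (r p) y) =
        (\<lambda>y. h y * (1 - (\<Prod>p\<in>insert p D. 1 - cutoff p (r p) y)))"
      using insert by (simp add: fun_eq_iff algebra_simps)
    ultimately show ?case by simp
  qed
  moreover
  let ?W = "\<Union>p\<in>D. ball p (r p)" and ?h = "\<lambda>y. h y * (1 - (\<Prod>p\<in>D. 1 - cutoff p (r p) y))"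
  have eq: "?h y = h y" if "y \<in> ?W" for y
  proof -
    from that obtain p where p: "p \<in> D" "y \<in> ball p (r p)" by blast
    then have "1 - cutoff p (r p) y = 0" using cutoff_eq_1[of "r p" y p] r[of p] D(1) by auto
    then have "(\<Prod>p\<in>D. 1 - cutoff p (r p) y) = 0" using p(1) D(2) by (auto intro!: prod_zero)
    then show ?thesis by simp
  qed
  have deq: "frechet_derivative ?h (at y) = frechet_derivative h (at y)" if "y \<in> ?W" for y
  proof -
    have "(h has_derivative frechet_derivative h (at y)) (at y)"
      using h Ck_Suc_has_derivative[of 0 h] by simp
    then have "(?h has_derivative frechet_derivative h (at y)) (at y)"
      by (rule has_derivative_transform_within_open[where s = ?W]) (use that eq in auto)
    from frechet_derivative_at[OF this] show ?thesis by simp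
  qed
  have "(LINT y:\<Omega>|lebesgue. frechet_derivative ?h (at y) b *\<^sub>R u y + ?h y *\<^sub>R w y)
      = (LINT y:\<Omega>|lebesgue. frechet_derivative h (at y) b *\<^sub>R u y + h y *\<^sub>R w y)"
  proof (rule set_lebesgue_integral_cong)
    show "\<Omega> \<in> sets lebesgue" using open_\<Omega> by (simp add: borel_open)
    show "\<forall>y. y \<in> \<Omega> \<longrightarrow> frechet_derivative ?h (at y) b *\<^sub>R u y + ?h y *\<^sub>R w y
       = frechet_derivative h (at y) b *\<^sub>R u y + h y *\<^sub>R w y"
    proof (intro allI impI)
      fix y assume "y \<in> \<Omega>"
      then have "y \<in> ?W" using D(3) closure_subset by blast
      then show "frechet_derivative ?h (at y) b *\<^sub>R u y + ?h y *\<^sub>R w y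
       = frechet_derivative h (at y) b *\<^sub>R u y + h y *\<^sub>R w y"
        by (simp only: deq eq)
    qed
  qed
  moreover have "(LINT y|S. (?h y * (\<nu> y \<bullet> b)) *\<^sub>R u y) = (LINT y|S. (h y * (\<nu> y \<bullet> b)) *\<^sub>R u y)"
  proof (rule Bochner_Integration.integral_cong[OF refl])
    fix y assume "y \<in> space S"
    then have "y \<in> closure \<Omega>" by (simp add: surface_measure_space[OF S] frontier_def)
    then have "y \<in> ?W" using D(3) by blast
    then show "(?h y * (\<nu> y \<bullet> b)) *\<^sub>R u y = (h y * (\<nu> y \<bullet> b)) *\<^sub>R u y" by (simp only: eq)
  qed
  ultimately show ?thesis by (simp only: P_def)
qed

end


subsection \<open>Integration of radial functions\<close>

text \<open>Both measures give \<open>{..r}\<close> the volume of the ball of radius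
  \<open>r\<close>: the density is the derivative of that volume. Half-lines form an
  intersection-stable generator, so the measures agree.\<close>

lemma distr_norm_lborel:
  "distr lborel borel (norm :: 'a::euclidean_space \<Rightarrow> real) =
   density lborel (\<lambda>r. ennreal (DIM('a) * unit_ball_vol DIM('a) * r ^ (DIM('a) - 1)) * indicator {0..} r)"
  (is "?L = ?R")
proof (rule measure_eqI_generator_eq[where E = "range atMost" and \<Omega> = UNIV and A = "\<lambda>i. {..real i}"])
  show "sets ?L = sigma_sets UNIV (range atMost)" "sets ?R = sigma_sets UNIV (range atMost)"
    by (simp_all add: borel_eq_atMost[where 'a = real] sets_measure_of)
  show "Int_stable (range (atMost :: real \<Rightarrow> _))"
    by (auto simp: Int_stable_def image_iff intro!: exI[of _ "min _ _"])
  show "(\<Union>i. {..real i}) = UNIV" using real_arch_simple by auto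
  have L: "emeasure ?L {..r} = ennreal (unit_ball_vol DIM('a) * r ^ DIM('a))" if "r \<ge> 0" for r
  proof -
    have "emeasure ?L {..r} = emeasure lborel (cball (0::'a) r)"
      by (subst emeasure_distr) (auto intro!: arg_cong[where f = "emeasure lborel"])
    then show ?thesis using emeasure_cball[OF that, of "0::'a"] by simp
  qed
  fix X :: "real set" assume "X \<in> range atMost"
  then obtain r where X: "X = {..r}" by auto
  show "emeasure ?L X = emeasure ?R X"
  proof (cases "r \<ge> 0")
    case True
    have "emeasure ?R X = (\<integral>\<^sup>+t. ennreal (DIM('a) * unit_ball_vol DIM('a) * t ^ (DIM('a) - 1)) * indicator {0..r} t \<partial>lborel)"
      unfolding X by (subst emeasure_density) (auto intro!: nn_integral_cong simp: indicator_def)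
    also have "\<dots> = ennreal (unit_ball_vol DIM('a) * r ^ DIM('a) - unit_ball_vol DIM('a) * 0 ^ DIM('a))"
      by (rule nn_integral_FTC_Icc) (use True in \<open>auto intro!: derivative_eq_intros\<close>)
    finally show ?thesis using L[OF True] by (simp add: X zero_power)
  next
    case False
    have "(\<lambda>t. ennreal (DIM('a) * unit_ball_vol DIM('a) * t ^ (DIM('a) - 1)) * indicator {0..} t * indicator {..r} t) = (\<lambda>t. 0)"
      using False by (auto simp: indicator_def)
    then have "emeasure ?R X = (\<integral>\<^sup>+t. 0 \<partial>(lborel :: real measure))"
      unfolding X by (subst emeasure_density) simp_all
    moreover have "norm -` {..r} \<inter> space lborel = ({} :: 'a set)"
    proof -
      have "\<not> norm x \<le> r" for x :: 'a using False norm_ge_zero[of x] by linarith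
      then show ?thesis by auto
    qed
    then have "emeasure ?L X = emeasure lborel ({} :: 'a set)"
      unfolding X by (subst emeasure_distr) simp_all
    ultimately show ?thesis by simp
  qed
next
  fix i :: nat
  have "emeasure (distr lborel borel (norm :: 'a \<Rightarrow> real)) {..real i} = emeasure lborel (cball (0::'a) (real i))"
    by (subst emeasure_distr) (auto intro!: arg_cong[where f = "emeasure lborel"])
  then show "emeasure (distr lborel borel (norm :: 'a \<Rightarrow> real)) {..real i} \<noteq> \<infinity>"
    using emeasure_cball[of "real i" "0::'a"] by simp
qed auto

lemma lborel_integral_norm:
  fixes g :: "real \<Rightarrow> real"
  assumes g: "g \<in> borel_measurable borel"
  defines "\<omega> \<equiv> DIM('a::euclidean_space) * unit_ball_vol DIM('a)"
  shows "integrable lborel (\<lambda>x::'a. g (norm x)) \<longleftrightarrow> set_integrable lborel {0..} (\<lambda>r. \<omega> * r ^ (DIM('a) - 1) * g r)"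
    and "(LINT x|lborel. g (norm (x::'a))) = (LINT r:{0..}|lborel. \<omega> * r ^ (DIM('a) - 1) * g r)"
proof -
  let ?d = "\<lambda>r. indicator {0..} r * (\<omega> * r ^ (DIM('a) - 1))"
  have d: "(\<lambda>r. ennreal (DIM('a) * unit_ball_vol DIM('a) * r ^ (DIM('a) - 1)) * indicator {0..} r) = (\<lambda>r. ennreal (?d r))"
    by (auto simp: \<omega>_def indicator_def)
  have nn: "AE r in lborel. 0 \<le> ?d r" by (auto simp: indicator_def \<omega>_def)
  have "integrable lborel (\<lambda>x::'a. g (norm x)) \<longleftrightarrow> integrable (distr lborel borel (norm :: 'a \<Rightarrow> real)) g"
    using g by (subst integrable_distr_eq) auto
  also have "\<dots> \<longleftrightarrow> integrable lborel (\<lambda>r. ?d r *\<^sub>R g r)"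
    unfolding distr_norm_lborel d using g nn by (subst integrable_density) auto
  finally show "integrable lborel (\<lambda>x::'a. g (norm x)) \<longleftrightarrow> set_integrable lborel {0..} (\<lambda>r. \<omega> * r ^ (DIM('a) - 1) * g r)"
    by (simp add: set_integrable_def mult.assoc)
  have "(LINT x|lborel. g (norm (x::'a))) = integral\<^sup>L (distr lborel borel (norm :: 'a \<Rightarrow> real)) g"
    using g by (subst integral_distr) auto
  also have "\<dots> = (LINT r|lborel. ?d r *\<^sub>R g r)"
    unfolding distr_norm_lborel d using g nn by (subst integral_density) auto
  finally show "(LINT x|lborel. g (norm (x::'a))) = (LINT r:{0..}|lborel. \<omega> * r ^ (DIM('a) - 1) * g r)"
    by (simp only: set_lebesgue_integral_def mult.assoc real_scaleR_def)
qed

section \<open>Coordinates of the doubled space, the Laplacian of radial functions and the constant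
  of the fundamental solution\<close>

lemma Basis_pt: "(Basis :: 'n::finite pt set) = (\<lambda>(A, j). axis A (axis j 1)) ` UNIV"
  by (auto simp: Basis_vec_def image_iff)

lemma inner_pt_axis: "(x::'n::finite pt) \<bullet> axis A (axis j 1) = x $ A $ j"
  by (simp add: inner_axis)

lemma axis_axis_in_Basis: "axis A (axis j 1) \<in> (Basis :: 'n::finite pt set)"
  by (auto simp: Basis_pt)

lemma sum_squares_pt: "(\<Sum>A\<in>UNIV. \<Sum>j\<in>UNIV. (x $ A $ j)\<^sup>2) = (x::'n::finite pt) \<bullet> x"
  by (simp add: inner_vec_def power2_eq_square)

text \<open>The Hessian of \<open>Q (x \<bullet> x)\<close> is \<open>2 * Q1\<close> times the
  identity plus \<open>4 * Q2\<close> times the products of coordinates, and its trace is taken in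
  dimension \<open>2 * CARD('n)\<close>. A profile in the squared norm also covers the
  origin.\<close>

lemma Delta_radial:
  fixes Q Q1 Q2 :: "real \<Rightarrow> real" and x :: "'n::finite pt"
  assumes Q: "\<And>s. (Q has_real_derivative Q1 s) (at s)" "\<And>s. (Q1 has_real_derivative Q2 s) (at s)"
  shows "Delta (\<lambda>x. Q (x \<bullet> x)) x = - (4 * real CARD('n) * Q1 (x \<bullet> x) + 4 * (x \<bullet> x) * Q2 (x \<bullet> x))"
proof -
  have 1: "partial A j (\<lambda>x. Q (x \<bullet> x)) = (\<lambda>x. 2 * x $ A $ j * Q1 (x \<bullet> x))" for A and j :: 'n
  proof
    fix x :: "'n pt"
    have "((\<lambda>x. Q (x \<bullet> x)) has_derivative (\<lambda>v. Q1 (x \<bullet> x) * (2 * (x \<bullet> v)))) (at x)"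
      by (rule has_derivative_eq_rhs, rule DERIV_compose_FDERIV[OF Q(1)])
        (auto intro!: derivative_eq_intros simp: inner_commute)
    from frechet_derivative_at[OF this, symmetric]
    show "partial A j (\<lambda>x. Q (x \<bullet> x)) x = 2 * x $ A $ j * Q1 (x \<bullet> x)"
      by (simp add: partial_def inner_pt_axis)
  qed
  have 2: "partial A j (\<lambda>x. 2 * x $ A $ j * Q1 (x \<bullet> x)) x = 2 * Q1 (x \<bullet> x) + 4 * Q2 (x \<bullet> x) * (x $ A $ j)\<^sup>2" for A and j :: 'n
  proof -
    have *: "(\<lambda>x. 2 * x $ A $ j * Q1 (x \<bullet> x)) = (\<lambda>x. 2 * (x \<bullet> axis A (axis j 1)) * Q1 (x \<bullet> x))"
      by (simp add: inner_pt_axis)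
    have "((\<lambda>x. 2 * x $ A $ j * Q1 (x \<bullet> x)) has_derivative
       (\<lambda>v. 2 * (x \<bullet> axis A (axis j 1)) * (Q2 (x \<bullet> x) * (2 * (x \<bullet> v))) + 2 * (v \<bullet> axis A (axis j 1)) * Q1 (x \<bullet> x))) (at x)"
      unfolding *
      by (rule has_derivative_eq_rhs, rule has_derivative_mult[OF _ DERIV_compose_FDERIV[OF Q(2)]])
        (auto intro!: derivative_eq_intros simp: inner_commute)
    from frechet_derivative_at[OF this, symmetric]
    show ?thesis
      by (simp add: partial_def inner_pt_axis power2_eq_square)
  qed
  have "Delta (\<lambda>x. Q (x \<bullet> x)) x =
      - (\<Sum>A\<in>(UNIV::2 set). \<Sum>j\<in>(UNIV::'n set). 2 * Q1 (x \<bullet> x) + 4 * Q2 (x \<bullet> x) * (x $ A $ j)\<^sup>2)"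
    unfolding Delta_def 1 2 ..
  also have "\<dots> = - (4 * real CARD('n) * Q1 (x \<bullet> x) + 4 * Q2 (x \<bullet> x) * (\<Sum>A\<in>UNIV. \<Sum>j\<in>UNIV. (x $ A $ j)\<^sup>2))"
    by (simp add: sum.distrib sum_distrib_left)
  finally show ?thesis unfolding sum_squares_pt by (simp add: algebra_simps)
qed

text \<open>Testing the fundamental solution with the bump function \<open>exp_bump 1 (1 - |x|\<^sup>2)\<close> determines \<open>C\<close>:
  in polar coordinates the integrand is an exact derivative.\<close>

lemma fundamental_solution_constant:
  assumes n: "CARD('n::finite) \<ge> 3" and fs: "fundamental_solution_Delta2 (G0 C :: 'n pt \<Rightarrow> real)"
  shows "8 * (real CARD('n) - 1) * (real CARD('n) - 2) * C * (DIM('n pt) * unit_ball_vol DIM('n pt)) = 1"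
proof -
  define P :: "nat \<Rightarrow> real poly" where "P k = ((\<lambda>p. [:0, 0, 1:] * (p - pderiv p)) ^^ k) 1" for k
  \<comment> \<open>The \<open>k\<close>-th derivative of the profile
    \<open>exp_bump 1 (1 - s)\<close>: \<open>P k\<close> iterates the polynomial of the derivative,
    and the sign comes from the inner function \<open>1 - s\<close>.\<close>
  define Q where "Q k s = (-1) ^ k * exp_bump (P k) (1 - s)" for k s
  have dQ: "(Q k has_real_derivative Q (Suc k) s) (at s)" for k s
    unfolding Q_def
    by (auto intro!: derivative_eq_intros exp_bump_deriv[THEN DERIV_chain2] simp: P_def)
  have Q0: "Q k s = 0" if "s \<ge> 1" for k s using that by (simp add: Q_def exp_bump_eq_0)
  define n where "n = real CARD('n)"
  \<comment> \<open>\<open>V 0\<close> is the profile of \<open>Delta \<phi>\<close> and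
    \<open>V k\<close> its \<open>k\<close>-th derivative; the term with the factor \<open>k\<close>
    comes from the Leibniz rule for the product with \<open>s\<close>.\<close>
  define V where "V k s = - (4 * n * Q (Suc k) s + 4 * k * Q (Suc k) s + 4 * s * Q (Suc (Suc k)) s)" for k s
  have dV: "(V k has_real_derivative V (Suc k) s) (at s)" for k s
    unfolding V_def
    by (auto intro!: derivative_eq_intros dQ simp: algebra_simps)
  define Z where "Z s = - (4 * n * V 1 s + 4 * s * V 2 s)" for s
  define \<phi> :: "'n pt \<Rightarrow> real" where "\<phi> x = exp_bump 1 (1 - x \<bullet> x)" for x
  have \<phi>: "\<phi> = (\<lambda>x. Q 0 (x \<bullet> x))" by (simp add: \<phi>_def Q_def P_def fun_eq_iff)
  have D1: "Delta \<phi> = (\<lambda>x. V 0 (x \<bullet> x))"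
    unfolding \<phi> using Delta_radial[OF dQ dQ, of 0] by (auto simp: V_def n_def fun_eq_iff numeral_2_eq_2)
  have D2: "Delta (Delta \<phi>) = (\<lambda>x. Z (x \<bullet> x))"
    unfolding D1 using Delta_radial[OF dV dV, of 0] by (auto simp: Z_def n_def fun_eq_iff numeral_2_eq_2)
  have supp: "{x. \<phi> x \<noteq> 0} \<subseteq> cball 0 1"
  proof
    fix x assume "x \<in> {x. \<phi> x \<noteq> 0}"
    then have "\<not> 1 - x \<bullet> x \<le> 0" using exp_bump_eq_0 by (auto simp: \<phi>_def)
    then have "norm x < 1" by (simp add: norm_lt_square)
    then show "x \<in> cball 0 1" by simp
  qed
  have "test_function UNIV \<phi>"
    unfolding test_function_def
  proof (intro conjI allI)
    show "Ck k \<phi>" for k unfolding \<phi>_def by (rule Ck_exp_bump)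
    show "compact (closure {x. \<phi> x \<noteq> 0})"
      using supp bounded_subset[OF bounded_cball] by (simp only: compact_closure) blast
  qed simp
  with fs have "(LINT y|lebesgue. G0 C y * Delta (Delta \<phi>) y) = \<phi> 0"
    by (simp add: fundamental_solution_Delta2_def)
  moreover define g where "g r = C * r powr (4 - 2 * n) * Z (r\<^sup>2)" for r
  have cont: "continuous_on UNIV (Q k)" for k
    using dQ by (auto simp: continuous_on_eq_continuous_at intro: DERIV_isCont)
  have cZ: "continuous_on UNIV Z"
    unfolding Z_def V_def by (intro continuous_intros cont)
  have "G0 C y * Delta (Delta \<phi>) y = g (norm y)" for y
    by (simp add: G0_def D2 g_def n_def power2_norm_eq_inner)
  moreover have [measurable]: "Z \<in> borel_measurable borel"
    using cZ by (rule borel_measurable_continuous_onI)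
  have gm: "g \<in> borel_measurable borel" unfolding g_def by measurable
  ultimately have 1: "(LINT y|lborel. g (norm (y :: 'n pt))) = \<phi> 0"
    by (subst (asm) integral_completion) auto
  define \<omega> where "\<omega> = DIM('n pt) * unit_ball_vol DIM('n pt)"
  have dim: "DIM('n pt) = 2 * CARD('n)" by simp
  \<comment> \<open>In polar coordinates the powers of \<open>r\<close> combine to
    \<open>r ^ 3\<close>, and \<open>r ^ 3 dr = s ds / 2\<close> for \<open>s = r\<^sup>2\<close>.
    Repeated integration by parts of \<open>s * Z s\<close> gives this antiderivative. At
    \<open>r = 1\<close> everything vanishes; at \<open>r = 0\<close> only the term with
    \<open>Q 0\<close> remains.\<close>
  define F where "F r = \<omega> * C / 2 * (- (4 * (r\<^sup>2)\<^sup>2 * V 1 (r\<^sup>2) + (4 * n - 8) * r\<^sup>2 * V 0 (r\<^sup>2))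
      - (4 * n - 8) * (4 * r\<^sup>2 * Q 1 (r\<^sup>2) + (4 * n - 4) * Q 0 (r\<^sup>2)))" for r
  have F: "(F has_real_derivative \<omega> * C * (r ^ 3 * Z (r\<^sup>2))) (at r)" for r
  proof -
    define s where "s = r\<^sup>2"
    have "((\<lambda>s. \<omega> * C / 2 * (- (4 * s\<^sup>2 * V 1 s + (4 * n - 8) * s * V 0 s)
      - (4 * n - 8) * (4 * s * Q 1 s + (4 * n - 4) * Q 0 s))) has_real_derivative \<omega> * C / 2 * (s * Z s)) (at s)"
      by (auto intro!: derivative_eq_intros dQ dV simp: Z_def numeral_2_eq_2)
        (simp add: V_def algebra_simps power2_eq_square)
    then have "(F has_real_derivative \<omega> * C / 2 * (s * Z s) * (2 * r)) (at r)"
      unfolding F_def s_def by (rule DERIV_chain2) (auto intro!: derivative_eq_intros)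
    then show ?thesis by (simp add: s_def power2_eq_square power3_eq_cube mult_ac)
  qed
  have "(LINT y|lborel. g (norm (y :: 'n pt))) = (LINT r:{0..}|lborel. \<omega> * r ^ (DIM('n pt) - 1) * g r)"
    unfolding \<omega>_def by (rule lborel_integral_norm[OF gm])
  also have "\<dots> = (LINT r|lborel. \<omega> * C * (r ^ 3 * Z (r\<^sup>2)) * indicator {0..1} r)"
    unfolding set_lebesgue_integral_def
  proof (intro Bochner_Integration.integral_cong refl)
    fix r :: real
    show "indicator {0..} r *\<^sub>R (\<omega> * r ^ (DIM('n pt) - 1) * g r) = \<omega> * C * (r ^ 3 * Z (r\<^sup>2)) * indicator {0..1} r"
    proof (cases "r > 0 \<and> r \<le> 1")
      case True
      have "r ^ (DIM('n pt) - 1) = r powr (2 * n - 1)"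
        using True n by (subst powr_realpow[symmetric]) (auto simp: dim n_def of_nat_diff)
      then have "r ^ (DIM('n pt) - 1) * r powr (4 - 2 * n) = r ^ 3"
        using True by (simp flip: powr_add powr_numeral)
      moreover have "\<omega> * r ^ (DIM('n pt) - 1) * g r =
          \<omega> * C * ((r ^ (DIM('n pt) - 1) * r powr (4 - 2 * n)) * Z (r\<^sup>2))"
        by (simp only: g_def mult_ac)
      ultimately have "\<omega> * r ^ (DIM('n pt) - 1) * g r = \<omega> * C * (r ^ 3 * Z (r\<^sup>2))"
        by (simp only:)
      then show ?thesis using True by simp
    next
      case False
      have "Z (r\<^sup>2) = 0" if "r > 1"
      proof -
        have "r\<^sup>2 \<ge> 1" using that by simp
        then show ?thesis by (simp add: Z_def V_def Q0)
      qed
      moreover have "0 ^ (DIM('n pt) - 1) = (0::real)" using n by (simp add: dim)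
      ultimately show ?thesis using False by (auto simp: g_def indicator_def not_less not_le)
    qed
  qed
  also have "\<dots> = F 1 - F 0"
  proof (rule integral_FTC_Icc_real)
    have "continuous_on UNIV (\<lambda>r. Z (r\<^sup>2))"
      by (rule continuous_on_compose2[OF cZ]) (auto intro!: continuous_intros)
    then have "isCont (\<lambda>r. Z (r\<^sup>2)) r" for r by (simp add: continuous_on_eq_continuous_at)
    then show "isCont (\<lambda>r. \<omega> * C * (r ^ 3 * Z (r\<^sup>2))) r" for r by (intro continuous_intros)
  qed (use F in auto)
  also have "F 1 = 0" unfolding F_def by (simp add: V_def Q0)
  also have "0 - F 0 = 8 * (n - 1) * (n - 2) * C * \<omega> * \<phi> 0"
    unfolding F_def by (simp add: \<phi> algebra_simps)
  finally have "8 * (n - 1) * (n - 2) * C * \<omega> * \<phi> 0 = 1 * \<phi> 0" using 1 by simp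
  moreover have "\<phi> 0 \<noteq> 0" using exp_bump_pos[of 1] by (simp add: \<phi>_def)
  ultimately show ?thesis unfolding n_def \<omega>_def by simp
qed


subsection \<open>The regularised Newtonian kernel\<close>

text \<open>For \<open>n\<close> half the dimension this is, up to a constant, a derivative of the
  Newtonian potential \<open>|z|^(2 - 2n)\<close> at \<open>z = x - y\<close>. At
  \<open>y = x\<close> the numerator is 0, and so is the value.\<close>

definition newton :: "nat \<Rightarrow> 'a::euclidean_space \<Rightarrow> 'a \<Rightarrow> 'a \<Rightarrow> real" where
  "newton n x a y = ((x - y) \<bullet> a) / ((x - y) \<bullet> (x - y)) ^ n"

definition newton_deriv :: "nat \<Rightarrow> 'a::euclidean_space \<Rightarrow> 'a \<Rightarrow> 'a \<Rightarrow> 'a \<Rightarrow> real" where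
  "newton_deriv n x a y v = 2 * n * ((x - y) \<bullet> a) * ((x - y) \<bullet> v) / ((x - y) \<bullet> (x - y)) ^ Suc n
     - (a \<bullet> v) / ((x - y) \<bullet> (x - y)) ^ n"

lemma has_derivative_newton:
  assumes "y \<noteq> x"
  shows "(newton n x a has_derivative newton_deriv n x a y) (at y)"
proof -
  define s where "s = (x - y) \<bullet> (x - y)"
  have s: "s \<noteq> 0" using assms by (simp add: s_def)
  have "((\<lambda>s. inverse (s ^ n)) has_real_derivative - n * inverse (s ^ Suc n)) (at s)"
  proof (cases n)
    case (Suc k)
    have "((\<lambda>s. inverse (s ^ Suc k)) has_real_derivative - (inverse (s ^ Suc k) * (Suc k * s ^ k) * inverse (s ^ Suc k))) (at s)"
      using s by (auto intro!: derivative_eq_intros simp del: power_Suc)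
    moreover have "- (inverse (s ^ Suc k) * (Suc k * s ^ k) * inverse (s ^ Suc k)) = - n * inverse (s ^ Suc n)"
      using s by (simp add: Suc field_simps)
    ultimately show ?thesis by (simp only: Suc)
  qed (use s in \<open>auto intro!: derivative_eq_intros\<close>)
  note inv = this
  have "((\<lambda>y. (x - y) \<bullet> (x - y)) has_derivative (\<lambda>v. - 2 * ((x - y) \<bullet> v))) (at y)"
    by (auto intro!: derivative_eq_intros simp: inner_commute)
  from DERIV_compose_FDERIV[OF inv[unfolded s_def] this]
  have "((\<lambda>y. inverse (((x - y) \<bullet> (x - y)) ^ n)) has_derivative
      (\<lambda>v. (- 2 * ((x - y) \<bullet> v)) * (- n * inverse (s ^ Suc n)))) (at y)"
    unfolding s_def .
  then have "((\<lambda>y. ((x - y) \<bullet> a) * inverse (((x - y) \<bullet> (x - y)) ^ n)) has_derivative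
      (\<lambda>v. ((x - y) \<bullet> a) * ((- 2 * ((x - y) \<bullet> v)) * (- n * inverse (s ^ Suc n))) + (- (v \<bullet> a)) * inverse (s ^ n))) (at y)"
    unfolding s_def by (intro has_derivative_mult) (auto intro!: derivative_eq_intros)
  then show ?thesis
    by (simp add: newton_def[abs_def] newton_deriv_def[abs_def] s_def divide_inverse inner_commute algebra_simps)
qed

text \<open>0 on the ball of radius \<open>\<epsilon>\<close> and 1 once the squared distance
  reaches \<open>\<epsilon>\<^sup>2 + \<delta>\<close>; \<open>\<delta>\<close> is thus a width in
  the squared radius.\<close>

definition outer_cutoff :: "real \<Rightarrow> real \<Rightarrow> 'a::euclidean_space \<Rightarrow> 'a \<Rightarrow> real" where
  "outer_cutoff \<epsilon> \<delta> x y = step (((x - y) \<bullet> (x - y) - \<epsilon>\<^sup>2) / \<delta>)"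

text \<open>The radial factor of the gradient of the cutoff, which in the variable \<open>y\<close>
  is \<open>- shell_density \<epsilon> \<delta> x y\<close> times \<open>x - y\<close>.\<close>

definition shell_density :: "real \<Rightarrow> real \<Rightarrow> 'a::euclidean_space \<Rightarrow> 'a \<Rightarrow> real" where
  "shell_density \<epsilon> \<delta> x y = 2 / \<delta> * step_deriv (((x - y) \<bullet> (x - y) - \<epsilon>\<^sup>2) / \<delta>)"

lemma cutoff_inside:
  assumes "0 < \<epsilon>" "0 < \<delta>" "(x - y) \<bullet> (x - y) \<le> \<epsilon>\<^sup>2"
  shows "outer_cutoff \<epsilon> \<delta> x y = 0" "shell_density \<epsilon> \<delta> x y = 0"
proof -
  have "((x - y) \<bullet> (x - y) - \<epsilon>\<^sup>2) / \<delta> \<le> 0" using assms by (simp add: divide_le_0_iff)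
  then show "outer_cutoff \<epsilon> \<delta> x y = 0" "shell_density \<epsilon> \<delta> x y = 0"
    by (auto simp: outer_cutoff_def shell_density_def step_def step_deriv_eq)
qed

lemma cutoff_outside:
  assumes "0 < \<epsilon>" "0 < \<delta>" "(x - y) \<bullet> (x - y) \<ge> \<epsilon>\<^sup>2 + \<delta>"
  shows "outer_cutoff \<epsilon> \<delta> x y = 1" "shell_density \<epsilon> \<delta> x y = 0"
proof -
  have "((x - y) \<bullet> (x - y) - \<epsilon>\<^sup>2) / \<delta> \<ge> 1" using assms by (simp add: le_divide_eq)
  then show "outer_cutoff \<epsilon> \<delta> x y = 1" "shell_density \<epsilon> \<delta> x y = 0"
    by (auto simp: outer_cutoff_def shell_density_def step_def step_deriv_eq)
qed

lemma shell_density_nonneg: "0 < \<delta> \<Longrightarrow> 0 \<le> shell_density \<epsilon> \<delta> x y"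
  by (simp add: shell_density_def step_deriv_nonneg)

lemma has_derivative_outer_cutoff:
  "(outer_cutoff \<epsilon> \<delta> x has_derivative (\<lambda>v. - shell_density \<epsilon> \<delta> x y * ((x - y) \<bullet> v))) (at y)"
proof -
  have "((\<lambda>y. ((x - y) \<bullet> (x - y) - \<epsilon>\<^sup>2) / \<delta>) has_derivative (\<lambda>v. - 2 * ((x - y) \<bullet> v) / \<delta>)) (at y)"
    by (auto intro!: derivative_eq_intros simp: inner_commute divide_inverse)
  from DERIV_compose_FDERIV[OF DERIV_step this]
  show ?thesis
    unfolding outer_cutoff_def[abs_def] shell_density_def by (simp add: mult_ac)
qed

definition cut_newton :: "real \<Rightarrow> real \<Rightarrow> nat \<Rightarrow> 'a::euclidean_space \<Rightarrow> 'a \<Rightarrow> 'a \<Rightarrow> real" where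
  "cut_newton \<epsilon> \<delta> n x a y = outer_cutoff \<epsilon> \<delta> x y * newton n x a y"

definition cut_newton_deriv :: "real \<Rightarrow> real \<Rightarrow> nat \<Rightarrow> 'a::euclidean_space \<Rightarrow> 'a \<Rightarrow> 'a \<Rightarrow> 'a \<Rightarrow> real" where
  "cut_newton_deriv \<epsilon> \<delta> n x a y v = outer_cutoff \<epsilon> \<delta> x y * newton_deriv n x a y v
     - shell_density \<epsilon> \<delta> x y * ((x - y) \<bullet> v) * newton n x a y"

lemma in_ball_imp_inner_less: "0 < \<epsilon> \<Longrightarrow> y \<in> ball x \<epsilon> \<Longrightarrow> (x - y) \<bullet> (x - y) < \<epsilon>\<^sup>2"
  by (simp add: dist_norm dot_square_norm power_strict_mono)

lemma has_derivative_cut_newton: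
  assumes e: "0 < \<epsilon>" "0 < \<delta>"
  shows "(cut_newton \<epsilon> \<delta> n x a has_derivative cut_newton_deriv \<epsilon> \<delta> n x a y) (at y)"
proof (cases "y = x")
  case False
  show ?thesis
    unfolding cut_newton_def[abs_def]
    by (rule has_derivative_eq_rhs[OF has_derivative_mult[OF has_derivative_outer_cutoff has_derivative_newton[OF False]]])
      (simp add: cut_newton_deriv_def fun_eq_iff)
next
  case True
  have z: "cut_newton_deriv \<epsilon> \<delta> n x a y = (\<lambda>v. 0)"
    using cutoff_inside[OF e, of x y] True by (simp add: cut_newton_deriv_def fun_eq_iff)
  show ?thesis
    unfolding z
  proof (rule has_derivative_transform_within_open[where f = "\<lambda>y. 0" and s = "ball x \<epsilon>"])
    show "0 = cut_newton \<epsilon> \<delta> n x a y" if "y \<in> ball x \<epsilon>" for y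
      using cutoff_inside(1)[OF e, of x y] in_ball_imp_inner_less[OF e(1) that] by (simp add: cut_newton_def)
  qed (use True e in auto)
qed

lemma frechet_derivative_cut_newton:
  assumes "0 < \<epsilon>" "0 < \<delta>"
  shows "frechet_derivative (cut_newton \<epsilon> \<delta> n x a) (at y) = cut_newton_deriv \<epsilon> \<delta> n x a y"
  by (rule frechet_derivative_at[OF has_derivative_cut_newton[OF assms], symmetric])

lemma continuous_outer_cutoff: "0 < \<delta> \<Longrightarrow> continuous_on A (outer_cutoff \<epsilon> \<delta> x)"
  using has_derivative_outer_cutoff
  by (meson continuous_at_imp_continuous_on has_derivative_continuous)

lemma continuous_shell_density: "0 < \<delta> \<Longrightarrow> continuous_on A (shell_density \<epsilon> \<delta> x)"
  unfolding shell_density_def[abs_def]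
  by (intro continuous_intros continuous_on_compose2[OF continuous_step_deriv[of UNIV]]) auto

lemma Ck1_cut_newton:
  assumes e: "0 < \<epsilon>" "0 < \<delta>"
  shows "Ck 1 (cut_newton \<epsilon> \<delta> n x a)"
  unfolding One_nat_def
proof (rule Ck_SucI[OF has_derivative_cut_newton[OF e]])
  fix b
  have "continuous_on (- {x} \<union> ball x \<epsilon>) (\<lambda>y. cut_newton_deriv \<epsilon> \<delta> n x a y b)"
  proof (rule continuous_on_open_Un)
    show "continuous_on (- {x}) (\<lambda>y. cut_newton_deriv \<epsilon> \<delta> n x a y b)"
      unfolding cut_newton_deriv_def newton_deriv_def newton_def
      by (intro continuous_intros continuous_outer_cutoff continuous_shell_density e) auto
    have "cut_newton_deriv \<epsilon> \<delta> n x a y b = 0" if "y \<in> ball x \<epsilon>" for y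
      using cutoff_inside[OF e, of x y] in_ball_imp_inner_less[OF e(1) that] by (simp add: cut_newton_deriv_def)
    then show "continuous_on (ball x \<epsilon>) (\<lambda>y. cut_newton_deriv \<epsilon> \<delta> n x a y b)"
      by (subst continuous_on_cong[of _ _ _ "\<lambda>_. 0"]) auto
  qed auto
  moreover have "- {x} \<union> ball x \<epsilon> = UNIV" using e by auto
  ultimately show "Ck 0 (\<lambda>y. cut_newton_deriv \<epsilon> \<delta> n x a y b)" by simp
qed

text \<open>A radial factor times \<open>x - y\<close> has a symmetric Jacobian. This is the
  hypothesis under which products of two generators collapse.\<close>

lemma cut_newton_deriv_commute: "cut_newton_deriv \<epsilon> \<delta> n x a y b = cut_newton_deriv \<epsilon> \<delta> n x b y a"
  by (simp add: cut_newton_deriv_def newton_deriv_def newton_def inner_commute mult_ac)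

text \<open>With the exponent equal to half the dimension the Newton field is divergence free, so
  only the gradient of the cutoff contributes.\<close>

lemma cut_newton_deriv_trace:
  fixes x y :: "'n::finite pt"
  shows "(\<Sum>A\<in>UNIV. \<Sum>j\<in>UNIV. cut_newton_deriv \<epsilon> \<delta> CARD('n) x (axis A (axis j 1)) y (axis A (axis j 1)))
    = - shell_density \<epsilon> \<delta> x y * (((x - y) \<bullet> (x - y)) / ((x - y) \<bullet> (x - y)) ^ CARD('n))"
proof -
  define s where "s = (x - y) \<bullet> (x - y)"
  define n where "n = CARD('n)"
  let ?z = "\<lambda>A j. (x - y) $ A $ j"
  have lin: "(\<Sum>A\<in>(UNIV::2 set). \<Sum>j\<in>(UNIV::'n set). a * (b * q A j - c) - d * q A j) =
      a * (b * (\<Sum>A\<in>UNIV. \<Sum>j\<in>UNIV. q A j) - 2 * CARD('n) * c) - d * (\<Sum>A\<in>UNIV. \<Sum>j\<in>UNIV. q A j)"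
    for a b c d :: real and q
    by (simp add: sum_subtractf sum.distrib sum_distrib_left algebra_simps)
  have zz: "(\<Sum>A\<in>UNIV. \<Sum>j\<in>UNIV. (?z A j)\<^sup>2) = s" unfolding s_def by (rule sum_squares_pt)
  have "cut_newton_deriv \<epsilon> \<delta> n x (axis A (axis j 1)) y (axis A (axis j 1)) =
      outer_cutoff \<epsilon> \<delta> x y * (2 * n / s ^ Suc n * (?z A j)\<^sup>2 - 1 / s ^ n) - shell_density \<epsilon> \<delta> x y / s ^ n * (?z A j)\<^sup>2" for A and j :: 'n
    unfolding cut_newton_deriv_def newton_deriv_def newton_def inner_pt_axis s_def[symmetric]
    by (simp add: power2_eq_square mult.assoc)
  then have "(\<Sum>A\<in>UNIV. \<Sum>j\<in>UNIV. cut_newton_deriv \<epsilon> \<delta> n x (axis A (axis j 1)) y (axis A (axis j 1)))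
     = outer_cutoff \<epsilon> \<delta> x y * (2 * n / s ^ Suc n * (\<Sum>A\<in>UNIV. \<Sum>j\<in>UNIV. (?z A j)\<^sup>2) - 2 * n / s ^ n)
       - shell_density \<epsilon> \<delta> x y / s ^ n * (\<Sum>A\<in>UNIV. \<Sum>j\<in>UNIV. (?z A j)\<^sup>2)"
    using lin[of "outer_cutoff \<epsilon> \<delta> x y" "2 * n / s ^ Suc n" "\<lambda>A j. (?z A j)\<^sup>2" "1 / s ^ n" "shell_density \<epsilon> \<delta> x y / s ^ n"]
    by (simp only: n_def) simp
  \<comment> \<open>At \<open>s = 0\<close> both quotients are 0 by the convention for division by
    0.\<close>
  also have "2 * n / s ^ Suc n * (\<Sum>A\<in>UNIV. \<Sum>j\<in>UNIV. (?z A j)\<^sup>2) - 2 * n / s ^ n = 0"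
    unfolding zz by (cases "s = 0") (auto simp: n_def)
  finally show ?thesis unfolding zz by (simp add: n_def s_def)
qed

section \<open>The mass of the transition shell\<close>

lemma lborel_translate_norm:
  fixes g :: "real \<Rightarrow> real" and x :: "'a::euclidean_space"
  assumes [measurable]: "g \<in> borel_measurable borel"
  shows "integrable lborel (\<lambda>y. g (norm (x - y))) \<longleftrightarrow> integrable lborel (\<lambda>y::'a. g (norm y))"
    and "(LINT y|lborel. g (norm (x - y))) = (LINT y|lborel. g (norm (y::'a)))"
proof -
  have "integrable lborel (\<lambda>y::'a. g (norm y)) \<longleftrightarrow> integrable (distr lborel borel (\<lambda>y. x - y)) (\<lambda>y. g (norm y))"
    by (simp add: lborel_distr_minus)
  then show "integrable lborel (\<lambda>y. g (norm (x - y))) \<longleftrightarrow> integrable lborel (\<lambda>y::'a. g (norm y))"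
    by (subst (asm) integrable_distr_eq) auto
  have "(LINT y|lborel. g (norm (y::'a))) = (LINT y|distr lborel borel (\<lambda>y. x - y). g (norm y))"
    by (simp add: lborel_distr_minus)
  then show "(LINT y|lborel. g (norm (x - y))) = (LINT y|lborel. g (norm (y::'a)))"
    by (subst (asm) integral_distr) auto
qed

text \<open>The volume factor cancels all powers of the radius but one, and what is left is the
  derivative of \<open>step ((r\<^sup>2 - \<epsilon>\<^sup>2) / \<delta>)\<close>, which rises from
  0 to 1. Hence the mass is the area of the unit sphere for all \<open>\<epsilon>\<close> and
  \<open>\<delta>\<close>.\<close>

lemma shell_mass:
  fixes x :: "'a::euclidean_space"
  assumes e: "0 < \<epsilon>" "0 < \<delta>" and dim: "DIM('a) = 2 * n" "n \<ge> 1"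
  defines "m \<equiv> \<lambda>y. shell_density \<epsilon> \<delta> x y * (((x - y) \<bullet> (x - y)) / ((x - y) \<bullet> (x - y)) ^ n)"
  shows "integrable lebesgue m" "(LINT y|lebesgue. m y) = DIM('a) * unit_ball_vol DIM('a)"
proof -
  let ?\<omega> = "DIM('a) * unit_ball_vol DIM('a)"
  define g where "g r = 2 / \<delta> * step_deriv ((r\<^sup>2 - \<epsilon>\<^sup>2) / \<delta>) * (r\<^sup>2 / (r\<^sup>2) ^ n)" for r :: real
  have [measurable]: "step_deriv \<in> borel_measurable borel"
    using continuous_step_deriv by (rule borel_measurable_continuous_onI)
  have gm: "g \<in> borel_measurable borel" unfolding g_def by measurable
  have m: "m = (\<lambda>y. g (norm (x - y)))" by (simp add: m_def g_def shell_density_def dot_square_norm fun_eq_iff)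
  define R where "R = sqrt (\<epsilon>\<^sup>2 + \<delta>)"
  have R: "R\<^sup>2 = \<epsilon>\<^sup>2 + \<delta>" "R > 0" using e by (auto simp: R_def add_pos_pos)
  define F where "F r = ?\<omega> * step ((r\<^sup>2 - \<epsilon>\<^sup>2) / \<delta>)" for r :: real
  define f where "f r = ?\<omega> * (2 / \<delta> * step_deriv ((r\<^sup>2 - \<epsilon>\<^sup>2) / \<delta>) * r)" for r :: real
  have F: "(F has_real_derivative f r) (at r)" for r
    unfolding F_def f_def using e
    by (auto intro!: derivative_eq_intros DERIV_step[THEN DERIV_chain2])
  have cf: "continuous_on UNIV f"
    unfolding f_def using e by (intro continuous_intros continuous_on_compose2[OF continuous_step_deriv[of UNIV]]) auto
  then have icf: "isCont f r" for r by (simp add: continuous_on_eq_continuous_at)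
  have eq: "indicator {0..} r *\<^sub>R (?\<omega> * r ^ (DIM('a) - 1) * g r) = f r * indicator {0..R} r" for r
  proof (cases "0 < r \<and> r \<le> R")
    case True
    have "(r\<^sup>2) ^ n = r ^ (DIM('a) - 1) * r"
    proof -
      have "2 * n = Suc (DIM('a) - 1)" using dim by simp
      then show ?thesis by (simp only: power_mult[symmetric] power_Suc2)
    qed
    then have "r ^ (DIM('a) - 1) * (r\<^sup>2 / (r\<^sup>2) ^ n) = r" using True by (simp add: power2_eq_square)
    moreover have "r ^ (DIM('a) - 1) * g r =
        2 / \<delta> * step_deriv ((r\<^sup>2 - \<epsilon>\<^sup>2) / \<delta>) * (r ^ (DIM('a) - 1) * (r\<^sup>2 / (r\<^sup>2) ^ n))"
      by (simp only: g_def mult_ac)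
    ultimately have "r ^ (DIM('a) - 1) * g r = 2 / \<delta> * step_deriv ((r\<^sup>2 - \<epsilon>\<^sup>2) / \<delta>) * r"
      by (simp only:)
    then show ?thesis using True by (simp add: f_def mult.assoc)
  next
    case False
    then consider "r < 0" | "r = 0" | "r > R" by linarith
    then show ?thesis
    proof cases
      case 3
      then have "R\<^sup>2 \<le> r\<^sup>2" using R by (intro power_mono) auto
      then have "(r\<^sup>2 - \<epsilon>\<^sup>2) / \<delta> \<ge> 1" using e by (simp add: R le_divide_eq)
      then have "step_deriv ((r\<^sup>2 - \<epsilon>\<^sup>2) / \<delta>) = 0" by (auto simp: step_deriv_eq)
      then show ?thesis using 3 by (simp add: g_def)
    qed (auto simp: g_def f_def)
  qed
  have "integrable lborel (\<lambda>r. f r * indicator {0..R} r)"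
    by (rule borel_integrable_atLeastAtMost) (rule icf)
  then have "integrable lborel (\<lambda>y::'a. g (norm y))"
    unfolding lborel_integral_norm(1)[OF gm] set_integrable_def eq .
  then have int: "integrable lborel m" unfolding m lborel_translate_norm(1)[OF gm] .
  then show "integrable lebesgue m"
    by (subst integrable_completion) auto
  have "(LINT y|lebesgue. m y) = (LINT y|lborel. m y)"
    using int by (intro integral_completion) auto
  also have "\<dots> = (LINT r|lborel. f r * indicator {0..R} r)"
    unfolding m lborel_translate_norm(2)[OF gm] lborel_integral_norm(2)[OF gm] set_lebesgue_integral_def eq ..
  also have "\<dots> = F R - F 0"
    by (rule integral_FTC_Icc_real) (use R F icf in auto)
  also have "\<dots> = ?\<omega>"
    using e R by (simp add: F_def step_def divide_le_0_iff)
  finally show "(LINT y|lebesgue. m y) = ?\<omega>" .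
qed


subsection \<open>Evaluation of the kernel\<close>

lemma has_derivative_norm_powr:
  fixes x :: "'a::euclidean_space"
  assumes "x \<noteq> 0"
  shows "((\<lambda>z. norm z powr p) has_derivative (\<lambda>v. p * norm x powr (p - 2) * (x \<bullet> v))) (at x)"
proof -
  have "((\<lambda>z. norm z powr p) has_derivative (\<lambda>v. p * norm x powr (p - 1) * (v \<bullet> sgn x))) (at x)"
    using assms
    by (intro has_derivative_eq_rhs[OF DERIV_compose_FDERIV[OF has_real_derivative_powr has_derivative_norm]])
      (auto simp: inner_commute)
  moreover have "p * norm x powr (p - 1) * (v \<bullet> sgn x) = p * norm x powr (p - 2) * (x \<bullet> v)" for v
  proof -
    have "norm x powr (p - 1) = norm x powr (p - 2) * norm x"
      using assms powr_add[of "norm x" "p - 2" 1] by simp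
    then show ?thesis using assms by (simp add: sgn_div_norm inner_commute)
  qed
  ultimately show ?thesis by simp
qed

text \<open>At the origin the operators applied to \<open>G0\<close> return unspecified values. A
  formula off the origin is enough, since derivatives at \<open>x \<noteq> 0\<close> are
  local.\<close>

lemma frechet_derivative_sum_scaleR:
  fixes f :: "'i::finite \<Rightarrow> 'j::finite \<Rightarrow> 'a::euclidean_space \<Rightarrow> real" and v :: "'i \<Rightarrow> 'j \<Rightarrow> 'b::euclidean_space"
  assumes u: "\<And>z. z \<noteq> 0 \<Longrightarrow> u z = (\<Sum>i\<in>UNIV. \<Sum>j\<in>UNIV. f i j z *\<^sub>R v i j)"
    and f: "\<And>i j. (f i j has_derivative f' i j) (at x)" and x: "x \<noteq> 0"
  shows "frechet_derivative u (at x) c = (\<Sum>i\<in>UNIV. \<Sum>j\<in>UNIV. f' i j c *\<^sub>R v i j)"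
proof -
  have "((\<lambda>z. \<Sum>i\<in>UNIV. \<Sum>j\<in>UNIV. f i j z *\<^sub>R v i j) has_derivative
      (\<lambda>c. \<Sum>i\<in>UNIV. \<Sum>j\<in>UNIV. f' i j c *\<^sub>R v i j)) (at x)"
    by (intro has_derivative_sum has_derivative_scaleR_left f)
  then have "(u has_derivative (\<lambda>c. \<Sum>i\<in>UNIV. \<Sum>j\<in>UNIV. f' i j c *\<^sub>R v i j)) (at x)"
    by (rule has_derivative_transform_within_open[where s = "- {0}"]) (use u x in auto)
  from frechet_derivative_at[OF this, symmetric] show ?thesis by (simp only:)
qed

lemma sum_gamma: "gamma j (\<Sum>i\<in>I. u i) = (\<Sum>i\<in>I. gamma j (u i))"
  by (rule linear_sum[OF bounded_linear.linear[OF bounded_linear_gamma]])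

text \<open>For each \<open>B\<close> the two outer operators contribute products of generators with
  coefficients that are symmetric, being mixed derivatives of \<open>G0\<close>. They collapse to
  minus the sum of the second derivatives, so the outer pair acts as \<open>Delta\<close> and a
  single generator remains.\<close>

lemma kernel_formula:
  fixes x :: "'n::{finite,linorder} pt" and w :: "'m::{finite,linorder} ext ^ 2"
  assumes m: "CARD('m) = CARD('n) div 2" and x: "x \<noteq> 0"
  shows "H C x w = (\<Sum>A\<in>UNIV. \<Sum>j\<in>UNIV.
    (- 8 * (real CARD('n) - 1) * (real CARD('n) - 2) * C * (x $ A $ j / (x \<bullet> x) ^ CARD('n))) *\<^sub>R gamma j (w $ A))"
proof -
  define N where "N = 2 * real CARD('n)"
  define E :: "2 \<Rightarrow> 'n \<Rightarrow> 'n pt" where "E A j = axis A (axis j 1)" for A j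
  have inner_E: "z \<bullet> E A j = z $ A $ j" for z A j by (simp add: E_def inner_axis)
  have EE: "E A j \<bullet> E A k = (if j = k then 1 else 0)" for A j k by (auto simp: E_def inner_axis_axis)
  \<comment> \<open>Iterated directional derivatives of \<open>G0\<close>, which with
    \<open>N\<close> the dimension is \<open>C * norm z powr (4 - N)\<close>.\<close>
  define g1 where "g1 a z = C * (4 - N) * ((z \<bullet> a) * norm z powr (2 - N))" for a z :: "'n pt"
  define g2 where "g2 a b z = C * (4 - N) * ((a \<bullet> b) * norm z powr (2 - N)
      + (z \<bullet> a) * ((2 - N) * norm z powr (- N) * (z \<bullet> b)))" for a b z :: "'n pt"
  define g3 where "g3 a b c z = C * (4 - N) * ((a \<bullet> b) * ((2 - N) * norm z powr (- N) * (z \<bullet> c))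
      + (c \<bullet> a) * ((2 - N) * norm z powr (- N) * (z \<bullet> b))
      + (z \<bullet> a) * ((2 - N) * norm z powr (- N) * (c \<bullet> b) + (2 - N) * (- N * norm z powr (- N - 2) * (z \<bullet> c)) * (z \<bullet> b)))"
    for a b c z :: "'n pt"
  have d0: "(G0 C has_derivative (\<lambda>a. g1 a z)) (at z)" if "z \<noteq> 0" for z
    unfolding G0_def[abs_def] g1_def
    by (rule has_derivative_eq_rhs, rule has_derivative_mult_right[OF has_derivative_norm_powr[OF that]])
      (simp add: N_def algebra_simps fun_eq_iff)
  have d1: "(g1 a has_derivative (\<lambda>b. g2 a b z)) (at z)" if "z \<noteq> 0" for a z
    unfolding g1_def[abs_def] g2_def
    by (rule has_derivative_eq_rhs, rule has_derivative_mult_right, rule has_derivative_mult,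
        rule has_derivative_inner_left[OF has_derivative_ident], rule has_derivative_norm_powr[OF that])
      (simp add: algebra_simps inner_commute fun_eq_iff)
  have d2: "(g2 a b has_derivative (\<lambda>c. g3 a b c z)) (at z)" if "z \<noteq> 0" for a b z
    unfolding g2_def[abs_def] g3_def
    by (rule has_derivative_eq_rhs, rule has_derivative_mult_right, rule has_derivative_add,
        rule has_derivative_mult_right[OF has_derivative_norm_powr[OF that]],
        rule has_derivative_mult, rule has_derivative_inner_left[OF has_derivative_ident],
        rule has_derivative_mult, rule has_derivative_mult_right[OF has_derivative_norm_powr[OF that]],
        rule has_derivative_inner_left[OF has_derivative_ident])
      (simp add: algebra_simps inner_commute fun_eq_iff)
  define u1 where "u1 = D0_adj (\<lambda>z :: 'n pt. G0 C z *\<^sub>R w)"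
  have u1: "u1 z = (\<Sum>A\<in>UNIV. \<Sum>j\<in>UNIV. g1 (E A j) z *\<^sub>R gamma j (w $ A))" if z: "z \<noteq> 0" for z
  proof -
    have "frechet_derivative (\<lambda>z. G0 C z *\<^sub>R w $ A) (at z) a = g1 a z *\<^sub>R w $ A" for A a
      by (simp only: frechet_derivative_at[OF has_derivative_scaleR_left[OF d0[OF z]], symmetric])
    then show ?thesis by (simp add: u1_def D0_adj_def partial_def E_def gamma_scaleR)
  qed
  have p1: "frechet_derivative u1 (at z) b = (\<Sum>A\<in>UNIV. \<Sum>j\<in>UNIV. g2 (E A j) b z *\<^sub>R gamma j (w $ A))" if z: "z \<noteq> 0" for z b
    by (rule frechet_derivative_sum_scaleR[OF u1 d1[OF z] z])
  define u2 where "u2 = D0 partial u1"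
  have u2: "u2 z $ B = (\<Sum>A\<in>UNIV. \<Sum>j\<in>UNIV. \<Sum>k\<in>UNIV. g2 (E A j) (E B k) z *\<^sub>R gamma k (gamma j (w $ A)))" if z: "z \<noteq> 0" for z B
  proof -
    have "u2 z $ B = (\<Sum>k\<in>UNIV. \<Sum>A\<in>UNIV. \<Sum>j\<in>UNIV. g2 (E A j) (E B k) z *\<^sub>R gamma k (gamma j (w $ A)))"
      by (simp add: u2_def D0_def partial_def p1[OF z] sum_gamma gamma_scaleR flip: E_def)
    also have "\<dots> = (\<Sum>A\<in>UNIV. \<Sum>k\<in>UNIV. \<Sum>j\<in>UNIV. g2 (E A j) (E B k) z *\<^sub>R gamma k (gamma j (w $ A)))"
      by (rule sum.swap)
    also have "\<dots> = (\<Sum>A\<in>UNIV. \<Sum>j\<in>UNIV. \<Sum>k\<in>UNIV. g2 (E A j) (E B k) z *\<^sub>R gamma k (gamma j (w $ A)))"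
      by (intro sum.cong refl sum.swap)
    finally show ?thesis .
  qed
  have p2: "frechet_derivative (\<lambda>z. u2 z $ B) (at x) c =
      (\<Sum>A\<in>UNIV. \<Sum>j\<in>UNIV. \<Sum>k\<in>UNIV. g3 (E A j) (E B k) c x *\<^sub>R gamma k (gamma j (w $ A)))" for B c
  proof -
    have "((\<lambda>z. \<Sum>A\<in>UNIV. \<Sum>j\<in>UNIV. \<Sum>k\<in>UNIV. g2 (E A j) (E B k) z *\<^sub>R gamma k (gamma j (w $ A))) has_derivative
      (\<lambda>c. \<Sum>A\<in>UNIV. \<Sum>j\<in>UNIV. \<Sum>k\<in>UNIV. g3 (E A j) (E B k) c x *\<^sub>R gamma k (gamma j (w $ A)))) (at x)"
      by (intro has_derivative_sum has_derivative_scaleR_left d2 x)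
    then have "((\<lambda>z. u2 z $ B) has_derivative
      (\<lambda>c. \<Sum>A\<in>UNIV. \<Sum>j\<in>UNIV. \<Sum>k\<in>UNIV. g3 (E A j) (E B k) c x *\<^sub>R gamma k (gamma j (w $ A)))) (at x)"
      by (rule has_derivative_transform_within_open[where s = "- {0}"]) (use u2 x in auto)
    from frechet_derivative_at[OF this, symmetric] show ?thesis by (simp only:)
  qed
  \<comment> \<open>This trace is the sum of second derivatives applied to \<open>g1\<close>. The
    terms with \<open>N\<close> cancel and leave \<open>2 * (4 - N) * (2 - N)\<close>, which is
    \<open>8 * (n - 1) * (n - 2)\<close> for \<open>N = 2 * n\<close>.\<close>
  have tr: "(\<Sum>B\<in>UNIV. \<Sum>k\<in>UNIV. g3 (E A j) (E B k) (E B k) x) =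
      8 * (real CARD('n) - 1) * (real CARD('n) - 2) * C * (x $ A $ j / (x \<bullet> x) ^ CARD('n))" for A j
  proof -
    have pw: "norm x powr (- N - 2) * (x \<bullet> x) = norm x powr (- N)"
    proof -
      have "x \<bullet> x = norm x powr 2" using x by (simp add: dot_square_norm powr_numeral)
      then show ?thesis by (simp only: powr_add[symmetric]) simp
    qed
    have xx: "(\<Sum>B\<in>UNIV. \<Sum>k\<in>UNIV. (x $ B $ k) * (x $ B $ k)) = x \<bullet> x"
      by (simp add: inner_vec_def)
    have xe: "(\<Sum>B\<in>UNIV. \<Sum>k\<in>UNIV. (E A j \<bullet> E B k) * (x $ B $ k)) = x $ A $ j"
    proof -
      have "(\<Sum>B\<in>UNIV. \<Sum>k\<in>UNIV. (E A j \<bullet> E B k) * (x $ B $ k)) = E A j \<bullet> x"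
        by (simp add: inner_E inner_vec_def[of "E A j"] inner_vec_def[of "E A j $ _"])
      then show ?thesis by (simp add: inner_commute inner_E)
    qed
    have "g3 (E A j) (E B k) (E B k) x = C * (4 - N) * (2 - N) * norm x powr (- N) * (2 * ((E A j \<bullet> E B k) * (x $ B $ k)) + x $ A $ j)
       - C * (4 - N) * (2 - N) * N * norm x powr (- N - 2) * x $ A $ j * (x $ B $ k * x $ B $ k)" for B k
      by (simp add: g3_def inner_E[of x] EE inner_commute[of "E B k" "E A j"] algebra_simps)
    then have "(\<Sum>B\<in>UNIV. \<Sum>k\<in>UNIV. g3 (E A j) (E B k) (E B k) x) =
        C * (4 - N) * (2 - N) * norm x powr (- N) * (2 * (\<Sum>B\<in>UNIV. \<Sum>k\<in>UNIV. (E A j \<bullet> E B k) * (x $ B $ k)) + N * x $ A $ j)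
      - C * (4 - N) * (2 - N) * N * norm x powr (- N - 2) * x $ A $ j * (\<Sum>B\<in>UNIV. \<Sum>k\<in>UNIV. x $ B $ k * x $ B $ k)"
      by (simp add: sum_subtractf sum.distrib N_def flip: sum_distrib_left)
    also have "\<dots> = C * (4 - N) * (2 - N) * norm x powr (- N) * (2 * x $ A $ j + N * x $ A $ j)
      - C * (4 - N) * (2 - N) * N * x $ A $ j * (norm x powr (- N - 2) * (x \<bullet> x))"
      unfolding xx xe by simp
    also have "\<dots> = 2 * C * (4 - N) * (2 - N) * x $ A $ j * norm x powr (- N)"
      unfolding pw by (simp add: algebra_simps)
    also have "norm x powr (- N) = inverse ((x \<bullet> x) ^ CARD('n))"
    proof -
      have "norm x powr N = norm x ^ (2 * CARD('n))"
        using x by (simp add: N_def flip: powr_realpow)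
      then show ?thesis by (simp add: powr_minus dot_square_norm power_mult)
    qed
    finally show ?thesis by (simp add: N_def divide_inverse algebra_simps)
  qed
  have "H C x w = (\<Sum>B\<in>UNIV. \<Sum>l\<in>UNIV. gamma l (\<Sum>A\<in>UNIV. \<Sum>j\<in>UNIV. \<Sum>k\<in>UNIV.
      g3 (E A j) (E B k) (E B l) x *\<^sub>R gamma k (gamma j (w $ A))))"
    by (simp add: H_def D0_adj_def[of u2] partial_def p2 flip: u1_def u2_def E_def)
  also have "\<dots> = (\<Sum>B\<in>UNIV. \<Sum>l\<in>UNIV. \<Sum>A\<in>UNIV. \<Sum>j\<in>UNIV. \<Sum>k\<in>UNIV.
      g3 (E A j) (E B k) (E B l) x *\<^sub>R gamma l (gamma k (gamma j (w $ A))))"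
    by (simp add: sum_gamma gamma_scaleR)
  also have "\<dots> = (\<Sum>B\<in>UNIV. \<Sum>A\<in>UNIV. \<Sum>l\<in>UNIV. \<Sum>j\<in>UNIV. \<Sum>k\<in>UNIV.
      g3 (E A j) (E B k) (E B l) x *\<^sub>R gamma l (gamma k (gamma j (w $ A))))"
    by (intro sum.cong refl sum.swap)
  also have "\<dots> = (\<Sum>B\<in>UNIV. \<Sum>A\<in>UNIV. \<Sum>j\<in>UNIV. \<Sum>l\<in>UNIV. \<Sum>k\<in>UNIV.
      g3 (E A j) (E B k) (E B l) x *\<^sub>R gamma l (gamma k (gamma j (w $ A))))"
    by (intro sum.cong refl sum.swap)
  also have "\<dots> = (\<Sum>B\<in>UNIV. \<Sum>A\<in>UNIV. \<Sum>j\<in>UNIV. - (\<Sum>k\<in>UNIV. g3 (E A j) (E B k) (E B k) x) *\<^sub>R gamma j (w $ A))"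
    by (intro sum.cong refl sum_gamma_gamma_symmetric[OF m, where T = "\<lambda>l k. g3 (E _ _) (E _ k) (E _ l) x"])
      (simp add: g3_def EE inner_commute algebra_simps)
  also have "\<dots> = (\<Sum>A\<in>UNIV. \<Sum>B\<in>UNIV. \<Sum>j\<in>UNIV. - (\<Sum>k\<in>UNIV. g3 (E A j) (E B k) (E B k) x) *\<^sub>R gamma j (w $ A))"
    by (rule sum.swap)
  also have "\<dots> = (\<Sum>A\<in>UNIV. \<Sum>j\<in>UNIV. \<Sum>B\<in>UNIV. - (\<Sum>k\<in>UNIV. g3 (E A j) (E B k) (E B k) x) *\<^sub>R gamma j (w $ A))"
    by (intro sum.cong refl sum.swap)
  also have "\<dots> = (\<Sum>A\<in>UNIV. \<Sum>j\<in>UNIV. - (\<Sum>B\<in>UNIV. \<Sum>k\<in>UNIV. g3 (E A j) (E B k) (E B k) x) *\<^sub>R gamma j (w $ A))"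
    by (simp flip: scaleR_sum_left add: sum_negf)
  also have "\<dots> = (\<Sum>A\<in>UNIV. \<Sum>j\<in>UNIV.
    (- 8 * (real CARD('n) - 1) * (real CARD('n) - 2) * C * (x $ A $ j / (x \<bullet> x) ^ CARD('n))) *\<^sub>R gamma j (w $ A))"
    unfolding tr by (intro sum.cong refl arg_cong2[where f = scaleR]) (simp add: algebra_simps)
  finally show ?thesis .
qed


subsection \<open>The representation formula\<close>

lemma sum_triple: "(\<Sum>(A, j, k)\<in>UNIV. F A j k) = (\<Sum>A\<in>UNIV. \<Sum>j\<in>UNIV. \<Sum>k\<in>UNIV. F A j k)"
  for F :: "'a::finite \<Rightarrow> 'b::finite \<Rightarrow> 'c::finite \<Rightarrow> 'd::comm_monoid_add"
proof -
  have "(\<Sum>A\<in>UNIV. \<Sum>j\<in>UNIV. \<Sum>k\<in>UNIV. F A j k) = (\<Sum>A\<in>UNIV. \<Sum>(j, k)\<in>UNIV \<times> UNIV. F A j k)"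
    by (simp only: sum.cartesian_product)
  also have "\<dots> = (\<Sum>(A, j, k)\<in>UNIV \<times> UNIV \<times> UNIV. F A j k)"
    by (subst sum.cartesian_product) (simp add: case_prod_unfold)
  finally show ?thesis by simp
qed

lemma integral_sum_bounded_linear:
  fixes X :: "'i \<Rightarrow> 'a \<Rightarrow> 'b::{banach, second_countable_topology}"
    and B :: "'i \<Rightarrow> 'b \<Rightarrow> 'c::{banach, second_countable_topology}"
  assumes "\<And>i. i \<in> I \<Longrightarrow> bounded_linear (B i)" "\<And>i. i \<in> I \<Longrightarrow> integrable M (X i)"
  shows "integrable M (\<lambda>y. \<Sum>i\<in>I. B i (X i y))"
    and "(LINT y|M. (\<Sum>i\<in>I. B i (X i y))) = (\<Sum>i\<in>I. B i (LINT y|M. X i y))"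
proof -
  have i: "integrable M (\<lambda>y. B i (X i y))" if "i \<in> I" for i
    by (rule integrable_bounded_linear[OF assms(1)[OF that] assms(2)[OF that]])
  then show "integrable M (\<lambda>y. \<Sum>i\<in>I. B i (X i y))"
    by (rule Bochner_Integration.integrable_sum)
  show "(LINT y|M. (\<Sum>i\<in>I. B i (X i y))) = (\<Sum>i\<in>I. B i (LINT y|M. X i y))"
    using i by (subst Bochner_Integration.integral_sum)
      (auto intro!: sum.cong integral_bounded_linear[OF assms(1) assms(2)])
qed

locale spinor_region = C2_region \<Omega> U S \<nu>
  for \<Omega> U :: "'n::{finite,linorder} pt set" and S :: "'n pt measure" and \<nu> :: "'n pt \<Rightarrow> 'n pt" +
  fixes f :: "'n pt \<Rightarrow> 'm::{finite,linorder} ext" and g :: "2 \<Rightarrow> 'n \<Rightarrow> 'n pt \<Rightarrow> 'm ext" and C :: real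
  assumes n: "3 \<le> CARD('n)" and m: "CARD('m) = CARD('n) div 2"
    and fs: "fundamental_solution_Delta2 (G0 C :: 'n pt \<Rightarrow> real)"
    and f: "continuous_on U f" and g: "weak_deriv U (axis A (axis j 1)) f (g A j)"
begin

definition kc :: real where
  "kc = - 8 * (real CARD('n) - 1) * (real CARD('n) - 2) * C"

text \<open>The explicit form of the kernel. Unlike \<open>H\<close> it is under control at
  \<open>y = x\<close>, where it is 0.\<close>

definition cauchy :: "'n pt \<Rightarrow> 'n pt \<Rightarrow> 'm ext ^ 2 \<Rightarrow> 'm ext" where
  "cauchy x y w = (\<Sum>A\<in>UNIV. \<Sum>j\<in>UNIV. (kc * newton CARD('n) x (axis A (axis j 1)) y) *\<^sub>R gamma j (w $ A))"

definition Df :: "'n pt \<Rightarrow> 'm ext ^ 2" where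
  "Df y = (\<chi> A. \<Sum>k\<in>UNIV. gamma k (g A k y))"

lemma H_eq_cauchy: "x \<noteq> y \<Longrightarrow> H C (x - y) w = cauchy x y w"
  unfolding cauchy_def kc_def newton_def inner_pt_axis by (rule kernel_formula[OF m]) simp

lemma kc_mass: "kc * (DIM('n pt) * unit_ball_vol DIM('n pt)) = - 1"
proof -
  have "kc * (DIM('n pt) * unit_ball_vol DIM('n pt)) =
      - (8 * (real CARD('n) - 1) * (real CARD('n) - 2) * C * (DIM('n pt) * unit_ball_vol DIM('n pt)))"
    unfolding kc_def by (simp only: mult_minus_left)
  then show ?thesis by (simp only: fundamental_solution_constant[OF n fs])
qed

lemma bounded_linear_gamma_gamma: "bounded_linear (\<lambda>v. c *\<^sub>R gamma j (gamma k v))"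
  by (intro bounded_linear_const_scaleR bounded_linear_compose[OF bounded_linear_gamma] bounded_linear_gamma)

lemma \<Omega>_lebesgue: "\<Omega> \<in> sets lebesgue"
  using open_\<Omega> by (simp add: borel_open)

lemma set_integrable_g: "set_integrable lebesgue \<Omega> (g A k)"
proof -
  have "set_integrable lebesgue (closure \<Omega>) (g A k)"
    using g compact_closure_\<Omega> closure_\<Omega> by (auto simp: weak_deriv_def locally_integrable_def)
  then show ?thesis by (rule set_integrable_subset[OF _ \<Omega>_lebesgue closure_subset])
qed

lemma cauchy_Df:
  "cauchy x y (Df y) = (\<Sum>(A, j, k)\<in>UNIV. newton CARD('n) x (axis A (axis j 1)) y *\<^sub>R (kc *\<^sub>R gamma j (gamma k (g A k y))))"
  unfolding sum_triple cauchy_def Df_def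
  by (simp add: sum_gamma scaleR_sum_right mult.commute)

text \<open>The scalar divergence theorem is applied for every triple \<open>(A, j, k)\<close>, with
  the factor \<open>h A j\<close> and the direction \<open>?E A k\<close>; the sum over the triples
  is then formed with the bounded linear maps given by two generators. The hypothesis
  \<open>sub\<close> places the whole transition shell in \<Omega>, so the cutoff is 1 on the
  frontier.\<close>

lemma cutoff_identity:
  assumes x: "x \<in> \<Omega>" and e: "0 < \<epsilon>" "0 < \<delta>"
    and sub: "\<And>y. (x - y) \<bullet> (x - y) \<le> \<epsilon>\<^sup>2 + \<delta> \<Longrightarrow> y \<in> \<Omega>"
  defines "mass \<equiv> \<lambda>y. shell_density \<epsilon> \<delta> x y * (((x - y) \<bullet> (x - y)) / ((x - y) \<bullet> (x - y)) ^ CARD('n))"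
  shows "integrable S (\<lambda>y. cauchy x y (normal_column (\<nu> y) (f y)))"
    and "(LINT y:\<Omega>|lebesgue. (kc * mass y) *\<^sub>R f y + outer_cutoff \<epsilon> \<delta> x y *\<^sub>R cauchy x y (Df y))
      = (LINT y|S. cauchy x y (normal_column (\<nu> y) (f y)))"
proof -
  let ?E = "\<lambda>A j. axis A (axis j 1) :: 'n pt"
  define h where "h A j = cut_newton \<epsilon> \<delta> CARD('n) x (?E A j)" for A and j :: 'n
  have ck: "Ck 1 (h A j)" for A j unfolding h_def by (rule Ck1_cut_newton[OF e])
  have dh: "frechet_derivative (h A j) (at y) = cut_newton_deriv \<epsilon> \<delta> CARD('n) x (?E A j) y" for A j y
    unfolding h_def by (rule frechet_derivative_cut_newton[OF e])
  define B where "B = (\<lambda>(A::2, j::'n, k::'n) v. kc *\<^sub>R gamma j (gamma k v) :: 'm ext)"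
  define X where "X = (\<lambda>(A, j, k) y. indicator \<Omega> y *\<^sub>R (cut_newton_deriv \<epsilon> \<delta> CARD('n) x (?E A j) y (?E A k) *\<^sub>R f y + h A j y *\<^sub>R g A k y))"
  define Y where "Y = (\<lambda>(A, j, k) y. (h A j y * (\<nu> y \<bullet> ?E A k)) *\<^sub>R f y)"
  have B: "bounded_linear (B p)" for p unfolding B_def by (cases p) (simp add: bounded_linear_gamma_gamma)
  have Xi: "integrable lebesgue (X p)" for p
  proof (cases p)
    case (fields A j k)
    have "set_integrable lebesgue \<Omega> (\<lambda>y. frechet_derivative (h A j) (at y) (?E A k) *\<^sub>R f y + h A j y *\<^sub>R g A k y)"
      by (intro set_integral_add(1) set_integrable_Ck1[OF g axis_axis_in_Basis ck])
    then show ?thesis by (simp add: X_def fields set_integrable_def dh)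
  qed
  have Yi: "integrable S (Y p)" for p
  proof (cases p)
    case (fields A j k)
    then show ?thesis using integrable_surface_Ck1[OF f ck] by (simp add: Y_def)
  qed
  have XY: "(LINT y|lebesgue. X p y) = (LINT y|S. Y p y)" for p
  proof (cases p)
    case (fields A j k)
    have "(LINT y:\<Omega>|lebesgue. frechet_derivative (h A j) (at y) (?E A k) *\<^sub>R f y + h A j y *\<^sub>R g A k y)
        = (LINT y|S. (h A j y * (\<nu> y \<bullet> ?E A k)) *\<^sub>R f y)"
      by (rule divergence_theorem[OF f g axis_axis_in_Basis ck])
    then show ?thesis by (simp add: X_def Y_def fields set_lebesgue_integral_def dh)
  qed
  have sumX: "(\<Sum>p\<in>UNIV. B p (X p y)) = indicator \<Omega> y *\<^sub>R ((kc * mass y) *\<^sub>R f y + outer_cutoff \<epsilon> \<delta> x y *\<^sub>R cauchy x y (Df y))" for y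
  proof -
    let ?D = "\<lambda>A j k. cut_newton_deriv \<epsilon> \<delta> CARD('n) x (?E A j) y (?E A k)"
    have "(\<Sum>p\<in>UNIV. B p (X p y)) = (\<Sum>(A, j, k)\<in>UNIV. indicator \<Omega> y *\<^sub>R (kc *\<^sub>R (?D A j k *\<^sub>R gamma j (gamma k (f y)))
        + h A j y *\<^sub>R (kc *\<^sub>R gamma j (gamma k (g A k y)))))"
      by (intro sum.cong refl) (auto simp: B_def X_def gamma_scaleR gamma_add scaleR_add_right mult_ac)
    also have "\<dots> = indicator \<Omega> y *\<^sub>R (kc *\<^sub>R (\<Sum>(A, j, k)\<in>UNIV. ?D A j k *\<^sub>R gamma j (gamma k (f y)))
        + (\<Sum>(A, j, k)\<in>UNIV. h A j y *\<^sub>R (kc *\<^sub>R gamma j (gamma k (g A k y)))))"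
      by (simp only: scaleR_sum_right sum.distrib[symmetric] case_prod_unfold)
    also have "(\<Sum>(A, j, k)\<in>UNIV. ?D A j k *\<^sub>R gamma j (gamma k (f y))) = mass y *\<^sub>R f y"
    proof -
      have "(\<Sum>(A, j, k)\<in>UNIV. ?D A j k *\<^sub>R gamma j (gamma k (f y))) = (\<Sum>A\<in>UNIV. - (\<Sum>j\<in>UNIV. ?D A j j) *\<^sub>R f y)"
        unfolding sum_triple by (intro sum.cong refl sum_gamma_gamma_symmetric[OF m] cut_newton_deriv_commute)
      also have "\<dots> = - (\<Sum>A\<in>UNIV. \<Sum>j\<in>UNIV. ?D A j j) *\<^sub>R f y"
        by (simp only: scaleR_sum_left[symmetric] sum_negf)
      finally show ?thesis unfolding cut_newton_deriv_trace by (simp add: mass_def)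
    qed
    also have "(\<Sum>(A, j, k)\<in>UNIV. h A j y *\<^sub>R (kc *\<^sub>R gamma j (gamma k (g A k y)))) = outer_cutoff \<epsilon> \<delta> x y *\<^sub>R cauchy x y (Df y)"
      unfolding cauchy_Df scaleR_sum_right by (intro sum.cong refl) (auto simp: h_def cut_newton_def)
    finally show ?thesis by simp
  qed
  have sumY: "(\<Sum>p\<in>UNIV. B p (Y p y)) = cauchy x y (normal_column (\<nu> y) (f y))" if y: "y \<in> space S" for y
  proof -
    have "y \<notin> \<Omega>" using y open_\<Omega> by (simp add: surface_measure_space[OF S] frontier_def interior_open)
    then have "\<not> (x - y) \<bullet> (x - y) \<le> \<epsilon>\<^sup>2 + \<delta>" using sub by blast
    then have 1: "outer_cutoff \<epsilon> \<delta> x y = 1" by (intro cutoff_outside(1)[OF e]) simp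
    have "(\<Sum>p\<in>UNIV. B p (Y p y)) = (\<Sum>A\<in>UNIV. \<Sum>j\<in>UNIV. \<Sum>k\<in>UNIV.
        kc *\<^sub>R ((newton CARD('n) x (?E A j) y * (\<nu> y $ A $ k)) *\<^sub>R gamma j (gamma k (f y))))"
      unfolding sum_triple[symmetric]
      by (intro sum.cong refl) (auto simp: B_def Y_def h_def cut_newton_def 1 gamma_scaleR inner_pt_axis)
    also have "\<dots> = cauchy x y (normal_column (\<nu> y) (f y))"
      by (simp add: cauchy_def normal_column_def sum_gamma gamma_scaleR scaleR_sum_right mult.assoc)
    finally show ?thesis .
  qed
  have "integrable S (\<lambda>y. \<Sum>p\<in>UNIV. B p (Y p y))" using B Yi by (rule integral_sum_bounded_linear)
  then show "integrable S (\<lambda>y. cauchy x y (normal_column (\<nu> y) (f y)))"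
    by (subst (asm) Bochner_Integration.integrable_cong[OF refl sumY])
  have "(LINT y:\<Omega>|lebesgue. (kc * mass y) *\<^sub>R f y + outer_cutoff \<epsilon> \<delta> x y *\<^sub>R cauchy x y (Df y))
      = (LINT y|lebesgue. (\<Sum>p\<in>UNIV. B p (X p y)))"
    unfolding sumX set_lebesgue_integral_def ..
  also have "\<dots> = (\<Sum>p\<in>UNIV. B p (LINT y|lebesgue. X p y))"
    using B Xi by (rule integral_sum_bounded_linear)
  also have "\<dots> = (\<Sum>p\<in>UNIV. B p (LINT y|S. Y p y))" unfolding XY ..
  also have "\<dots> = (LINT y|S. (\<Sum>p\<in>UNIV. B p (Y p y)))"
    using B Yi by (rule integral_sum_bounded_linear(2)[symmetric])
  also have "\<dots> = (LINT y|S. cauchy x y (normal_column (\<nu> y) (f y)))"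
    by (rule Bochner_Integration.integral_cong[OF refl sumY])
  finally show "(LINT y:\<Omega>|lebesgue. (kc * mass y) *\<^sub>R f y + outer_cutoff \<epsilon> \<delta> x y *\<^sub>R cauchy x y (Df y))
      = (LINT y|S. cauchy x y (normal_column (\<nu> y) (f y)))" .
qed

lemma newton_bound:
  assumes "0 < \<epsilon>" "\<epsilon> \<le> norm (x - y)"
  shows "\<bar>newton CARD('n) x (axis A (axis j 1)) (y :: 'n pt)\<bar> \<le> norm (x - y) / (\<epsilon>\<^sup>2) ^ CARD('n)"
proof -
  have "\<bar>(x - y) \<bullet> axis A (axis j 1)\<bar> \<le> norm (x - y)" by (rule Basis_le_norm[OF axis_axis_in_Basis])
  moreover have "(\<epsilon>\<^sup>2) ^ CARD('n) \<le> ((x - y) \<bullet> (x - y)) ^ CARD('n)"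
    using assms by (intro power_mono) (auto simp: dot_square_norm)
  moreover have "0 < (\<epsilon>\<^sup>2) ^ CARD('n)" using assms by simp
  ultimately show ?thesis
    unfolding newton_def by (simp add: abs_divide frac_le)
qed

lemma newton_measurable [measurable]: "newton k x a \<in> borel_measurable borel"
  unfolding newton_def[abs_def] by measurable

lemma set_integrable_cauchy:
  assumes "\<And>A j k. set_integrable lebesgue D (\<lambda>y. newton CARD('n) x (axis A (axis j 1)) y *\<^sub>R g A k y)"
  shows "set_integrable lebesgue D (\<lambda>y. cauchy x y (Df y))"
proof -
  let ?B = "\<lambda>(A::2, j::'n, k::'n) v. kc *\<^sub>R gamma j (gamma k v) :: 'm ext"
  let ?X = "\<lambda>(A, j, k) y. indicator D y *\<^sub>R (newton CARD('n) x (axis A (axis j 1)) y *\<^sub>R g A k y)"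
  have "integrable lebesgue (\<lambda>y. \<Sum>p\<in>UNIV. ?B p (?X p y))"
    using assms unfolding set_integrable_def
    by (intro integral_sum_bounded_linear(1)) (auto simp: bounded_linear_gamma_gamma split: prod.splits)
  moreover have "(\<Sum>p\<in>UNIV. ?B p (?X p y)) = indicator D y *\<^sub>R cauchy x y (Df y)" for y
    unfolding cauchy_Df scaleR_sum_right by (intro sum.cong refl) (auto simp: gamma_scaleR mult_ac)
  ultimately show ?thesis by (simp add: set_integrable_def)
qed

lemma set_integrable_cauchy_outside:
  assumes e: "0 < \<epsilon>"
  shows "set_integrable lebesgue (\<Omega> - ball x \<epsilon>) (\<lambda>y. cauchy x y (Df y))"
proof -
  have meas: "\<Omega> - ball x \<epsilon> \<in> sets lebesgue" using \<Omega>_lebesgue by auto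
  obtain R where R: "\<And>y. y \<in> \<Omega> \<Longrightarrow> norm (x - y) \<le> R"
    using bounded_\<Omega> bounded_any_center[of \<Omega> x] by (auto simp: dist_norm)
  have "integrable lebesgue (\<lambda>y. (indicator (\<Omega> - ball x \<epsilon>) y * newton CARD('n) x (axis A (axis j 1)) y) *\<^sub>R g A k y)" for A j k
  proof (rule integrable_scaleR_support(1)[where K = "\<Omega> - ball x \<epsilon>" and M = "R / (\<epsilon>\<^sup>2) ^ CARD('n)"])
    show "(\<lambda>y. indicator (\<Omega> - ball x \<epsilon>) y * newton CARD('n) x (axis A (axis j 1)) y) \<in> borel_measurable lebesgue"
      using meas by (intro borel_measurable_times borel_measurable_indicator measurable_completion) auto
    show "\<bar>indicator (\<Omega> - ball x \<epsilon>) y * newton CARD('n) x (axis A (axis j 1)) y\<bar> \<le> R / (\<epsilon>\<^sup>2) ^ CARD('n)"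
      if y: "y \<in> \<Omega> - ball x \<epsilon>" for y
    proof -
      have "\<bar>newton CARD('n) x (axis A (axis j 1)) y\<bar> \<le> norm (x - y) / (\<epsilon>\<^sup>2) ^ CARD('n)"
        using y by (intro newton_bound[OF e]) (auto simp: dist_norm)
      also have "\<dots> \<le> R / (\<epsilon>\<^sup>2) ^ CARD('n)" using R y by (intro divide_right_mono) auto
      finally show ?thesis using y by simp
    qed
    show "set_integrable lebesgue (\<Omega> - ball x \<epsilon>) (g A k)"
      by (rule set_integrable_subset[OF set_integrable_g meas]) auto
  qed auto
  then show ?thesis by (intro set_integrable_cauchy) (simp add: set_integrable_def)
qed

text \<open>The smooth cutoffs of \<open>cutoff_identity\<close> become sharp as \<open>\<delta>\<close> tends to \<open>0\<close>.\<close>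

lemma outside_ball_estimate:
  assumes x: "x \<in> \<Omega>" and e: "0 < \<epsilon>" "\<epsilon> < \<rho>" and sub: "ball x \<rho> \<subseteq> \<Omega>"
    and close: "\<And>y. y \<in> ball x \<rho> \<Longrightarrow> norm (f y - f x) \<le> \<eta>"
  shows "norm ((LINT y:(\<Omega> - ball x \<epsilon>)|lebesgue. cauchy x y (Df y))
    - (LINT y|S. cauchy x y (normal_column (\<nu> y) (f y))) - f x) \<le> \<eta>"
proof -
  let ?F = "\<lambda>y. cauchy x y (Df y)" and ?b = "LINT y|S. cauchy x y (normal_column (\<nu> y) (f y))"
  \<comment> \<open>Starting the denominator at 2 makes \<open>d k\<close> strictly smaller than
    \<open>\<rho>\<^sup>2 - \<epsilon>\<^sup>2\<close> for every \<open>k\<close>, so each shell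
    lies within \<open>ball x \<rho>\<close>.\<close>
  define d where "d k = (\<rho>\<^sup>2 - \<epsilon>\<^sup>2) / (2 + real k)" for k
  have pos: "\<rho>\<^sup>2 - \<epsilon>\<^sup>2 > 0" using e by (simp add: power_strict_mono)
  have d: "0 < d k" "\<epsilon>\<^sup>2 + d k < \<rho>\<^sup>2" for k
  proof -
    show "0 < d k" using pos by (simp add: d_def)
    have "d k < \<rho>\<^sup>2 - \<epsilon>\<^sup>2" unfolding d_def using pos by (simp add: divide_less_eq)
    then show "\<epsilon>\<^sup>2 + d k < \<rho>\<^sup>2" by simp
  qed
  have "(\<lambda>k. (\<rho>\<^sup>2 - \<epsilon>\<^sup>2) / (2 + real k)) \<longlonglongrightarrow> 0"
    by (intro tendsto_divide_0[OF tendsto_const] filterlim_at_top_imp_at_infinity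
        filterlim_tendsto_add_at_top[OF tendsto_const] filterlim_real_sequentially)
  then have d0: "d \<longlonglongrightarrow> 0" by (simp add: d_def[abs_def])
  have inb: "y \<in> ball x \<rho>" if "(x - y) \<bullet> (x - y) \<le> \<epsilon>\<^sup>2 + d k" for y k
  proof -
    have "(norm (x - y))\<^sup>2 < \<rho>\<^sup>2" using that d(2)[of k] by (simp add: dot_square_norm)
    then have "norm (x - y) < \<rho>" using e power_less_imp_less_base[of "norm (x - y)" 2 \<rho>] by linarith
    then show ?thesis by (simp add: dist_norm)
  qed
  have Fi: "integrable lebesgue (\<lambda>y. indicator (\<Omega> - ball x \<epsilon>) y *\<^sub>R ?F y)"
    using set_integrable_cauchy_outside[OF e(1), of x] by (simp add: set_integrable_def)
  let ?G = "\<lambda>k y. indicator \<Omega> y *\<^sub>R (outer_cutoff \<epsilon> (d k) x y *\<^sub>R ?F y)"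
  have G: "?G k y = outer_cutoff \<epsilon> (d k) x y *\<^sub>R (indicator (\<Omega> - ball x \<epsilon>) y *\<^sub>R ?F y)" for k y
  proof (cases "y \<in> ball x \<epsilon>")
    case True
    then have "outer_cutoff \<epsilon> (d k) x y = 0"
      using in_ball_imp_inner_less[OF e(1) True] by (intro cutoff_inside(1)[OF e(1) d(1)]) simp
    then show ?thesis by simp
  qed (simp add: indicator_def)
  have cm: "outer_cutoff \<epsilon> (d k) x \<in> borel_measurable lebesgue" for k
    using borel_measurable_continuous_onI[OF continuous_outer_cutoff[OF d(1)[of k]], of \<epsilon> x]
    by (intro measurable_completion) simp
  have Gm: "?G k \<in> borel_measurable lebesgue" for k
    unfolding G by (rule borel_measurable_scaleR[OF cm borel_measurable_integrable[OF Fi]])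
  have le: "norm (?G k y) \<le> norm (indicator (\<Omega> - ball x \<epsilon>) y *\<^sub>R ?F y)" for k y
    unfolding G using step_bounds[of "((x - y) \<bullet> (x - y) - \<epsilon>\<^sup>2) / d k"]
    by (simp add: outer_cutoff_def mult.assoc mult_left_le_one_le)
  have Gi: "integrable lebesgue (?G k)" for k
    by (rule Bochner_Integration.integrable_bound[OF Fi Gm]) (use le in blast)
  have lim: "(\<lambda>k. LINT y|lebesgue. ?G k y) \<longlonglongrightarrow> (LINT y|lebesgue. indicator (\<Omega> - ball x \<epsilon>) y *\<^sub>R ?F y)"
  proof (rule integral_dominated_convergence[where w = "\<lambda>y. norm (indicator (\<Omega> - ball x \<epsilon>) y *\<^sub>R ?F y)"])
    \<comment> \<open>On the sphere the cutoffs vanish although its points in \<Omega> belong to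
      \<open>\<Omega> - ball x \<epsilon>\<close>; the limit fails only on this null set.\<close>
    have "sphere x \<epsilon> \<in> null_sets lebesgue"
      using negligible_sphere[of x \<epsilon>] by (simp add: negligible_iff_null_sets)
    then have "AE y in lebesgue. y \<notin> sphere x \<epsilon>" by (rule AE_not_in)
    then show "AE y in lebesgue. (\<lambda>k. ?G k y) \<longlonglongrightarrow> indicator (\<Omega> - ball x \<epsilon>) y *\<^sub>R ?F y"
    proof eventually_elim
      fix y assume y: "y \<notin> sphere x \<epsilon>"
      show "(\<lambda>k. ?G k y) \<longlonglongrightarrow> indicator (\<Omega> - ball x \<epsilon>) y *\<^sub>R ?F y"
      proof (cases "y \<in> ball x \<epsilon>")
        case True
        then show ?thesis unfolding G by simp
      next
        case False
        then have "\<epsilon> < norm (x - y)" using y by (auto simp: dist_norm)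
        then have "0 < (x - y) \<bullet> (x - y) - \<epsilon>\<^sup>2" using e by (simp add: dot_square_norm power_strict_mono)
        then have "\<forall>\<^sub>F k in sequentially. d k < (x - y) \<bullet> (x - y) - \<epsilon>\<^sup>2" using order_tendstoD(2)[OF d0] by blast
        then have "\<forall>\<^sub>F k in sequentially. ?G k y = indicator (\<Omega> - ball x \<epsilon>) y *\<^sub>R ?F y"
        proof eventually_elim
          fix k assume "d k < (x - y) \<bullet> (x - y) - \<epsilon>\<^sup>2"
          then have "outer_cutoff \<epsilon> (d k) x y = 1" by (intro cutoff_outside(1)[OF e(1) d(1)]) simp
          then show "?G k y = indicator (\<Omega> - ball x \<epsilon>) y *\<^sub>R ?F y" unfolding G by simp
        qed
        then show ?thesis by (rule tendsto_eventually)
      qed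
    qed
    show "integrable lebesgue (\<lambda>y. norm (indicator (\<Omega> - ball x \<epsilon>) y *\<^sub>R ?F y))" by (rule integrable_norm[OF Fi])
  qed (use Gm Fi le in auto)
  have est: "norm ((LINT y|lebesgue. ?G k y) - ?b - f x) \<le> \<eta>" for k
  proof -
    define mass where "mass y = shell_density \<epsilon> (d k) x y * (((x - y) \<bullet> (x - y)) / ((x - y) \<bullet> (x - y)) ^ CARD('n))" for y
    have mass_int: "integrable lebesgue mass" and mass_eq: "(LINT y|lebesgue. mass y) = DIM('n pt) * unit_ball_vol DIM('n pt)"
      using shell_mass[OF e(1) d(1)[of k], of "CARD('n)" x] n unfolding mass_def[abs_def] by simp_all
    have mass0: "mass y = 0" if "y \<notin> ball x \<rho>" for y
    proof -
      have "\<not> (x - y) \<bullet> (x - y) \<le> \<epsilon>\<^sup>2 + d k" using inb that by blast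
      then have "shell_density \<epsilon> (d k) x y = 0" by (intro cutoff_outside(2)[OF e(1) d(1)]) simp
      then show ?thesis by (simp add: mass_def)
    qed
    have mass_nn: "0 \<le> mass y" for y
      unfolding mass_def using d(1)[of k] by (intro mult_nonneg_nonneg shell_density_nonneg divide_nonneg_nonneg zero_le_power inner_ge_zero)
    have id: "(LINT y:\<Omega>|lebesgue. (kc * mass y) *\<^sub>R f y + outer_cutoff \<epsilon> (d k) x y *\<^sub>R ?F y) = ?b"
      unfolding mass_def
    proof (rule cutoff_identity(2)[OF x e(1) d(1)])
      show "y \<in> \<Omega>" if "(x - y) \<bullet> (x - y) \<le> \<epsilon>\<^sup>2 + d k" for y using inb[OF that] sub by blast
    qed
    let ?M = "\<lambda>y. indicator \<Omega> y *\<^sub>R ((kc * mass y) *\<^sub>R f y)"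
    \<comment> \<open>The first part integrates to \<open>- f x\<close> by \<open>kc_mass\<close>.
      The second is at most \<open>\<eta>\<close> times the mass, and \<open>kc\<close> times the
      mass has absolute value 1.\<close>
    have M: "?M y = kc *\<^sub>R (mass y *\<^sub>R f x) + kc *\<^sub>R (mass y *\<^sub>R (indicator \<Omega> y *\<^sub>R (f y - f x)))" for y
    proof (cases "y \<in> \<Omega>")
      case False
      then have "mass y = 0" using mass0 sub by blast
      then show ?thesis by simp
    qed (simp add: algebra_simps)
    have r1: "integrable lebesgue (\<lambda>y. mass y *\<^sub>R f x)" using mass_int by simp
    have bnd: "norm (mass y *\<^sub>R (indicator \<Omega> y *\<^sub>R (f y - f x))) \<le> mass y * \<eta>" for y
    proof (cases "y \<in> ball x \<rho>")
      case True
      then show ?thesis using close[OF True] mass_nn[of y] sub by (auto simp: indicator_def intro!: mult_left_mono)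
    qed (simp add: mass0)
    have r2: "integrable lebesgue (\<lambda>y. mass y *\<^sub>R (indicator \<Omega> y *\<^sub>R (f y - f x)))"
    proof (rule Bochner_Integration.integrable_bound)
      show "integrable lebesgue (\<lambda>y. mass y * \<eta>)" using mass_int by simp
      have "set_integrable lebesgue (closure \<Omega>) f"
        using g compact_closure_\<Omega> closure_\<Omega> by (auto simp: weak_deriv_def locally_integrable_def)
      then have "set_integrable lebesgue \<Omega> f" by (rule set_integrable_subset[OF _ \<Omega>_lebesgue closure_subset])
      then have "(\<lambda>y. indicator \<Omega> y *\<^sub>R f y) \<in> borel_measurable lebesgue"
        unfolding set_integrable_def by (rule borel_measurable_integrable)
      then have "(\<lambda>y. mass y *\<^sub>R (indicator \<Omega> y *\<^sub>R f y - indicator \<Omega> y *\<^sub>R f x)) \<in> borel_measurable lebesgue"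
        by (intro borel_measurable_scaleR[OF borel_measurable_integrable[OF mass_int]] borel_measurable_diff
            borel_measurable_scaleR[OF borel_measurable_indicator[OF \<Omega>_lebesgue] borel_measurable_const])
      then show "(\<lambda>y. mass y *\<^sub>R (indicator \<Omega> y *\<^sub>R (f y - f x))) \<in> borel_measurable lebesgue"
        by (simp only: scaleR_diff_right)
      show "AE y in lebesgue. norm (mass y *\<^sub>R (indicator \<Omega> y *\<^sub>R (f y - f x))) \<le> norm (mass y * \<eta>)"
        using bnd by (intro AE_I2) (metis abs_ge_self order_trans real_norm_def)
    qed
    let ?err = "LINT y|lebesgue. mass y *\<^sub>R (indicator \<Omega> y *\<^sub>R (f y - f x))"
    have Mi: "integrable lebesgue ?M"
      unfolding M by (intro Bochner_Integration.integrable_add integrable_scaleR_right r1 r2)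
    have "(LINT y|lebesgue. ?M y) = (LINT y|lebesgue. kc *\<^sub>R (mass y *\<^sub>R f x))
        + (LINT y|lebesgue. kc *\<^sub>R (mass y *\<^sub>R (indicator \<Omega> y *\<^sub>R (f y - f x))))"
      unfolding M by (intro Bochner_Integration.integral_add integrable_scaleR_right r1 r2)
    also have "\<dots> = kc *\<^sub>R (LINT y|lebesgue. mass y *\<^sub>R f x) + kc *\<^sub>R ?err"
      by (simp only: integral_scaleR_right)
    also have "(LINT y|lebesgue. mass y *\<^sub>R f x) = (LINT y|lebesgue. mass y) *\<^sub>R f x"
      using mass_int by (intro integral_scaleR_left)
    also have "kc *\<^sub>R ((LINT y|lebesgue. mass y) *\<^sub>R f x) = - f x"
      using kc_mass by (simp add: mass_eq)
    finally have MM: "(LINT y|lebesgue. ?M y) = - f x + kc *\<^sub>R ?err" .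
    have "?b = (LINT y|lebesgue. ?M y + ?G k y)"
      unfolding id[symmetric] set_lebesgue_integral_def by (simp add: scaleR_add_right)
    also have "\<dots> = (LINT y|lebesgue. ?M y) + (LINT y|lebesgue. ?G k y)"
      by (rule Bochner_Integration.integral_add[OF Mi Gi])
    finally have "(LINT y|lebesgue. ?G k y) - ?b - f x = - (kc *\<^sub>R ?err)"
      unfolding MM by (simp add: algebra_simps)
    then have "norm ((LINT y|lebesgue. ?G k y) - ?b - f x) = \<bar>kc\<bar> * norm ?err" by simp
    also have "norm ?err \<le> (LINT y|lebesgue. mass y * \<eta>)"
      by (rule order_trans[OF integral_norm_bound Bochner_Integration.integral_mono[OF integrable_norm[OF r2] _ bnd]])
        (use mass_int in simp)
    also have "\<bar>kc\<bar> * (LINT y|lebesgue. mass y * \<eta>) = \<bar>kc * (DIM('n pt) * unit_ball_vol DIM('n pt))\<bar> * \<eta>"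
      by (simp add: mass_eq abs_mult)
    also have "\<dots> = \<eta>" unfolding kc_mass by simp
    finally show ?thesis by (simp add: mult_left_mono)
  qed
  have "(\<lambda>k. norm ((LINT y|lebesgue. ?G k y) - ?b - f x)) \<longlonglongrightarrow>
      norm ((LINT y|lebesgue. indicator (\<Omega> - ball x \<epsilon>) y *\<^sub>R ?F y) - ?b - f x)"
    by (intro tendsto_intros lim)
  then show ?thesis
    unfolding set_lebesgue_integral_def by (rule LIMSEQ_le_const2) (use est in blast)
qed

end


subsection \<open>Integrability for almost every pole\<close>

text \<open>Tonelli: the integral of \<open>L (x - y)\<close> over \<open>x\<close> in a ball is
  bounded uniformly in \<open>y\<close>, so the double integral against the integrable
  \<open>norm (w y)\<close> is finite, and the inner integral over \<open>y\<close> is finite for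
  almost every \<open>x\<close>.\<close>

lemma AE_set_integrable_newton:
  fixes w :: "'a::euclidean_space \<Rightarrow> 'b::euclidean_space"
  assumes dim: "DIM('a) = 2 * n" "n \<ge> 1" and \<Omega>: "bounded \<Omega>" and w: "set_integrable lebesgue \<Omega> w"
  shows "AE x in lebesgue. x \<in> \<Omega> \<longrightarrow> (\<forall>a\<in>Basis. set_integrable lebesgue \<Omega> (\<lambda>y. newton n x a y *\<^sub>R w y))"
proof -
  define L where "L z = norm z / (z \<bullet> z) ^ n" for z :: 'a
  have L: "0 \<le> L z" for z by (simp add: L_def)
  have Lm[measurable]: "L \<in> borel_measurable borel" unfolding L_def[abs_def] by measurable
  have newton_le: "\<bar>newton n x a y\<bar> \<le> L (x - y)" if "a \<in> Basis" for x a y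
    unfolding newton_def L_def using Basis_le_norm[OF that, of "x - y"]
    by (simp add: abs_divide divide_right_mono)
  define w0 where "w0 y = indicator \<Omega> y *\<^sub>R w y" for y
  have w0: "integrable lebesgue w0" using w unfolding set_integrable_def w0_def .
  then have w0m: "w0 \<in> borel_measurable lebesgue" by (rule borel_measurable_integrable)
  \<comment> \<open>A Borel version of the norm of \<open>w0\<close>, since the product with
    \<open>lborel\<close> does not see functions that are merely Lebesgue measurable.\<close>
  obtain G where Gm[measurable]: "G \<in> borel_measurable lborel" and G: "AE y in lborel. norm (w0 y) = G y"
    using completion_ex_borel_measurable_real[of "\<lambda>y. norm (w0 y)" lborel] w0m by auto
  have fin: "(\<integral>\<^sup>+ y. ennreal (G y) \<partial>lborel) < \<infinity>"
  proof -
    have "(\<integral>\<^sup>+ y. ennreal (G y) \<partial>lborel) = (\<integral>\<^sup>+ y. ennreal (norm (w0 y)) \<partial>lborel)"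
      using G by (intro nn_integral_cong_AE) auto
    also have "\<dots> = (\<integral>\<^sup>+ y. ennreal (norm (w0 y)) \<partial>lebesgue)" by (simp add: nn_integral_completion)
    also have "\<dots> < \<infinity>" using w0 by (simp add: integrable_iff_bounded)
    finally show ?thesis .
  qed
  obtain R where R: "\<Omega> \<subseteq> cball 0 R" using \<Omega> by (auto simp: bounded_iff subset_iff)
  define g where "g r = r / (r\<^sup>2) ^ n * indicator {0..1} r" for r :: real
  have gm[measurable]: "g \<in> borel_measurable borel" unfolding g_def[abs_def] by measurable
  \<comment> \<open>Within distance 1 the kernel is the integrable radial function \<open>g\<close>;
    beyond it is at most 1, which costs the volume of the ball.\<close>
  define M where "M = (\<integral>\<^sup>+ z. ennreal (g (norm z)) \<partial>(lborel :: 'a measure)) + emeasure lborel (cball (0::'a) R)"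
  have "M < \<infinity>"
  proof -
    let ?\<omega> = "DIM('a) * unit_ball_vol DIM('a)"
    \<comment> \<open>The volume factor exactly cancels the singularity of \<open>g\<close>. At
      \<open>r = 0\<close> the quotient is 0, hence the interval open at the left.\<close>
    have "indicator {0..} r *\<^sub>R (?\<omega> * r ^ (DIM('a) - 1) * g r) = ?\<omega> * indicator {0<..1} r" for r
    proof (cases "0 < r")
      case True
      have "2 * n = Suc (DIM('a) - 1)" using dim by simp
      then have "(r\<^sup>2) ^ n = r ^ (DIM('a) - 1) * r" by (simp only: power_mult[symmetric] power_Suc2)
      then have "r ^ (DIM('a) - 1) * (r / (r\<^sup>2) ^ n) = 1" using True by simp
      moreover have "?\<omega> * r ^ (DIM('a) - 1) * g r = ?\<omega> * (r ^ (DIM('a) - 1) * (r / (r\<^sup>2) ^ n)) * indicator {0..1} r"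
        by (simp only: g_def mult_ac)
      ultimately have "?\<omega> * r ^ (DIM('a) - 1) * g r = ?\<omega> * indicator {0..1} r" by (simp only: mult_1_right)
      then show ?thesis using True by (simp add: indicator_def)
    qed (auto simp: g_def indicator_def)
    moreover have "integrable lborel (\<lambda>r::real. ?\<omega> * indicator {0<..1} r)"
      by (intro integrable_mult_right integrable_real_indicator) auto
    ultimately have "integrable lborel (\<lambda>z::'a. g (norm z))"
      by (simp only: lborel_integral_norm(1)[OF gm] set_integrable_def)
    then have "(\<integral>\<^sup>+ z. ennreal (norm (g (norm z))) \<partial>(lborel :: 'a measure)) < \<infinity>"
      by (simp only: integrable_iff_bounded)
    moreover have "norm (g (norm z)) = g (norm z)" for z :: 'a by (simp add: g_def)
    ultimately have "(\<integral>\<^sup>+ z. ennreal (g (norm z)) \<partial>(lborel :: 'a measure)) < \<infinity>"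
      by (simp only:)
    moreover have "emeasure lborel (cball (0::'a) R) < \<infinity>" by (rule emeasure_lborel_cball_finite)
    ultimately show ?thesis by (simp add: M_def)
  qed
  have inner: "(\<integral>\<^sup>+ x. indicator (cball 0 R) x * ennreal (L (x - y)) \<partial>lborel) \<le> M" for y
  proof -
    have "indicator (cball 0 R) x * ennreal (L (x - y)) \<le> ennreal (g (norm (y - x))) + indicator (cball 0 R) x" for x
    proof (cases "norm (y - x) \<le> 1")
      case True
      then have "L (x - y) = g (norm (y - x))"
        by (simp add: L_def g_def dot_square_norm norm_minus_commute)
      then show ?thesis by (simp add: indicator_def)
    next
      case False
      define r where "r = norm (y - x)"
      have "r ^ 1 \<le> r ^ (2 * n)" using False dim by (intro power_increasing) (auto simp: r_def)
      then have "L (x - y) \<le> 1"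
        using False by (simp add: L_def dot_square_norm r_def norm_minus_commute power_mult divide_le_eq_1)
      then show ?thesis by (auto simp: indicator_def intro: add_increasing)
    qed
    then have "(\<integral>\<^sup>+ x. indicator (cball 0 R) x * ennreal (L (x - y)) \<partial>lborel)
        \<le> (\<integral>\<^sup>+ x. ennreal (g (norm (y - x))) + indicator (cball 0 R) x \<partial>lborel)"
      by (intro nn_integral_mono) simp
    also have "\<dots> = (\<integral>\<^sup>+ x. ennreal (g (norm (y - x))) \<partial>lborel) + emeasure lborel (cball (0::'a) R)"
      by (subst nn_integral_add) (auto intro!: borel_measurable_indicator)
    also have "(\<integral>\<^sup>+ x. ennreal (g (norm (y - x))) \<partial>lborel) = (\<integral>\<^sup>+ x. ennreal (g (norm x)) \<partial>distr lborel borel (\<lambda>x. y - x))"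
      by (subst nn_integral_distr) auto
    finally show ?thesis unfolding lborel_distr_minus M_def .
  qed
  have jm: "(\<lambda>(x, y). indicator (cball 0 R) x * ennreal (L (x - y)) * ennreal (G y)) \<in> borel_measurable (lborel \<Otimes>\<^sub>M lborel)"
  proof -
    have [measurable]: "cball (0::'a) R \<in> sets borel" "G \<in> borel_measurable borel" using Gm by simp_all
    have "(\<lambda>(x, y). indicator (cball 0 R) x * ennreal (L (x - y)) * ennreal (G y)) \<in> borel_measurable (borel \<Otimes>\<^sub>M borel)"
      by measurable
    then show ?thesis
      by (simp add: measurable_cong_sets[OF sets_pair_measure_cong[OF sets_lborel sets_lborel] refl])
  qed
  have "(\<integral>\<^sup>+ x. \<integral>\<^sup>+ y. indicator (cball 0 R) x * ennreal (L (x - y)) * ennreal (G y) \<partial>lborel \<partial>lborel) =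
      (\<integral>\<^sup>+ y. \<integral>\<^sup>+ x. indicator (cball 0 R) x * ennreal (L (x - y)) * ennreal (G y) \<partial>lborel \<partial>lborel)"
    by (rule lborel_pair.Fubini'[OF jm, symmetric])
  also have "\<dots> = (\<integral>\<^sup>+ y. (\<integral>\<^sup>+ x. indicator (cball 0 R) x * ennreal (L (x - y)) \<partial>lborel) * ennreal (G y) \<partial>lborel)"
  proof (intro nn_integral_cong nn_integral_multc)
    fix y :: 'a
    have [measurable]: "cball (0::'a) R \<in> sets borel" by simp
    have "(\<lambda>x. indicator (cball 0 R) x * ennreal (L (x - y))) \<in> borel_measurable borel" by measurable
    then show "(\<lambda>x. indicator (cball 0 R) x * ennreal (L (x - y))) \<in> borel_measurable lborel" by simp
  qed
  also have "\<dots> \<le> (\<integral>\<^sup>+ y. M * ennreal (G y) \<partial>lborel)"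
    by (intro nn_integral_mono mult_right_mono inner) simp
  also have "\<dots> = M * (\<integral>\<^sup>+ y. ennreal (G y) \<partial>lborel)" by (rule nn_integral_cmult) measurable
  also have "\<dots> < \<infinity>" using fin \<open>M < \<infinity>\<close> by (simp add: ennreal_mult_less_top)
  finally have "AE x in lborel. (\<integral>\<^sup>+ y. indicator (cball 0 R) x * ennreal (L (x - y)) * ennreal (G y) \<partial>lborel) \<noteq> \<infinity>"
    by (intro nn_integral_PInf_AE[OF lborel.borel_measurable_nn_integral[OF jm]]) (simp only: less_top infinity_ennreal_def not_False_eq_True)
  then have "AE x in lebesgue. (\<integral>\<^sup>+ y. indicator (cball 0 R) x * ennreal (L (x - y)) * ennreal (G y) \<partial>lborel) \<noteq> \<infinity>"
    by (rule AE_completion)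
  then show ?thesis
  proof eventually_elim
    fix x assume fin: "(\<integral>\<^sup>+ y. indicator (cball 0 R) x * ennreal (L (x - y)) * ennreal (G y) \<partial>lborel) \<noteq> \<infinity>"
    show "x \<in> \<Omega> \<longrightarrow> (\<forall>a\<in>Basis. set_integrable lebesgue \<Omega> (\<lambda>y. newton n x a y *\<^sub>R w y))"
    proof (intro impI ballI)
      fix a :: 'a assume x: "x \<in> \<Omega>" and a: "a \<in> Basis"
      have nm: "newton n x a \<in> borel_measurable borel" unfolding newton_def[abs_def] by measurable
      have "integrable lebesgue (\<lambda>y. newton n x a y *\<^sub>R w0 y)"
      proof (rule integrableI_bounded)
        show "(\<lambda>y. newton n x a y *\<^sub>R w0 y) \<in> borel_measurable lebesgue"
          using nm by (intro borel_measurable_scaleR w0m) (auto intro: measurable_completion)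
        have "(\<integral>\<^sup>+ y. ennreal (norm (newton n x a y *\<^sub>R w0 y)) \<partial>lebesgue)
            = (\<integral>\<^sup>+ y. ennreal (norm (newton n x a y *\<^sub>R w0 y)) \<partial>lborel)" by (simp add: nn_integral_completion)
        also have "\<dots> \<le> (\<integral>\<^sup>+ y. indicator (cball 0 R) x * ennreal (L (x - y)) * ennreal (G y) \<partial>lborel)"
        proof (rule nn_integral_mono_AE, use G in eventually_elim)
          fix y assume y: "norm (w0 y) = G y"
          have "ennreal (norm (newton n x a y *\<^sub>R w0 y)) \<le> ennreal (L (x - y) * norm (w0 y))"
            using newton_le[OF a, of x y] by (intro ennreal_leI) (simp add: mult_right_mono)
          also have "\<dots> = indicator (cball 0 R) x * ennreal (L (x - y)) * ennreal (G y)"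
            using x R L[of "x - y"] norm_ge_zero[of "w0 y"] unfolding y by (auto simp: ennreal_mult indicator_def)
          finally show "ennreal (norm (newton n x a y *\<^sub>R w0 y)) \<le> indicator (cball 0 R) x * ennreal (L (x - y)) * ennreal (G y)" .
        qed
        also have "\<dots> < \<infinity>" using fin by (simp add: less_top)
        finally show "(\<integral>\<^sup>+ y. ennreal (norm (newton n x a y *\<^sub>R w0 y)) \<partial>lebesgue) < \<infinity>" .
      qed
      then show "set_integrable lebesgue \<Omega> (\<lambda>y. newton n x a y *\<^sub>R w y)"
        by (simp add: set_integrable_def w0_def mult.commute)
    qed
  qed
qed

section \<open>Transfer to the kernel \<open>H\<close> and passage to the limit at the pole\<close>

context spinor_region
begin

lemma dim_pt: "DIM('n pt) = 2 * CARD('n)" "CARD('n) \<ge> 1"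
  using n by simp_all

lemma surface_integral_H:
  assumes x: "x \<in> \<Omega>"
  shows "integrable S (\<lambda>y. H C (x - y) (normal_column (\<nu> y) (f y)))"
    and "(LINT y|S. H C (x - y) (normal_column (\<nu> y) (f y))) = (LINT y|S. cauchy x y (normal_column (\<nu> y) (f y)))"
proof -
  have eq: "H C (x - y) (normal_column (\<nu> y) (f y)) = cauchy x y (normal_column (\<nu> y) (f y))" if "y \<in> space S" for y
  proof (rule H_eq_cauchy)
    show "x \<noteq> y" using x that open_\<Omega> by (auto simp: surface_measure_space[OF S] frontier_def interior_open)
  qed
  obtain r where r: "r > 0" "cball x r \<subseteq> \<Omega>" using open_\<Omega> x open_contains_cball by metis
  have "integrable S (\<lambda>y. cauchy x y (normal_column (\<nu> y) (f y)))"
  proof (rule cutoff_identity(1)[OF x])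
    \<comment> \<open>Any cutoff supported well inside \<Omega> will do; here the squared radius of
      the shell is at most three quarters of \<open>r\<^sup>2\<close>.\<close>
    show "0 < r / 2" "0 < r\<^sup>2 / 2" using r by auto
    show "y \<in> \<Omega>" if "(x - y) \<bullet> (x - y) \<le> (r / 2)\<^sup>2 + r\<^sup>2 / 2" for y
    proof -
      have "(r / 2)\<^sup>2 = r\<^sup>2 / 4" by (simp add: power_divide)
      then have "(norm (x - y))\<^sup>2 \<le> r\<^sup>2"
        using that zero_le_power2[of r] unfolding dot_square_norm by linarith
      then have "norm (x - y) \<le> r" using r(1) power2_le_imp_le[of "norm (x - y)" r] by simp
      then show ?thesis using r(2) by (auto simp: dist_norm)
    qed
  qed
  then show "integrable S (\<lambda>y. H C (x - y) (normal_column (\<nu> y) (f y)))"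
    by (subst Bochner_Integration.integrable_cong[OF refl eq])
  show "(LINT y|S. H C (x - y) (normal_column (\<nu> y) (f y))) = (LINT y|S. cauchy x y (normal_column (\<nu> y) (f y)))"
    by (rule Bochner_Integration.integral_cong[OF refl eq])
qed

text \<open>The indicator hides the point \<open>y = x\<close>, the only one at which the two
  kernels may differ.\<close>

lemma H_outside:
  assumes "\<epsilon> > 0"
  shows "indicator (\<Omega> - ball x \<epsilon>) y *\<^sub>R H C (x - y) (Df y) = indicator (\<Omega> - ball x \<epsilon>) y *\<^sub>R cauchy x y (Df y)"
  using assms H_eq_cauchy[of x y] by (cases "x = y") auto

text \<open>\<open>outside_ball_estimate\<close> with the bound \<open>\<eta> / 2\<close> holds for
  all small radii at once, by continuity of \<open>f\<close> at \<open>x\<close>. The limit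
  therefore exists without integrability at the pole.\<close>

lemma has_singular_integral_H:
  assumes x: "x \<in> \<Omega>"
  shows "has_singular_integral (\<lambda>y. H C (x - y) (Df y)) (f x + (LINT y|S. H C (x - y) (normal_column (\<nu> y) (f y)))) \<Omega> x"
  unfolding has_singular_integral_def
proof (intro conjI allI impI)
  show "set_integrable lebesgue (\<Omega> - ball x \<epsilon>) (\<lambda>y. H C (x - y) (Df y))" if "\<epsilon> > 0" for \<epsilon>
    using set_integrable_cauchy_outside[OF that, of x] unfolding set_integrable_def H_outside[OF that] .
  have "x \<in> U" using x closure_\<Omega> closure_subset by blast
  then have fc: "isCont f x" using f open_U by (simp add: continuous_on_eq_continuous_at)
  obtain r where r: "r > 0" "ball x r \<subseteq> \<Omega>" using open_\<Omega> x open_contains_ball by metis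
  let ?b = "LINT y|S. H C (x - y) (normal_column (\<nu> y) (f y))"
  show "((\<lambda>\<epsilon>. LINT y:(\<Omega> - ball x \<epsilon>)|lebesgue. H C (x - y) (Df y)) \<longlongrightarrow> f x + ?b) (at_right 0)"
  proof (rule tendstoI)
    fix \<eta> :: real assume "\<eta> > 0"
    then obtain d where d: "d > 0" "\<And>y. dist y x < d \<Longrightarrow> dist (f y) (f x) < \<eta> / 2"
      using fc unfolding continuous_at_eps_delta by (metis half_gt_zero)
    define \<rho> where "\<rho> = min r d"
    have \<rho>: "\<rho> > 0" "ball x \<rho> \<subseteq> \<Omega>" using r d by (auto simp: \<rho>_def)
    have "dist (LINT y:(\<Omega> - ball x \<epsilon>)|lebesgue. H C (x - y) (Df y)) (f x + ?b) < \<eta>" if e: "0 < \<epsilon>" "\<epsilon> < \<rho>" for \<epsilon>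
    proof -
      have "norm ((LINT y:(\<Omega> - ball x \<epsilon>)|lebesgue. cauchy x y (Df y))
        - (LINT y|S. cauchy x y (normal_column (\<nu> y) (f y))) - f x) \<le> \<eta> / 2"
      proof (rule outside_ball_estimate[OF x e \<rho>(2)])
        show "norm (f y - f x) \<le> \<eta> / 2" if "y \<in> ball x \<rho>" for y
          using d(2)[of y] that by (auto simp: \<rho>_def dist_norm norm_minus_commute intro: less_imp_le)
      qed
      then show ?thesis
        using \<open>\<eta> > 0\<close> unfolding set_lebesgue_integral_def H_outside[OF e(1)] surface_integral_H(2)[OF x] dist_norm
        by (simp add: algebra_simps)
    qed
    then show "\<forall>\<^sub>F \<epsilon> in at_right 0. dist (LINT y:(\<Omega> - ball x \<epsilon>)|lebesgue. H C (x - y) (Df y)) (f x + ?b) < \<eta>"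
      unfolding eventually_at_right_field using \<rho>(1) by blast
  qed
qed

lemma AE_set_integrable_H: "AE x in lebesgue. x \<in> \<Omega> \<longrightarrow> set_integrable lebesgue \<Omega> (\<lambda>y. H C (x - y) (Df y))"
proof -
  have "AE x in lebesgue. \<forall>p\<in>UNIV. x \<in> \<Omega> \<longrightarrow> (\<forall>a\<in>Basis. set_integrable lebesgue \<Omega> (\<lambda>y. newton CARD('n) x a y *\<^sub>R g (fst p) (snd p) y))"
    by (rule eventually_ball_finite) (auto intro!: AE_set_integrable_newton[OF dim_pt bounded_\<Omega>] set_integrable_g)
  then show ?thesis
  proof eventually_elim
    fix x assume *: "\<forall>p\<in>UNIV. x \<in> \<Omega> \<longrightarrow> (\<forall>a\<in>Basis. set_integrable lebesgue \<Omega> (\<lambda>y. newton CARD('n) x a y *\<^sub>R g (fst p) (snd p) y))"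
    show "x \<in> \<Omega> \<longrightarrow> set_integrable lebesgue \<Omega> (\<lambda>y. H C (x - y) (Df y))"
    proof
      assume x: "x \<in> \<Omega>"
      have "set_integrable lebesgue \<Omega> (\<lambda>y. newton CARD('n) x (axis A (axis j 1)) y *\<^sub>R g A k y)" for A j k
        using *[rule_format, of "(A, k)", OF _ x axis_axis_in_Basis] by simp
      then have i: "integrable lebesgue (\<lambda>y. indicator \<Omega> y *\<^sub>R cauchy x y (Df y))"
        unfolding set_integrable_def[symmetric] by (rule set_integrable_cauchy)
      \<comment> \<open>At the pole \<open>H\<close> takes an unspecified value; changing the
        integrand at this single point preserves measurability and integrability.\<close>
      have eq: "indicator \<Omega> y *\<^sub>R H C (x - y) (Df y) = (if y \<in> {x} then H C (0 :: 'n pt) (Df x) else indicator \<Omega> y *\<^sub>R cauchy x y (Df y))" for y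
        using x H_eq_cauchy[of x y] by auto
      have "{x} \<in> null_sets lebesgue" by (simp add: negligible_iff_null_sets[symmetric])
      then have ae: "AE y in lebesgue. y \<notin> {x}" by (rule AE_not_in)
      show "set_integrable lebesgue \<Omega> (\<lambda>y. H C (x - y) (Df y))"
        unfolding set_integrable_def eq
      proof (rule integrable_cong_AE_imp[OF i])
        show "(\<lambda>y. if y \<in> {x} then H C (0 :: 'n pt) (Df x) else indicator \<Omega> y *\<^sub>R cauchy x y (Df y)) \<in> borel_measurable lebesgue"
          by (rule measurable_If_set[OF _ borel_measurable_integrable[OF i]]) auto
        show "AE y in lebesgue. indicator \<Omega> y *\<^sub>R cauchy x y (Df y) = (if y \<in> {x} then H C (0 :: 'n pt) (Df x) else indicator \<Omega> y *\<^sub>R cauchy x y (Df y))"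
          using ae by eventually_elim simp
      qed
    qed
  qed
qed

end

text \<open>The integrals outside balls shrinking to \<open>x\<close> converge to the Lebesgue
  integral by dominated convergence, the point \<open>x\<close> being a null set; limits are
  unique.\<close>

lemma has_singular_integral_lebesgue:
  assumes s: "has_singular_integral F I \<Omega> x" and i: "set_integrable lebesgue \<Omega> F"
  shows "(LINT y:\<Omega>|lebesgue. F y) = I"
proof -
  define \<epsilon> where "\<epsilon> k = inverse (real (Suc k))" for k
  have eps: "filterlim \<epsilon> (at_right 0) sequentially"
    unfolding filterlim_at \<epsilon>_def using LIMSEQ_inverse_real_of_nat by (auto simp del: of_nat_Suc)
  have "((\<lambda>\<epsilon>. LINT y:(\<Omega> - ball x \<epsilon>)|lebesgue. F y) \<longlongrightarrow> I) (at_right 0)"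
    using s unfolding has_singular_integral_def by blast
  from filterlim_compose[OF this eps]
  have "(\<lambda>k. LINT y:(\<Omega> - ball x (\<epsilon> k))|lebesgue. F y) \<longlonglongrightarrow> I" .
  moreover have "(\<lambda>k. LINT y|lebesgue. indicator (\<Omega> - ball x (\<epsilon> k)) y *\<^sub>R F y) \<longlonglongrightarrow> (LINT y|lebesgue. indicator \<Omega> y *\<^sub>R F y)"
  proof (rule integral_dominated_convergence[where w = "\<lambda>y. norm (indicator \<Omega> y *\<^sub>R F y)"])
    have e: "\<epsilon> k > 0" for k by (simp add: \<epsilon>_def)
    show "(\<lambda>y. indicator \<Omega> y *\<^sub>R F y) \<in> borel_measurable lebesgue"
      using i unfolding set_integrable_def by (rule borel_measurable_integrable)
    show "(\<lambda>y. indicator (\<Omega> - ball x (\<epsilon> k)) y *\<^sub>R F y) \<in> borel_measurable lebesgue" for k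
      using s e unfolding has_singular_integral_def set_integrable_def by (blast intro: borel_measurable_integrable)
    show "integrable lebesgue (\<lambda>y. norm (indicator \<Omega> y *\<^sub>R F y))"
      using i unfolding set_integrable_def by (rule integrable_norm)
    have "{x} \<in> null_sets lebesgue" by (simp add: negligible_iff_null_sets[symmetric])
    then have "AE y in lebesgue. y \<notin> {x}" by (rule AE_not_in)
    then show "AE y in lebesgue. (\<lambda>k. indicator (\<Omega> - ball x (\<epsilon> k)) y *\<^sub>R F y) \<longlonglongrightarrow> indicator \<Omega> y *\<^sub>R F y"
    proof eventually_elim
      fix y assume "y \<notin> {x}"
      then have "dist x y > 0" by simp
      then have "\<forall>\<^sub>F k in sequentially. \<epsilon> k < dist x y"
        unfolding \<epsilon>_def by (rule order_tendstoD(2)[OF LIMSEQ_inverse_real_of_nat])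
      then have "\<forall>\<^sub>F k in sequentially. indicator (\<Omega> - ball x (\<epsilon> k)) y *\<^sub>R F y = indicator \<Omega> y *\<^sub>R F y"
        by eventually_elim (simp add: indicator_def)
      then show "(\<lambda>k. indicator (\<Omega> - ball x (\<epsilon> k)) y *\<^sub>R F y) \<longlonglongrightarrow> indicator \<Omega> y *\<^sub>R F y"
        by (rule tendsto_eventually)
    qed
    show "AE y in lebesgue. norm (indicator (\<Omega> - ball x (\<epsilon> k)) y *\<^sub>R F y) \<le> norm (indicator \<Omega> y *\<^sub>R F y)" for k
      by (intro AE_I2) (simp add: indicator_def)
  qed
  ultimately show ?thesis unfolding set_lebesgue_integral_def by (rule LIMSEQ_unique[rotated])
qed

theorem theorem3p1:
  fixes f :: "'n::{finite,linorder} pt \<Rightarrow> 'm::{finite,linorder} ext"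
    and \<Omega> U :: "'n pt set"
    and \<nu> :: "'n pt \<Rightarrow> 'n pt"
    and S :: "'n pt measure"
    and C :: real
  assumes "CARD('n) \<ge> 3" and "CARD('m) = CARD('n) div 2"
    and "C > 0" and "fundamental_solution_Delta2 (G0 C :: 'n pt \<Rightarrow> real)"
    and "domain \<Omega>" and "bounded \<Omega>" and "C2_boundary \<Omega>"
    and "domain U" and "closure \<Omega> \<subseteq> U"
    and "\<forall>x\<in>U. f x \<in> spinor_plus CARD('n)" and "continuous_on U f" and "W12 U f"
    and "\<forall>y\<in>frontier \<Omega>. unit_outer_normal \<Omega> y (\<nu> y)"
    and "surface_measure \<Omega> S"
  shows "(\<forall>x\<in>\<Omega>. integrable S (\<lambda>y. H C (x - y) (normal_column (\<nu> y) (f y))) \<and>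
           (\<exists>I. has_singular_integral (\<lambda>y. H C (x - y) (D0 (weak_partial U) f y)) I \<Omega> x \<and>
                f x = - (LINT y|S. H C (x - y) (normal_column (\<nu> y) (f y))) + I))
       \<and> (\<forall>x\<in>\<Omega>. set_integrable lebesgue \<Omega> (\<lambda>y. H C (x - y) (D0 (weak_partial U) f y)) \<longrightarrow>
             f x = - (LINT y|S. H C (x - y) (normal_column (\<nu> y) (f y)))
                   + (LINT y:\<Omega>|lebesgue. H C (x - y) (D0 (weak_partial U) f y)))
       \<and> (AE x in lebesgue. x \<in> \<Omega> \<longrightarrow>
             set_integrable lebesgue \<Omega> (\<lambda>y. H C (x - y) (D0 (weak_partial U) f y)))"
proof -
  have weak: "has_weak_partial U A j f (weak_partial U A j f)" for A j
  proof -
    have "\<exists>g. has_weak_partial U A j f g" using assms(12) by (simp add: W12_def)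
    then show ?thesis unfolding weak_partial_def by (rule someI_ex)
  qed
  interpret spinor_region \<Omega> U S \<nu> f "\<lambda>A j. weak_partial U A j f" C
  proof
    show "weak_deriv U (axis A (axis j 1)) f (weak_partial U A j f)" for A and j :: 'n
      using weak[of A j] by (simp add: has_weak_partial_def weak_deriv_def partial_def)
  qed (use assms in \<open>auto simp: domain_def\<close>)
  have Df: "D0 (weak_partial U) f = Df" by (simp add: D0_def Df_def fun_eq_iff)
  \<comment> \<open>The improper integral has already been computed by
    \<open>has_singular_integral_H\<close>; this is the witness for \<open>I\<close>
    rearranged.\<close>
  have rep: "f x = - (LINT y|S. H C (x - y) (normal_column (\<nu> y) (f y)))
      + (f x + (LINT y|S. H C (x - y) (normal_column (\<nu> y) (f y))))" for x by simp
  show ?thesis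
    unfolding Df
  proof (intro conjI ballI impI AE_set_integrable_H)
    fix x assume x: "x \<in> \<Omega>"
    show "integrable S (\<lambda>y. H C (x - y) (normal_column (\<nu> y) (f y)))" by (rule surface_integral_H(1)[OF x])
    show "\<exists>I. has_singular_integral (\<lambda>y. H C (x - y) (Df y)) I \<Omega> x \<and>
                f x = - (LINT y|S. H C (x - y) (normal_column (\<nu> y) (f y))) + I"
      using has_singular_integral_H[OF x] rep by blast
    assume "set_integrable lebesgue \<Omega> (\<lambda>y. H C (x - y) (Df y))"
    from has_singular_integral_lebesgue[OF has_singular_integral_H[OF x] this]
    show "f x = - (LINT y|S. H C (x - y) (normal_column (\<nu> y) (f y))) + (LINT y:\<Omega>|lebesgue. H C (x - y) (Df y))"
      by simp
  qed
qed

end
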